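(* Let $\mathcal{A}$ be an infinite von Neumann factor and let $\Phi:\mathcal{A}\to\mathcal{A}$ be a linear map. Then $\Phi$ preserves the extreme points of the unit ball of $\mathcal{A}$ if and only if at least one of the following holds: (i) there are a unitary operator $U\in\mathcal{A}$ and a unital $*$-homomorphism $\Psi:\mathcal{A}\to\mathcal{A}$ such that $\Phi(A)=U\Psi(A)$ for all $A\in\mathcal{A}$; (ii) there are a unitary operator $U'\in\mathcal{A}$ and a unital $*$-antihomomorphism $\Psi':\mathcal{A}\to\mathcal{A}$ such that $\Phi(A)=U'\Psi'(A)$ for all $A\in\mathcal{A}$.
   Context: All Hilbert spaces and algebras are complex, and linear means complex-linear. A von Neumann factor is a von Neumann algebra, acting on some Hilbert space, whose centre consists of the scalar multiples of the identity $I$; it is infinite if $I$ is an infinite projection, i.e. $I$ is Murray-von Neumann equivalent in $\mathcal{A}$ to a proper subprojection of $I$. The unit ball of $\mathcal{A}$ is $\{A\in\mathcal{A}:\|A\|\le 1\}$, where $\|\cdot\|$ is the operator norm. A linear map $\Phi:\mathcal{A}\to\mathcal{A}$ preserves the extreme points of the unit ball if $\Phi(A)$ is an extreme point of the unit ball of $\mathcal{A}$ whenever $A$ is one. No continuity of $\Phi$ is assumed. A $*$-homomorphism (resp. $*$-antihomomorphism) is a linear map $\Psi$ with $\Psi(A^* )=\Psi(A)^*$ and $\Psi(AB)=\Psi(A)\Psi(B)$ (resp. $\Psi(AB)=\Psi(B)\Psi(A)$) for all $A,B$; it is unital if $\Psi(I)=I$. No weak or $\sigma$-weak continuity is required of it.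 *)

theory Defs
  imports "HOL-Analysis.Analysis"
begin

text \<open>Complex Hilbert spaces. The inner product is linear in the first and conjugate-linear
  in the second argument. Completeness is part of the class \<^class>\<open>banach\<close>.\<close>

class chilbert_space = banach +
  fixes scaleC :: "complex \<Rightarrow> 'a \<Rightarrow> 'a" (infixr "*\<^sub>C" 75)
    and cinner :: "'a \<Rightarrow> 'a \<Rightarrow> complex"
  assumes scaleC_add_right: "c *\<^sub>C (x + y) = c *\<^sub>C x + c *\<^sub>C y"
    and scaleC_add_left: "(c + d) *\<^sub>C x = c *\<^sub>C x + d *\<^sub>C x"
    and scaleC_scaleC: "c *\<^sub>C d *\<^sub>C x = (c * d) *\<^sub>C x"
    and scaleR_scaleC: "r *\<^sub>R x = complex_of_real r *\<^sub>C x"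
    and cinner_commute: "cinner x y = cnj (cinner y x)"
    and cinner_add_left: "cinner (x + y) z = cinner x z + cinner y z"
    and cinner_scaleC_left: "cinner (c *\<^sub>C x) y = c * cinner x y"
    and cinner_self: "cinner x x = complex_of_real ((norm x)\<^sup>2)"

lemma cinner_add_right: "cinner x (y + z) = cinner x y + cinner x z"
  by (metis cinner_commute cinner_add_left complex_cnj_add)

lemma cinner_scaleC_right: "cinner x (c *\<^sub>C y) = cnj c * cinner x y"
  by (metis cinner_commute cinner_scaleC_left complex_cnj_mult)

lemma cinner_scaleR_left: "cinner (r *\<^sub>R x) y = complex_of_real r * cinner x y"
  by (simp add: scaleR_scaleC cinner_scaleC_left)

lemma cinner_scaleR_right: "cinner x (r *\<^sub>R y) = complex_of_real r * cinner x y"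
  by (simp add: scaleR_scaleC cinner_scaleC_right)

lemma cinner_minus_left: "cinner (- x) y = - cinner x y"
  using cinner_scaleR_left[of "-1" x y] by simp

lemma cinner_minus_right: "cinner x (- y) = - cinner x y"
  using cinner_scaleR_right[of x "-1" y] by simp

lemma cinner_diff_left: "cinner (x - y) z = cinner x z - cinner y z"
  using cinner_add_left[of x "- y" z] by (simp add: cinner_minus_left)

lemma cinner_diff_right: "cinner x (y - z) = cinner x y - cinner x z"
  using cinner_add_right[of x y "- z"] by (simp add: cinner_minus_right)

lemma Re_cinner_commute: "Re (cinner x y) = Re (cinner y x)"
  by (subst cinner_commute) simp

lemma norm_add_sq: "(norm (x + y))\<^sup>2 = (norm x)\<^sup>2 + (norm y)\<^sup>2 + 2 * Re (cinner x y)"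
proof -
  have "(norm (x + y))\<^sup>2 = Re (cinner (x + y) (x + y))"
    by (simp only: cinner_self Re_complex_of_real)
  also have "\<dots> = Re (cinner x x) + Re (cinner x y) + Re (cinner y x) + Re (cinner y y)"
    by (simp add: cinner_add_left cinner_add_right)
  also have "\<dots> = (norm x)\<^sup>2 + (norm y)\<^sup>2 + 2 * Re (cinner x y)"
    using Re_cinner_commute[of x y] by (simp add: cinner_self)
  finally show ?thesis .
qed

lemma Re_cinner_le: "Re (cinner x y) \<le> norm x * norm y"
proof -
  have "(norm (x + y))\<^sup>2 \<le> (norm x + norm y)\<^sup>2"
    by (intro power_mono norm_triangle_ineq norm_ge_zero)
  then show ?thesis
    by (simp add: norm_add_sq power2_sum)
qed

lemma norm_scaleC: "norm (c *\<^sub>C x) = cmod c * norm x"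
proof -
  have "complex_of_real ((norm (c *\<^sub>C x))\<^sup>2) = cinner (c *\<^sub>C x) (c *\<^sub>C x)"
    by (simp only: cinner_self)
  also have "\<dots> = (c * cnj c) * cinner x x"
    by (simp add: cinner_scaleC_left cinner_scaleC_right mult_ac)
  also have "\<dots> = complex_of_real ((cmod c)\<^sup>2) * complex_of_real ((norm x)\<^sup>2)"
    by (simp only: cinner_self complex_norm_square)
  also have "\<dots> = complex_of_real ((cmod c * norm x)\<^sup>2)"
    by (simp only: of_real_mult power_mult_distrib)
  finally have "complex_of_real ((norm (c *\<^sub>C x))\<^sup>2) = complex_of_real ((cmod c * norm x)\<^sup>2)" .
  then have "(norm (c *\<^sub>C x))\<^sup>2 = (cmod c * norm x)\<^sup>2"
    by (simp only: of_real_eq_iff)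
  then show ?thesis
    by (simp add: power2_eq_iff_nonneg)
qed

lemma cinner_ext:
  assumes "\<And>x. cinner x y = cinner x z"
  shows "y = z"
proof -
  have "cinner (y - z) (y - z) = 0"
    using assms by (simp add: cinner_diff_right)
  then show ?thesis by (simp add: cinner_self)
qed

text \<open>Operators are elements of the library type of bounded (real-)linear functions, whose norm
  is the operator norm; the bounded complex-linear operators form the subset \<open>clinear_ops\<close>.\<close>

definition clinear_ops :: "('h::chilbert_space \<Rightarrow>\<^sub>L 'h) set" where
  "clinear_ops = {A :: 'h \<Rightarrow>\<^sub>L 'h. \<forall>c x. A (c *\<^sub>C x) = c *\<^sub>C A x}"

lift_definition scaleC_op :: "complex \<Rightarrow> ('h::chilbert_space \<Rightarrow>\<^sub>L 'h) \<Rightarrow> ('h \<Rightarrow>\<^sub>L 'h)"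
  is "\<lambda>c A x. c *\<^sub>C A x"
proof -
  fix c :: complex and A :: "'h \<Rightarrow> 'h"
  assume A: "bounded_linear A"
  have "bounded_linear (\<lambda>x::'h. c *\<^sub>C x)"
    by (rule bounded_linear_intro[where K = "cmod c"])
      (simp_all add: scaleC_add_right scaleR_scaleC scaleC_scaleC mult.commute norm_scaleC)
  from bounded_linear_compose[OF this A] show "bounded_linear (\<lambda>x. c *\<^sub>C A x)" .
qed

text \<open>Every complex-linear operator has exactly one adjoint, see \<open>adjoint_op_works\<close> below;
  on other operators \<open>adjoint_op\<close> is unspecified.\<close>

definition adjoint_op :: "('h::chilbert_space \<Rightarrow>\<^sub>L 'h) \<Rightarrow> ('h \<Rightarrow>\<^sub>L 'h)" where
  "adjoint_op A = (THE B :: 'h \<Rightarrow>\<^sub>L 'h. \<forall>x y. cinner (A x) y = cinner x (B y))"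

lemma riesz:
  fixes f :: "'h::chilbert_space \<Rightarrow> complex"
  assumes add: "\<And>x y. f (x + y) = f x + f y"
    and scale: "\<And>c x. f (c *\<^sub>C x) = c * f x"
    and bound: "\<And>x. Re (f x) \<le> K * norm x"
  shows "\<exists>z. \<forall>x. f x = cinner x z"
proof -
  define g where "g = (\<lambda>x. (norm x)\<^sup>2 - 2 * Re (f x))"
  define m where "m = (INF x. g x)"
  have fR: "f (r *\<^sub>R x) = complex_of_real r * f x" for r x
    by (simp add: scaleR_scaleC scale)
  have "- K\<^sup>2 \<le> g x" for x
  proof -
    have "0 \<le> (norm x - K)\<^sup>2" by simp
    then show ?thesis
      using bound[of x] unfolding g_def power2_diff by (simp add: mult.commute)
  qed
  then have bdd: "bdd_below (range g)" by (rule bdd_belowI2)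
  have m_le: "m \<le> g x" for x
    unfolding m_def by (rule cINF_lower[OF bdd]) simp
  have "\<exists>x. g x < m + 1 / real (Suc n)" for n
    using cINF_less_iff[OF _ bdd, of "m + 1 / real (Suc n)"]
    unfolding m_def by auto
  then obtain X where X: "\<And>n. g (X n) < m + 1 / real (Suc n)" by metis
  have para: "(norm (x - y))\<^sup>2 \<le> 2 * (g x - m) + 2 * (g y - m)" for x y
  proof -
    have "(norm (x - y))\<^sup>2 = (norm x)\<^sup>2 + (norm y)\<^sup>2 - 2 * Re (cinner x y)"
      using norm_add_sq[of x "- y"] by (simp add: cinner_minus_right)
    moreover have "g ((1/2) *\<^sub>R (x + y)) =
        ((norm x)\<^sup>2 + (norm y)\<^sup>2 + 2 * Re (cinner x y)) / 4 - (Re (f x) + Re (f y))"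
      unfolding g_def norm_scaleR power_mult_distrib norm_add_sq fR add
      by (simp add: power2_eq_square) argo
    ultimately show ?thesis
      using m_le[of "(1/2) *\<^sub>R (x + y)"] unfolding g_def by (simp add: field_simps)
  qed
  have "Cauchy X"
  proof (rule metric_CauchyI)
    fix e :: real
    assume e: "0 < e"
    obtain N where N: "1 / real (Suc N) < e\<^sup>2 / 4"
      using e reals_Archimedean[of "e\<^sup>2 / 4"] by (auto simp: inverse_eq_divide)
    have small: "g (X n) - m < e\<^sup>2 / 4" if "N \<le> n" for n
    proof -
      have "1 / real (Suc n) \<le> 1 / real (Suc N)" using that by (simp add: field_simps)
      then show ?thesis using X[of n] N by linarith
    qed
    have "dist (X i) (X j) < e" if "N \<le> i" "N \<le> j" for i j
    proof -
      have "(norm (X i - X j))\<^sup>2 < e\<^sup>2"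
        using para[of "X i" "X j"] small[OF that(1)] small[OF that(2)] by argo
      then show ?thesis using e by (simp add: dist_norm power2_less_imp_less)
    qed
    then show "\<exists>M. \<forall>i\<ge>M. \<forall>j\<ge>M. dist (X i) (X j) < e" by blast
  qed
  then obtain z where z: "X \<longlonglongrightarrow> z"
    using Cauchy_convergent_iff convergent_def by blast
  have blf: "bounded_linear (\<lambda>x. Re (f x))"
  proof (rule bounded_linear_intro[where K = K])
    fix x
    have "Re (f (- x)) = - Re (f x)" using fR[of "-1" x] by simp
    then show "norm (Re (f x)) \<le> norm x * K"
      using bound[of x] bound[of "- x"] by (simp add: mult.commute)
  qed (simp_all add: add fR)
  have "(\<lambda>n. g (X n)) \<longlonglongrightarrow> g z"
    unfolding g_def by (intro tendsto_intros bounded_linear.tendsto[OF blf] z)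
  moreover have "(\<lambda>n. g (X n)) \<longlonglongrightarrow> m"
  proof (rule tendsto_sandwich[of "\<lambda>_. m" _ _ "\<lambda>n. m + 1 / real (Suc n)"])
    show "(\<lambda>n. m + 1 / real (Suc n)) \<longlonglongrightarrow> m"
      using tendsto_add[OF tendsto_const[of m] LIMSEQ_inverse_real_of_nat]
      by (simp add: inverse_eq_divide)
  qed (intro always_eventually allI m_le less_imp_le[OF X] tendsto_const)+
  ultimately have gz: "g z = m" by (rule LIMSEQ_unique)
  have re_le: "Re (f x) \<le> Re (cinner x z)" for x
  proof (rule ccontr)
    assume "\<not> ?thesis"
    then have d: "0 < Re (f x) - Re (cinner x z)" (is "0 < ?d") by simp
    define t where "t = ?d / ((norm x)\<^sup>2 + 1)"
    have pos: "0 < (norm x)\<^sup>2 + 1" by (simp add: add_nonneg_pos)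
    have t: "0 < t" using d pos by (simp add: t_def)
    have "g (z + t *\<^sub>R x) = g z + t\<^sup>2 * (norm x)\<^sup>2 - 2 * t * ?d"
      unfolding g_def norm_add_sq add fR
      by (simp add: cinner_scaleR_right power_mult_distrib Re_cinner_commute[of z x] algebra_simps)
    then have "2 * t * ?d \<le> t\<^sup>2 * (norm x)\<^sup>2"
      using m_le[of "z + t *\<^sub>R x"] gz by simp
    then have "t * (2 * ?d) \<le> t * (t * (norm x)\<^sup>2)"
      by (simp add: power2_eq_square algebra_simps)
    then have "2 * ?d \<le> t * (norm x)\<^sup>2" using t by simp
    also have "\<dots> \<le> t * ((norm x)\<^sup>2 + 1)" using t by simp
    also have "\<dots> = ?d" using pos by (simp add: t_def)
    finally show False using d by simp
  qed
  have re: "Re (f x) = Re (cinner x z)" for x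
    using re_le[of x] re_le[of "- x"] fR[of "-1" x] by (simp add: cinner_minus_left)
  have "f x = cinner x z" for x
    using re[of x] re[of "\<i> *\<^sub>C x"] by (simp add: complex_eq_iff scale cinner_scaleC_left)
  then show ?thesis by blast
qed

lemma adjoint_op_works:
  fixes A :: "'h::chilbert_space \<Rightarrow>\<^sub>L 'h"
  assumes "A \<in> clinear_ops"
  shows "cinner (A x) y = cinner x (adjoint_op A y)"
proof -
  have "\<exists>z. \<forall>x. cinner (A x) y = cinner x z" for y
  proof (rule riesz[where K = "norm A * norm y"])
    fix x
    have "Re (cinner (A x) y) \<le> norm (A x) * norm y" by (rule Re_cinner_le)
    also have "\<dots> \<le> norm A * norm x * norm y"
      by (intro mult_right_mono norm_blinfun norm_ge_zero)
    finally show "Re (cinner (A x) y) \<le> norm A * norm y * norm x" by (simp add: mult_ac)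
  qed (use assms in \<open>simp_all add: clinear_ops_def blinfun.add_right cinner_add_left
      cinner_scaleC_left\<close>)
  then obtain B where B: "\<And>x y. cinner (A x) y = cinner x (B y)" by metis
  have "bounded_linear B"
  proof (rule bounded_linear_intro[where K = "norm A"])
    show "B (y + z) = B y + B z" for y z
      by (rule cinner_ext) (simp add: cinner_add_right B[symmetric])
    show "B (r *\<^sub>R y) = r *\<^sub>R B y" for r y
      by (rule cinner_ext) (simp add: cinner_scaleR_right B[symmetric])
    show "norm (B y) \<le> norm y * norm A" for y
    proof -
      have "(norm (B y))\<^sup>2 = Re (cinner (B y) (B y))"
        by (simp only: cinner_self Re_complex_of_real)
      also have "\<dots> = Re (cinner (A (B y)) y)" by (simp add: B)
      also have "\<dots> \<le> norm (A (B y)) * norm y" by (rule Re_cinner_le)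
      also have "\<dots> \<le> norm A * norm (B y) * norm y"
        by (intro mult_right_mono norm_blinfun norm_ge_zero)
      finally have "norm (B y) * norm (B y) \<le> norm (B y) * (norm y * norm A)"
        by (simp add: power2_eq_square mult_ac)
      then show ?thesis
        by (cases "B y = 0") simp_all
    qed
  qed
  then have app: "blinfun_apply (Blinfun B) = B" by (rule bounded_linear_Blinfun_apply)
  have "\<exists>!C. \<forall>x y. cinner (A x) y = cinner x (blinfun_apply C y)"
  proof (rule ex1I[of _ "Blinfun B"])
    show "\<forall>x y. cinner (A x) y = cinner x (Blinfun B y)" by (simp add: app B)
    show "C = Blinfun B" if "\<forall>x y. cinner (A x) y = cinner x (blinfun_apply C y)" for C
      by (rule blinfun_eqI, rule cinner_ext) (use that B app in metis)
  qed
  from theI'[OF this] show ?thesis unfolding adjoint_op_def by blast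
qed

definition commutant :: "('h::chilbert_space \<Rightarrow>\<^sub>L 'h) set \<Rightarrow> ('h \<Rightarrow>\<^sub>L 'h) set" where
  "commutant S = {B \<in> clinear_ops. \<forall>A\<in>S. A o\<^sub>L B = B o\<^sub>L A}"

text \<open>Dixmier's definition: a *-subalgebra of the algebra of all bounded operators that equals
  its bicommutant (so it contains the identity).\<close>

definition von_neumann_algebra :: "('h::chilbert_space \<Rightarrow>\<^sub>L 'h) set \<Rightarrow> bool" where
  "von_neumann_algebra M \<longleftrightarrow>
    M \<subseteq> clinear_ops \<and>
    (\<forall>A\<in>M. \<forall>B\<in>M. A + B \<in> M \<and> A o\<^sub>L B \<in> M) \<and>
    (\<forall>c. \<forall>A\<in>M. scaleC_op c A \<in> M) \<and>
    (\<forall>A\<in>M. adjoint_op A \<in> M) \<and>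
    commutant (commutant M) = M"

definition centre :: "('h::chilbert_space \<Rightarrow>\<^sub>L 'h) set \<Rightarrow> ('h \<Rightarrow>\<^sub>L 'h) set" where
  "centre M = {A \<in> M. \<forall>B\<in>M. A o\<^sub>L B = B o\<^sub>L A}"

definition factor :: "('h::chilbert_space \<Rightarrow>\<^sub>L 'h) set \<Rightarrow> bool" where
  "factor M \<longleftrightarrow> von_neumann_algebra M \<and> centre M = range (\<lambda>c. scaleC_op c id_blinfun)"

definition projection :: "('h::chilbert_space \<Rightarrow>\<^sub>L 'h) \<Rightarrow> bool" where
  "projection P \<longleftrightarrow> P \<in> clinear_ops \<and> adjoint_op P = P \<and> P o\<^sub>L P = P"

text \<open>Meant for projections \<open>P\<close> and \<open>Q\<close>; being a projection is not part of the definition.\<close>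

definition mvn_equiv ::
    "('h::chilbert_space \<Rightarrow>\<^sub>L 'h) set \<Rightarrow> ('h \<Rightarrow>\<^sub>L 'h) \<Rightarrow> ('h \<Rightarrow>\<^sub>L 'h) \<Rightarrow> bool" where
  "mvn_equiv M P Q \<longleftrightarrow> (\<exists>V\<in>M. adjoint_op V o\<^sub>L V = P \<and> V o\<^sub>L adjoint_op V = Q)"

definition subprojection ::
    "('h::chilbert_space \<Rightarrow>\<^sub>L 'h) \<Rightarrow> ('h \<Rightarrow>\<^sub>L 'h) \<Rightarrow> bool" where
  "subprojection Q P \<longleftrightarrow> projection Q \<and> projection P \<and>
    range (blinfun_apply Q) \<subseteq> range (blinfun_apply P)"

definition infinite_projection ::
    "('h::chilbert_space \<Rightarrow>\<^sub>L 'h) set \<Rightarrow> ('h \<Rightarrow>\<^sub>L 'h) \<Rightarrow> bool" where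
  "infinite_projection M P \<longleftrightarrow>
    P \<in> M \<and> projection P \<and> (\<exists>Q\<in>M. subprojection Q P \<and> Q \<noteq> P \<and> mvn_equiv M P Q)"

definition infinite_factor :: "('h::chilbert_space \<Rightarrow>\<^sub>L 'h) set \<Rightarrow> bool" where
  "infinite_factor M \<longleftrightarrow> factor M \<and> infinite_projection M id_blinfun"

definition unitary_op :: "('h::chilbert_space \<Rightarrow>\<^sub>L 'h) \<Rightarrow> bool" where
  "unitary_op U \<longleftrightarrow> U \<in> clinear_ops \<and>
    adjoint_op U o\<^sub>L U = id_blinfun \<and> U o\<^sub>L adjoint_op U = id_blinfun"

text \<open>A map on \<open>M\<close> is represented by a function on the whole operator type; its
  values outside \<open>M\<close> are irrelevant throughout.\<close>

definition clinear_map_on ::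
    "('h::chilbert_space \<Rightarrow>\<^sub>L 'h) set \<Rightarrow> (('h \<Rightarrow>\<^sub>L 'h) \<Rightarrow> ('h \<Rightarrow>\<^sub>L 'h)) \<Rightarrow> bool" where
  "clinear_map_on M \<Phi> \<longleftrightarrow> \<Phi> \<in> M \<rightarrow> M \<and>
    (\<forall>A\<in>M. \<forall>B\<in>M. \<Phi> (A + B) = \<Phi> A + \<Phi> B) \<and>
    (\<forall>c. \<forall>A\<in>M. \<Phi> (scaleC_op c A) = scaleC_op c (\<Phi> A))"

definition star_homomorphism_on ::
    "('h::chilbert_space \<Rightarrow>\<^sub>L 'h) set \<Rightarrow> (('h \<Rightarrow>\<^sub>L 'h) \<Rightarrow> ('h \<Rightarrow>\<^sub>L 'h)) \<Rightarrow> bool" where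
  "star_homomorphism_on M \<Psi> \<longleftrightarrow> clinear_map_on M \<Psi> \<and>
    (\<forall>A\<in>M. \<Psi> (adjoint_op A) = adjoint_op (\<Psi> A)) \<and>
    (\<forall>A\<in>M. \<forall>B\<in>M. \<Psi> (A o\<^sub>L B) = \<Psi> A o\<^sub>L \<Psi> B)"

definition star_antihomomorphism_on ::
    "('h::chilbert_space \<Rightarrow>\<^sub>L 'h) set \<Rightarrow> (('h \<Rightarrow>\<^sub>L 'h) \<Rightarrow> ('h \<Rightarrow>\<^sub>L 'h)) \<Rightarrow> bool" where
  "star_antihomomorphism_on M \<Psi> \<longleftrightarrow> clinear_map_on M \<Psi> \<and>
    (\<forall>A\<in>M. \<Psi> (adjoint_op A) = adjoint_op (\<Psi> A)) \<and>
    (\<forall>A\<in>M. \<forall>B\<in>M. \<Psi> (A o\<^sub>L B) = \<Psi> B o\<^sub>L \<Psi> A)"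

definition unital :: "(('h::chilbert_space \<Rightarrow>\<^sub>L 'h) \<Rightarrow> ('h \<Rightarrow>\<^sub>L 'h)) \<Rightarrow> bool" where
  "unital \<Psi> \<longleftrightarrow> \<Psi> id_blinfun = id_blinfun"

definition unit_ball :: "('h::chilbert_space \<Rightarrow>\<^sub>L 'h) set \<Rightarrow> ('h \<Rightarrow>\<^sub>L 'h) set" where
  "unit_ball M = {A \<in> M. norm A \<le> 1}"

definition preserves_extreme_points ::
    "('h::chilbert_space \<Rightarrow>\<^sub>L 'h) set \<Rightarrow> (('h \<Rightarrow>\<^sub>L 'h) \<Rightarrow> ('h \<Rightarrow>\<^sub>L 'h)) \<Rightarrow> bool" where
  "preserves_extreme_points M \<Phi> \<longleftrightarrow>
    (\<forall>A. A extreme_point_of unit_ball M \<longrightarrow> \<Phi> A extreme_point_of unit_ball M)"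

end

theory Submission
  imports Defs
begin

text \<open>In a factor the extreme points of the unit ball are the isometries and the co-isometries.
  Every self-adjoint \<open>S\<close> is the first-order part of a path of unitaries, so if a linear map \<open>\<Theta>\<close>
  sends unitaries to isometries or co-isometries and \<open>X = \<Theta> 1\<close> is an isometry, the second-order
  variation gives \<open>(\<Theta> S)\<^sup>\<dagger> * \<Theta> S = X\<^sup>\<dagger> * \<Theta> (S * S)\<close>. Applied to \<open>\<Theta> A = \<Phi> (A * V)\<close> and
  \<open>\<Theta> A = \<Phi> (V * A)\<close> this shows that \<open>\<Phi> 1\<close> is an isometry (co-isometry) as soon as one extreme point
  \<open>V\<close> is sent to an isometry (co-isometry). Two isometries with orthogonal ranges, which exist
  because the factor is infinite, exclude that all extreme points are sent to isometries; hence
  \<open>\<Phi> 1\<close> is unitary and \<open>(\<Phi> 1)\<^sup>\<dagger> * \<Phi>\<close> is a Jordan *-homomorphism \<open>\<Psi>\<close>. It is multiplicative or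
  antimultiplicative according to whether it sends one of these two isometries to an isometry or to
  a co-isometry.\<close>

section \<open>The algebra of bounded complex-linear operators\<close>

text \<open>Operators are produced by iterations and monotone nets whose limits stay in the algebra:
  a contraction for sqrt(1 - A^2), which gives the unitaries near \<open>1\<close>, Newton's
  iteration for polar parts, and strong limits of increasing partial isometries. Continuity of the
  given map is not assumed; it follows because a small self-adjoint element is, up to a scalar, a
  difference of two unitaries, and unitaries have images of norm at most 1. The extreme points form
  two families, while the second-order argument needs the images along a path to stay in one of
  them. A co-isometry at distance less than 1 from an isometry is an isometry itself, so near
  \<open>1\<close> the path cannot change family. A factor is prime: A M B = 0 forces A = 0 or B =
  0. This gives both the description of the extreme points and the comparison of projections.
  Comparison in turn promotes one proper isometry to two isometries with orthogonal ranges: a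
  Hilbert hotel made from the isometry yields a nonzero projection with two orthogonal copies of
  itself below it, and a maximal such projection is compared with its complement.\<close>

lemma cinner_zero_left [simp]: "cinner 0 x = 0"
  using cinner_diff_left[of 0 0 x] by simp

lemma cinner_zero_right [simp]: "cinner x 0 = 0"
  using cinner_diff_right[of x 0 0] by simp

lemma norm_diff_sq: "(norm (x - y))\<^sup>2 = (norm x)\<^sup>2 + (norm y)\<^sup>2 - 2 * Re (cinner x y)"
  using norm_add_sq[of x "- y"] by (simp add: cinner_minus_right)

lemma scaleC_zero_right [simp]: "c *\<^sub>C (0::'h::chilbert_space) = 0"
  using scaleC_add_right[of c "0::'h" 0] by simp

lemma scaleC_minus_right: "c *\<^sub>C (- x) = - (c *\<^sub>C (x::'h::chilbert_space))"
  by (metis add.right_inverse add_eq_0_iff scaleC_add_right scaleC_zero_right)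

lemma scaleC_diff_right: "c *\<^sub>C (x - y) = c *\<^sub>C x - c *\<^sub>C (y::'h::chilbert_space)"
  using scaleC_add_right[of c x "- y"] by (simp add: scaleC_minus_right)

lemma scaleC_one [simp]: "1 *\<^sub>C x = (x::'h::chilbert_space)"
  using scaleR_scaleC[of 1 x] by simp

lemma scaleC_scaleR: "c *\<^sub>C r *\<^sub>R x = r *\<^sub>R c *\<^sub>C (x::'h::chilbert_space)"
  by (simp add: scaleR_scaleC scaleC_scaleC mult.commute)

lemma adjoint_op_clinear:
  fixes A :: "'h::chilbert_space \<Rightarrow>\<^sub>L 'h"
  assumes "A \<in> clinear_ops"
  shows "adjoint_op A \<in> clinear_ops"
  unfolding clinear_ops_def
proof (intro CollectI allI)
  show "adjoint_op A (c *\<^sub>C x) = c *\<^sub>C adjoint_op A x" for c x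
    by (rule cinner_ext) (simp add: adjoint_op_works[OF assms, symmetric] cinner_scaleC_right)
qed

text \<open>Complex-linear operators get a type of their own, so that algebraic simplification,
  limits and completeness apply with \<open>*\<close> as composition. \<open>cop_map\<close> leads
  back to the operators of the statement.\<close>

typedef (overloaded) 'h cop = "clinear_ops :: ('h::chilbert_space \<Rightarrow>\<^sub>L 'h) set"
  morphisms of_cop cop
  by (intro exI[of _ 0]) (simp add: clinear_ops_def)

setup_lifting type_definition_cop

lift_definition app :: "'h::chilbert_space cop \<Rightarrow> 'h \<Rightarrow> 'h" (infixr "\<rhd>" 85) is blinfun_apply .

lemma cop_eqI: "(\<And>x. A \<rhd> x = B \<rhd> x) \<Longrightarrow> A = B"
  by transfer (rule blinfun_eqI)

instantiation cop :: (chilbert_space) real_normed_algebra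
begin

lift_definition zero_cop :: "'a cop" is 0 by (simp add: clinear_ops_def)
lift_definition plus_cop :: "'a cop \<Rightarrow> 'a cop \<Rightarrow> 'a cop" is "(+)"
  by (simp add: clinear_ops_def blinfun.add_left scaleC_add_right)
lift_definition minus_cop :: "'a cop \<Rightarrow> 'a cop \<Rightarrow> 'a cop" is "(-)"
  by (simp add: clinear_ops_def blinfun.diff_left scaleC_diff_right)
lift_definition uminus_cop :: "'a cop \<Rightarrow> 'a cop" is uminus
  by (simp add: clinear_ops_def blinfun.minus_left scaleC_minus_right)
lift_definition times_cop :: "'a cop \<Rightarrow> 'a cop \<Rightarrow> 'a cop" is "(o\<^sub>L)"
  by (simp add: clinear_ops_def)
lift_definition scaleR_cop :: "real \<Rightarrow> 'a cop \<Rightarrow> 'a cop" is scaleR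
  by (simp add: clinear_ops_def blinfun.scaleR_left scaleC_scaleR)
lift_definition norm_cop :: "'a cop \<Rightarrow> real" is norm .
definition sgn_cop :: "'a cop \<Rightarrow> 'a cop" where "sgn_cop A = inverse (norm A) *\<^sub>R A"
definition dist_cop :: "'a cop \<Rightarrow> 'a cop \<Rightarrow> real" where "dist_cop A B = norm (A - B)"
definition uniformity_cop :: "('a cop \<times> 'a cop) filter"
  where "uniformity_cop = (INF e\<in>{0 <..}. principal {(x, y). dist x y < e})"
definition open_cop :: "'a cop set \<Rightarrow> bool"
  where "open_cop S = (\<forall>x\<in>S. \<forall>\<^sub>F (x', y) in uniformity. x' = x \<longrightarrow> y \<in> S)"

instance
proof
  fix A B C :: "'a cop" and r s :: real
  show "A * B * C = A * (B * C)" by transfer (rule blinfun_eqI, simp)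
  show "(A + B) * C = A * C + B * C"
    by transfer (rule blinfun_eqI, simp add: blinfun.add_left)
  show "A * (B + C) = A * B + A * C"
    by transfer (rule blinfun_eqI, simp add: blinfun.add_left blinfun.add_right)
  show "(r *\<^sub>R A) * B = r *\<^sub>R (A * B)"
    by transfer (rule blinfun_eqI, simp add: blinfun.scaleR_left)
  show "A * (r *\<^sub>R B) = r *\<^sub>R (A * B)"
    by transfer (rule blinfun_eqI, simp add: blinfun.scaleR_left blinfun.scaleR_right)
  show "norm (A * B) \<le> norm A * norm B" by transfer (rule norm_blinfun_compose)
  show "norm (A + B) \<le> norm A + norm B" by transfer (rule norm_triangle_ineq)
qed (fact dist_cop_def uniformity_cop_def open_cop_def sgn_cop_def
    | transfer; simp add: algebra_simps)+

end

text \<open>The unit is added through \<open>monoid_mult\<close> because on the zero space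
  \<open>1 = 0\<close>, whereas the classes of rings with unit demand
  \<open>0 \<noteq> 1\<close>.\<close>

instantiation cop :: (chilbert_space) monoid_mult
begin
lift_definition one_cop :: "'a cop" is id_blinfun by (simp add: clinear_ops_def)
instance by standard (transfer; rule blinfun_eqI; simp)+
end

lift_definition star :: "'h::chilbert_space cop \<Rightarrow> 'h cop" ("_\<^sup>\<dagger>" [1000] 1000) is adjoint_op
  by (rule adjoint_op_clinear)

lift_definition cscale :: "complex \<Rightarrow> 'h::chilbert_space cop \<Rightarrow> 'h cop" (infixr "\<odot>" 75) is scaleC_op
  by (simp add: clinear_ops_def scaleC_op.rep_eq scaleC_scaleC mult.commute)

lemma app_one [simp]: "1 \<rhd> x = x" by transfer simp
lemma app_zero [simp]: "0 \<rhd> x = 0" by transfer simp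
lemma app_mult [simp]: "(A * B) \<rhd> x = A \<rhd> B \<rhd> x" by transfer simp
lemma app_add: "(A + B) \<rhd> x = A \<rhd> x + B \<rhd> x" by transfer (simp add: blinfun.add_left)
lemma app_diff: "(A - B) \<rhd> x = A \<rhd> x - B \<rhd> x" by transfer (simp add: blinfun.diff_left)
lemma app_minus: "(- A) \<rhd> x = - (A \<rhd> x)" by transfer (simp add: blinfun.minus_left)
lemma app_scaleR: "(r *\<^sub>R A) \<rhd> x = r *\<^sub>R (A \<rhd> x)" by transfer (simp add: blinfun.scaleR_left)
lemma app_cscale: "(c \<odot> A) \<rhd> x = c *\<^sub>C (A \<rhd> x)" by transfer (simp add: scaleC_op.rep_eq)
lemma app_zero_right [simp]: "A \<rhd> 0 = 0" by transfer simp
lemma app_add_right: "A \<rhd> (x + y) = A \<rhd> x + A \<rhd> y" by transfer (simp add: blinfun.add_right)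
lemma app_diff_right: "A \<rhd> (x - y) = A \<rhd> x - A \<rhd> y" by transfer (simp add: blinfun.diff_right)
lemma app_scaleC_right: "A \<rhd> (c *\<^sub>C x) = c *\<^sub>C (A \<rhd> x)" by transfer (simp add: clinear_ops_def)
lemma app_scaleR_right: "A \<rhd> (r *\<^sub>R x) = r *\<^sub>R (A \<rhd> x)" by (simp add: scaleR_scaleC app_scaleC_right)

lemmas app_simps = app_add app_diff app_minus app_scaleR app_cscale app_add_right app_diff_right
  app_scaleC_right app_scaleR_right

lemma norm_app: "norm (A \<rhd> x) \<le> norm A * norm x" by transfer (rule norm_blinfun)

lemma norm_cop_bound: "0 \<le> b \<Longrightarrow> (\<And>x. norm (A \<rhd> x) \<le> b * norm x) \<Longrightarrow> norm A \<le> b"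
  by transfer (rule norm_blinfun_bound)

lemma norm_app_le: "norm A \<le> 1 \<Longrightarrow> norm (A \<rhd> x) \<le> norm x"
  using norm_app[of A x] mult_right_mono[of "norm A" 1 "norm x"] by auto

lemma bounded_linear_app: "bounded_linear (app A)"
  by (transfer; simp add: blinfun.bounded_linear_right)

lemmas tendsto_app [tendsto_intros] = bounded_linear.tendsto[OF bounded_linear_app]

lemma cop_of_bounded:
  assumes "\<And>x y. f (x + y) = f x + f y" "\<And>c x. f (c *\<^sub>C x) = c *\<^sub>C f x"
    and "\<And>x. norm (f x) \<le> K * norm x"
  shows "\<exists>A. \<forall>x. A \<rhd> x = f x"
proof -
  have bl: "bounded_linear f"
    by (rule bounded_linear_intro[where K=K]) (use assms in \<open>simp_all add: scaleR_scaleC mult.commute\<close>)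
  show ?thesis
    by (rule exI[of _ "cop (Blinfun f)"])
      (simp add: app.rep_eq cop_inverse clinear_ops_def bounded_linear_Blinfun_apply[OF bl] assms(2))
qed

lemma cinner_star: "cinner (A \<rhd> x) y = cinner x (A\<^sup>\<dagger> \<rhd> y)"
  by transfer (rule adjoint_op_works)

lemma cinner_star': "cinner (A\<^sup>\<dagger> \<rhd> x) y = cinner x (A \<rhd> y)"
  by (metis cinner_star cinner_commute)

lemma star_eqI: "(\<And>x y. cinner (A \<rhd> x) y = cinner x (B \<rhd> y)) \<Longrightarrow> A\<^sup>\<dagger> = B"
  by (rule cop_eqI, rule cinner_ext) (simp add: cinner_star)

lemma star_star [simp]: "A\<^sup>\<dagger>\<^sup>\<dagger> = A"
  by (rule star_eqI) (rule cinner_star')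
lemma star_mult [simp]: "(A * B)\<^sup>\<dagger> = B\<^sup>\<dagger> * A\<^sup>\<dagger>"
  by (rule star_eqI) (simp add: cinner_star)
lemma star_add [simp]: "(A + B)\<^sup>\<dagger> = A\<^sup>\<dagger> + B\<^sup>\<dagger>"
  by (rule star_eqI) (simp add: cinner_star app_simps cinner_add_left cinner_add_right)
lemma star_diff [simp]: "(A - B)\<^sup>\<dagger> = A\<^sup>\<dagger> - B\<^sup>\<dagger>"
  by (rule star_eqI) (simp add: cinner_star app_simps cinner_diff_left cinner_diff_right)
lemma star_zero [simp]: "0\<^sup>\<dagger> = 0"
  by (rule star_eqI) simp
lemma star_one [simp]: "1\<^sup>\<dagger> = 1"
  by (rule star_eqI) simp
lemma star_scaleR [simp]: "(r *\<^sub>R A)\<^sup>\<dagger> = r *\<^sub>R A\<^sup>\<dagger>"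
  by (rule star_eqI) (simp add: cinner_star app_simps cinner_scaleR_left cinner_scaleR_right)
lemma star_cscale [simp]: "(c \<odot> A)\<^sup>\<dagger> = cnj c \<odot> A\<^sup>\<dagger>"
  by (rule star_eqI) (simp add: cinner_star app_simps cinner_scaleC_left cinner_scaleC_right)
lemma star_power [simp]: "(A ^ n)\<^sup>\<dagger> = A\<^sup>\<dagger> ^ n"
  by (induction n) (simp_all add: power_commutes)
lemma star_inject [simp]: "A\<^sup>\<dagger> = B\<^sup>\<dagger> \<longleftrightarrow> A = B"
  by (metis star_star)

lemma norm_star_le: "norm A\<^sup>\<dagger> \<le> norm A"
proof (rule norm_cop_bound)
  show "norm (A\<^sup>\<dagger> \<rhd> x) \<le> norm A * norm x" for x
  proof -
    have "(norm (A\<^sup>\<dagger> \<rhd> x))\<^sup>2 = Re (cinner (A\<^sup>\<dagger> \<rhd> x) (A\<^sup>\<dagger> \<rhd> x))"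
      by (simp only: cinner_self Re_complex_of_real)
    also have "\<dots> = Re (cinner x (A \<rhd> A\<^sup>\<dagger> \<rhd> x))" by (simp only: cinner_star')
    also have "\<dots> \<le> norm x * norm (A \<rhd> A\<^sup>\<dagger> \<rhd> x)" by (rule Re_cinner_le)
    also have "\<dots> \<le> norm x * (norm A * norm (A\<^sup>\<dagger> \<rhd> x))"
      by (intro mult_left_mono norm_app norm_ge_zero)
    finally have "norm (A\<^sup>\<dagger> \<rhd> x) * norm (A\<^sup>\<dagger> \<rhd> x) \<le> (norm A * norm x) * norm (A\<^sup>\<dagger> \<rhd> x)"
      by (simp add: power2_eq_square mult_ac)
    then show ?thesis by (cases "A\<^sup>\<dagger> \<rhd> x = 0") simp_all
  qed
qed simp

lemma norm_star [simp]: "norm A\<^sup>\<dagger> = norm A"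
  using norm_star_le[of A] norm_star_le[of "A\<^sup>\<dagger>"] by simp

lemma tendsto_star [tendsto_intros]:
  "(f \<longlongrightarrow> A) F \<Longrightarrow> ((\<lambda>i. (f i)\<^sup>\<dagger>) \<longlongrightarrow> A\<^sup>\<dagger>) F"
  by (rule bounded_linear.tendsto[where f = star])
    (rule bounded_linear_intro[where K=1], auto)

lemma cscale_add_right: "c \<odot> (A + B) = c \<odot> A + c \<odot> B"
  by (rule cop_eqI) (simp add: app_simps scaleC_add_right)
lemma cscale_diff_right: "c \<odot> (A - B) = c \<odot> A - c \<odot> B"
  by (rule cop_eqI) (simp add: app_simps scaleC_diff_right)
lemma cscale_cscale [simp]: "c \<odot> d \<odot> A = (c * d) \<odot> A"
  by (rule cop_eqI) (simp add: app_simps scaleC_scaleC)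
lemma cscale_mult_left [simp]: "(c \<odot> A) * B = c \<odot> (A * B)"
  by (rule cop_eqI) (simp add: app_simps)
lemma cscale_mult_right [simp]: "A * (c \<odot> B) = c \<odot> (A * B)"
  by (rule cop_eqI) (simp add: app_simps)
lemma cscale_of_real: "complex_of_real r \<odot> A = r *\<^sub>R A"
  by (rule cop_eqI) (simp add: app_simps scaleR_scaleC)
lemma cscale_minus_left [simp]: "(- c) \<odot> A = - (c \<odot> A)"
  using cscale_cscale[of "-1" c A] cscale_of_real[of "-1" "c \<odot> A"] by simp
lemma cscale_one [simp]: "1 \<odot> A = A"
  using cscale_of_real[of 1 A] by simp
lemma cscale_zero_left [simp]: "0 \<odot> A = 0"
  using cscale_of_real[of 0 A] by simp
lemma cscale_zero_right [simp]: "c \<odot> 0 = 0"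
  by (rule cop_eqI) (simp add: app_simps)
lemma cscale_scaleR [simp]: "c \<odot> (r *\<^sub>R A) = r *\<^sub>R (c \<odot> A)"
  by (rule cop_eqI) (simp add: app_simps scaleC_scaleR)
lemma norm_cscale: "norm (c \<odot> A) = cmod c * norm A"
proof (rule antisym)
  have *: "norm (c \<odot> A) \<le> cmod c * norm A" for c and A :: "'a cop"
  proof (rule norm_cop_bound)
    show "norm ((c \<odot> A) \<rhd> x) \<le> cmod c * norm A * norm x" for x
      using mult_left_mono[OF norm_app[of A x], of "cmod c"]
      by (simp add: app_simps norm_scaleC mult_ac)
  qed simp
  show "norm (c \<odot> A) \<le> cmod c * norm A" by (rule *)
  show "cmod c * norm A \<le> norm (c \<odot> A)"
  proof (cases "c = 0")
    case False
    have "norm A = norm (inverse c \<odot> c \<odot> A)"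
      using False by simp
    also have "\<dots> \<le> cmod (inverse c) * norm (c \<odot> A)" by (rule *)
    also have "\<dots> = norm (c \<odot> A) / cmod c"
      by (simp only: norm_inverse divide_inverse mult.commute)
    finally show ?thesis using False by (simp add: field_simps)
  qed simp
qed

text \<open>Limits are taken among the real-linear operators and remain complex-linear. The fixed
  point argument for unitaries rests on this completeness.\<close>

instance cop :: (chilbert_space) banach
proof
  fix X :: "nat \<Rightarrow> 'a cop"
  assume "Cauchy X"
  then have "Cauchy (\<lambda>n. of_cop (X n))"
    unfolding Cauchy_def dist_norm by (simp add: norm_cop.rep_eq minus_cop.rep_eq)
  then obtain L where L: "(\<lambda>n. of_cop (X n)) \<longlonglongrightarrow> L"
    using Cauchy_convergent_iff convergent_def by blast
  have pt: "(\<lambda>n. of_cop (X n) x) \<longlonglongrightarrow> L x" for x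
    by (rule bounded_linear.tendsto[OF blinfun.bounded_linear_left L])
  have "L (c *\<^sub>C x) = c *\<^sub>C L x" for c x
  proof (rule LIMSEQ_unique[OF pt])
    have "bounded_linear (\<lambda>x::'a. c *\<^sub>C x)"
      using bounded_linear_app[of "c \<odot> 1"] by (simp add: app_cscale[abs_def])
    moreover have "of_cop (X n) (c *\<^sub>C x) = c *\<^sub>C of_cop (X n) x" for n
      using of_cop[of "X n"] by (simp add: clinear_ops_def)
    ultimately show "(\<lambda>n. of_cop (X n) (c *\<^sub>C x)) \<longlonglongrightarrow> c *\<^sub>C L x"
      using bounded_linear.tendsto[OF _ pt] by simp
  qed
  then have "of_cop (cop L) = L"
    by (intro cop_inverse) (simp add: clinear_ops_def)
  with L have "X \<longlonglongrightarrow> cop L"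
    by (simp add: tendsto_iff dist_norm norm_cop.rep_eq minus_cop.rep_eq)
  then show "convergent X" by (auto simp: convergent_def)
qed

section \<open>Positivity, isometries and projections\<close>

lemma cinner_eq_norm: "Re (cinner (A\<^sup>\<dagger> \<rhd> A \<rhd> x) x) = (norm (A \<rhd> x))\<^sup>2"
  by (simp add: cinner_star' cinner_self)

text \<open>Expanding the form at \<open>x + y\<close> and using self-adjointness gives
  \<open>Re (cinner (A \<rhd> x) y) = 0\<close>; then take \<open>y = A \<rhd> x\<close>.\<close>

lemma selfadj_zero:
  assumes sa: "A\<^sup>\<dagger> = A" and "\<And>x. Re (cinner (A \<rhd> x) x) = 0"
  shows "A = 0"
proof (rule cop_eqI)
  fix x
  have "Re (cinner (A \<rhd> (x + y)) (x + y)) = Re (cinner (A \<rhd> x) x) + Re (cinner (A \<rhd> y) y)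
      + Re (cinner (A \<rhd> x) y) + Re (cinner (A \<rhd> y) x)" for y
    by (simp add: app_simps cinner_add_left cinner_add_right)
  moreover have "Re (cinner (A \<rhd> y) x) = Re (cinner (A \<rhd> x) y)" for y
    by (metis Re_cinner_commute cinner_star sa)
  ultimately have "Re (cinner (A \<rhd> x) (A \<rhd> x)) = 0"
    using assms(2) by (metis add_cancel_right_left add_0 double_zero)
  then show "A \<rhd> x = 0 \<rhd> x" by (simp add: cinner_self)
qed

lemma isom_iff_norm: "A\<^sup>\<dagger> * A = 1 \<longleftrightarrow> (\<forall>x. norm (A \<rhd> x) = norm x)"
proof
  assume "A\<^sup>\<dagger> * A = 1"
  then have "A\<^sup>\<dagger> \<rhd> A \<rhd> x = x" for x by (metis app_mult app_one)
  then show "\<forall>x. norm (A \<rhd> x) = norm x"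
    using cinner_eq_norm[of A] by (simp add: cinner_self)
next
  assume *: "\<forall>x. norm (A \<rhd> x) = norm x"
  have "A\<^sup>\<dagger> * A - 1 = 0"
  proof (rule selfadj_zero)
    show "Re (cinner ((A\<^sup>\<dagger> * A - 1) \<rhd> x) x) = 0" for x
      using * cinner_eq_norm[of A x] by (simp add: app_simps cinner_diff_left cinner_self)
  qed simp
  then show "A\<^sup>\<dagger> * A = 1" by simp
qed

lemma star_mult_self_zero [simp]: "A\<^sup>\<dagger> * A = 0 \<longleftrightarrow> A = 0"
proof
  assume "A\<^sup>\<dagger> * A = 0"
  then have "A\<^sup>\<dagger> \<rhd> A \<rhd> x = 0" for x by (metis app_mult app_zero)
  then have "A \<rhd> x = 0" for x using cinner_eq_norm[of A x] by simp
  then show "A = 0" by (intro cop_eqI) simp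
qed simp

lemma norm_isom_le: "A\<^sup>\<dagger> * A = 1 \<Longrightarrow> norm A \<le> 1"
  by (rule norm_cop_bound) (simp_all add: isom_iff_norm)

definition iso_coiso :: "'h::chilbert_space cop \<Rightarrow> bool" where
  "iso_coiso A \<longleftrightarrow> A\<^sup>\<dagger> * A = 1 \<or> A * A\<^sup>\<dagger> = 1"

lemma iso_coiso_star: "iso_coiso A\<^sup>\<dagger> \<longleftrightarrow> iso_coiso A"
  by (auto simp: iso_coiso_def)

lemma norm_iso_coiso_le: "iso_coiso A \<Longrightarrow> norm A \<le> 1"
  using norm_isom_le[of A] norm_isom_le[of "A\<^sup>\<dagger>"] by (auto simp: iso_coiso_def)

definition proj :: "'h::chilbert_space cop \<Rightarrow> bool" where
  "proj P \<longleftrightarrow> P\<^sup>\<dagger> = P \<and> P * P = P"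

lemma norm_proj_sq: "proj P \<Longrightarrow> Re (cinner (P \<rhd> x) x) = (norm (P \<rhd> x))\<^sup>2"
  using cinner_eq_norm[of P x] by (metis app_mult proj_def)

lemma proj_cinner: "proj P \<Longrightarrow> cinner (P \<rhd> x) (y - P \<rhd> y) = 0"
  by (metis (no_types, lifting) app_mult cinner_star cinner_diff_right proj_def right_minus_eq)

lemma norm_proj_split: "proj P \<Longrightarrow> (norm x)\<^sup>2 = (norm (P \<rhd> x))\<^sup>2 + (norm (x - P \<rhd> x))\<^sup>2"
  using norm_add_sq[of "P \<rhd> x" "x - P \<rhd> x"] proj_cinner[of P x x] by simp

lemma norm_proj_le: "proj P \<Longrightarrow> norm (P \<rhd> x) \<le> norm x"
  using norm_proj_split[of P x] by (metis le_add_same_cancel1 norm_ge_zero power2_le_imp_le zero_le_power2)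

lemma proj_compl: "proj P \<Longrightarrow> proj (1 - P)"
  by (simp add: proj_def algebra_simps)

text \<open>The value at \<open>x\<close> is the point of \<open>N\<close> nearest to
  \<open>x\<close>: a minimizing sequence is Cauchy by the parallelogram law, and minimality makes
  the error orthogonal to \<open>N\<close>. In \<open>prime\<close> this turns an invariant subspace
  into an operator.\<close>

lemma projection_exists:
  fixes N :: "'h::chilbert_space set"
  assumes closed: "closed N" and zero: "0 \<in> N"
    and add: "\<And>x y. x \<in> N \<Longrightarrow> y \<in> N \<Longrightarrow> x + y \<in> N"
    and scale: "\<And>c x. x \<in> N \<Longrightarrow> c *\<^sub>C x \<in> N"
  shows "\<exists>P. proj P \<and> range (app P) = N"
proof -
  have scaleR: "x \<in> N \<Longrightarrow> r *\<^sub>R x \<in> N" for r x by (simp add: scaleR_scaleC scale)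
  have minus: "x \<in> N \<Longrightarrow> y \<in> N \<Longrightarrow> x - y \<in> N" for x y
    using add[of x "(-1) *\<^sub>R y"] scaleR[of y "-1"] by simp
  have ex: "\<exists>y\<in>N. \<forall>z\<in>N. cinner z (x - y) = 0" for x
  proof -
    define m where "m = (INF y\<in>N. (norm (x - y))\<^sup>2)"
    have bdd: "bdd_below ((\<lambda>y. (norm (x - y))\<^sup>2) ` N)" by (rule bdd_belowI2[of _ 0]) simp
    have m_le: "m \<le> (norm (x - y))\<^sup>2" if "y \<in> N" for y
      unfolding m_def by (rule cINF_lower[OF bdd that])
    have "\<exists>y\<in>N. (norm (x - y))\<^sup>2 < m + 1 / real (Suc n)" for n
      using cINF_less_iff[OF _ bdd, of "m + 1 / real (Suc n)"] zero unfolding m_def by auto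
    then obtain X where X: "\<And>n. X n \<in> N" "\<And>n. (norm (x - X n))\<^sup>2 < m + 1 / real (Suc n)" by metis
    have para: "(norm (y - z))\<^sup>2 \<le> 2 * ((norm (x - y))\<^sup>2 - m) + 2 * ((norm (x - z))\<^sup>2 - m)"
      if "y \<in> N" "z \<in> N" for y z
    proof -
      have "(norm (y - z))\<^sup>2 + 4 * (norm (x - (1/2) *\<^sub>R (y + z)))\<^sup>2
          = 2 * (norm (x - y))\<^sup>2 + 2 * (norm (x - z))\<^sup>2"
      proof -
        have "(norm ((x - y) + (x - z)))\<^sup>2 = 4 * (norm (x - (1/2) *\<^sub>R (y + z)))\<^sup>2"
        proof -
          have "(x - y) + (x - z) = 2 *\<^sub>R (x - (1/2) *\<^sub>R (y + z))"
            by (simp add: scaleR_diff_right scaleR_2)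
          then show ?thesis by (simp only: norm_scaleR power_mult_distrib) simp
        qed
        moreover have "(norm (y - z))\<^sup>2 = (norm ((x - z) - (x - y)))\<^sup>2" by simp
        ultimately show ?thesis
          using norm_add_sq[of "x - y" "x - z"] norm_diff_sq[of "x - z" "x - y"]
            Re_cinner_commute[of "x - y" "x - z"] by linarith
      qed
      then show ?thesis using m_le[of "(1/2) *\<^sub>R (y + z)"] scaleR add that by fastforce
    qed
    have "Cauchy X"
    proof (rule metric_CauchyI)
      fix e :: real
      assume e: "0 < e"
      obtain k where k: "1 / real (Suc k) < e\<^sup>2 / 4"
        using e reals_Archimedean[of "e\<^sup>2 / 4"] by (auto simp: inverse_eq_divide)
      have small: "(norm (x - X n))\<^sup>2 - m < e\<^sup>2 / 4" if "k \<le> n" for n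
      proof -
        have "1 / real (Suc n) \<le> 1 / real (Suc k)" using that by (simp add: field_simps)
        then show ?thesis using X(2)[of n] k by linarith
      qed
      have "dist (X i) (X j) < e" if "k \<le> i" "k \<le> j" for i j
      proof -
        have "(norm (X i - X j))\<^sup>2 < e\<^sup>2"
          using para[OF X(1) X(1), of i j] small[OF that(1)] small[OF that(2)] by argo
        then show ?thesis using e by (simp add: dist_norm power2_less_imp_less)
      qed
      then show "\<exists>M. \<forall>i\<ge>M. \<forall>j\<ge>M. dist (X i) (X j) < e" by blast
    qed
    then obtain y where y: "X \<longlonglongrightarrow> y"
      using Cauchy_convergent_iff convergent_def by blast
    have yN: "y \<in> N" using closed_sequentially[OF closed] X(1) y by blast
    have "(norm (x - y))\<^sup>2 \<le> m"
    proof (rule LIMSEQ_le)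
      show "(\<lambda>n. (norm (x - X n))\<^sup>2) \<longlonglongrightarrow> (norm (x - y))\<^sup>2" by (intro tendsto_intros y)
      show "(\<lambda>n. m + 1 / real (Suc n)) \<longlonglongrightarrow> m"
        using tendsto_add[OF tendsto_const[of m] LIMSEQ_inverse_real_of_nat]
        by (simp add: inverse_eq_divide)
      show "\<exists>N. \<forall>n\<ge>N. (norm (x - X n))\<^sup>2 \<le> m + 1 / real (Suc n)"
        using X(2) less_imp_le by blast
    qed
    then have min: "(norm (x - y))\<^sup>2 \<le> (norm (x - y - z))\<^sup>2" if "z \<in> N" for z
      using m_le[OF add[OF yN that]] by (metis diff_diff_eq order_trans)
    have "cinner z (x - y) = 0" if z: "z \<in> N" for z
    proof -
      have re: "Re (cinner (x - y) z) \<le> 0" if z: "z \<in> N" for z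
      proof (rule ccontr)
        let ?d = "Re (cinner (x - y) z)"
        assume "\<not> ?thesis"
        then have d: "0 < ?d" by simp
        \<comment> \<open>This \<open>t\<close> makes \<open>t^2 * (norm z)^2 - 2 * t * ?d\<close>
          negative; the added 1 covers \<open>z = 0\<close>.\<close>
        define t where "t = ?d / ((norm z)\<^sup>2 + 1)"
        have pos: "0 < (norm z)\<^sup>2 + 1" by (simp add: add_nonneg_pos)
        have t: "0 < t" using d pos by (simp add: t_def)
        have "2 * t * ?d \<le> t\<^sup>2 * (norm z)\<^sup>2"
          using min[OF scaleR[OF z, of t]] norm_diff_sq[of "x - y" "t *\<^sub>R z"]
          by (simp add: cinner_scaleR_right power_mult_distrib)
        then have "t * (2 * ?d) \<le> t * (t * (norm z)\<^sup>2)"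
          by (simp add: power2_eq_square algebra_simps)
        then have "2 * ?d \<le> t * (norm z)\<^sup>2" using t by simp
        also have "\<dots> \<le> t * ((norm z)\<^sup>2 + 1)" using t by simp
        also have "\<dots> = ?d" using pos by (simp add: t_def)
        finally show False using d by simp
      qed
      let ?w = "cinner (x - y) z"
      \<comment> \<open>Multiplying \<open>z\<close> by the scalar \<open>?w\<close> turns the bound
        on the real part into |?w|^2 \<le> 0.\<close>
      have "Re (cinner (x - y) (?w *\<^sub>C z)) \<le> 0" using re scale z by blast
      then have "(Re ?w)\<^sup>2 + (Im ?w)\<^sup>2 \<le> 0"
        by (simp add: cinner_scaleC_right power2_eq_square)
      then have "?w = 0"
        by (simp add: complex_eq_iff sum_power2_le_zero_iff)
      then show ?thesis by (metis cinner_commute complex_cnj_zero)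
    qed
    then show ?thesis using yN by blast
  qed
  then obtain p where p: "\<And>x. p x \<in> N" "\<And>x z. z \<in> N \<Longrightarrow> cinner z (x - p x) = 0" by metis
  have p_unique: "p x = y" if "y \<in> N" "\<And>z. z \<in> N \<Longrightarrow> cinner z (x - y) = 0" for x y
  proof -
    have "cinner (p x - y) ((x - y) - (x - p x)) = 0"
      unfolding cinner_diff_right[of _ "x - y"] using that p minus by simp
    then show ?thesis by (simp add: cinner_self)
  qed
  have "\<exists>P. \<forall>x. P \<rhd> x = p x"
  proof (rule cop_of_bounded)
    show "p (x + y) = p x + p y" for x y
      by (rule p_unique) (use p add in \<open>auto simp: add_diff_add cinner_add_right\<close>)
    show "p (c *\<^sub>C x) = c *\<^sub>C p x" for c x
      by (rule p_unique)
        (use p scale in \<open>auto simp: scaleC_diff_right[symmetric] cinner_scaleC_right\<close>)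
    show "norm (p x) \<le> 1 * norm x" for x
    proof -
      have "(norm x)\<^sup>2 = (norm (p x))\<^sup>2 + (norm (x - p x))\<^sup>2"
        using norm_add_sq[of "p x" "x - p x"] p(2)[OF p(1), of x x] by simp
      then show ?thesis
        by (metis le_add_same_cancel1 mult_1 norm_ge_zero power2_le_imp_le zero_le_power2)
    qed
  qed
  then obtain P where P: "\<And>x. P \<rhd> x = p x" by blast
  have pN: "p x = x" if "x \<in> N" for x by (rule p_unique) (use that in auto)
  have "P\<^sup>\<dagger> = P"
  proof (rule star_eqI)
    fix x y
    have "cinner (p x) y = cinner (p x) (p y)"
      using p(2)[OF p(1), of x y] by (simp add: cinner_diff_right)
    moreover have "cinner (p y) x = cinner (p y) (p x)"
      using p(2)[OF p(1), of y x] by (simp add: cinner_diff_right)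
    ultimately show "cinner (P \<rhd> x) y = cinner x (P \<rhd> y)" unfolding P by (metis cinner_commute)
  qed
  moreover have "P * P = P" by (rule cop_eqI) (simp add: P pN p)
  moreover have "range (app P) = N" using P p(1) pN by (auto simp: image_iff) metis
  ultimately show ?thesis by (auto simp: proj_def)
qed

text \<open>Separates the odd part \<open>p\<close> from the even part \<open>q\<close> of an
  expression that has the same value for both signs of a parameter.\<close>

lemma add_diff_same_eq:
  fixes p q r :: "'a::real_vector"
  assumes "q + p = r" "q - p = r"
  shows "p = 0" "q = r"
proof -
  have "2 *\<^sub>R p = (q + p) - (q - p)" by (simp add: scaleR_2)
  then show "p = 0" using assms by simp
  then show "q = r" using assms by simp
qed

section \<open>Unital *-algebras of operators\<close>

locale star_algebra =
  fixes M :: "'h::chilbert_space cop set"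
  assumes add_mem: "A \<in> M \<Longrightarrow> B \<in> M \<Longrightarrow> A + B \<in> M"
    and mult_mem: "A \<in> M \<Longrightarrow> B \<in> M \<Longrightarrow> A * B \<in> M"
    and star_mem: "A \<in> M \<Longrightarrow> A\<^sup>\<dagger> \<in> M"
    and cscale_mem: "A \<in> M \<Longrightarrow> c \<odot> A \<in> M"
    and one_mem: "1 \<in> M"
begin

lemma zero_mem: "0 \<in> M" using cscale_mem[OF one_mem, of 0] by simp
lemma scaleR_mem: "A \<in> M \<Longrightarrow> r *\<^sub>R A \<in> M"
  using cscale_mem[of A "complex_of_real r"] by (simp add: cscale_of_real)
lemma minus_mem: "A \<in> M \<Longrightarrow> - A \<in> M"
  using scaleR_mem[of A "-1"] by simp
lemma diff_mem: "A \<in> M \<Longrightarrow> B \<in> M \<Longrightarrow> A - B \<in> M"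
  using add_mem[of A "- B"] minus_mem by simp

lemmas mem = add_mem mult_mem star_mem cscale_mem one_mem zero_mem scaleR_mem minus_mem diff_mem

lemma cartesian_decomposition:
  assumes "A \<in> M"
  obtains S T where "S \<in> M" "T \<in> M" "S\<^sup>\<dagger> = S" "T\<^sup>\<dagger> = T" "A = S + \<i> \<odot> T"
    "A\<^sup>\<dagger> = S - \<i> \<odot> T" "norm S \<le> norm A" "norm T \<le> norm A"
proof
  let ?S = "(1/2) *\<^sub>R (A + A\<^sup>\<dagger>)" and ?T = "\<i> \<odot> ((1/2) *\<^sub>R (A\<^sup>\<dagger> - A))"
  show "?S \<in> M" "?T \<in> M" by (simp_all add: assms mem)
  show "?S\<^sup>\<dagger> = ?S" by (simp add: add.commute)
  show "?T\<^sup>\<dagger> = ?T"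
    by (simp add: cscale_scaleR cscale_diff_right scaleR_diff_right)
  have iT: "\<i> \<odot> ?T = (1/2) *\<^sub>R (A - A\<^sup>\<dagger>)"
    by (simp add: scaleR_diff_right)
  show "A = ?S + \<i> \<odot> ?T" "A\<^sup>\<dagger> = ?S - \<i> \<odot> ?T"
    unfolding iT by (simp_all add: scaleR_diff_right scaleR_add_right flip: scaleR_add_left)
  show "norm ?S \<le> norm A" using norm_triangle_ineq[of A "A\<^sup>\<dagger>"] by simp
  show "norm ?T \<le> norm A" unfolding norm_cscale using norm_triangle_ineq4[of "A\<^sup>\<dagger>" A] by simp
qed

end

section \<open>Linear maps sending unitaries to isometries and co-isometries\<close>

definition unit :: "'h::chilbert_space cop \<Rightarrow> bool" where
  "unit U \<longleftrightarrow> U\<^sup>\<dagger> * U = 1 \<and> U * U\<^sup>\<dagger> = 1"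

lemma unit_star: "unit U \<Longrightarrow> unit U\<^sup>\<dagger>"
  by (simp add: unit_def)

lemma iso_coiso_unit: "unit U \<Longrightarrow> iso_coiso U"
  by (simp add: unit_def iso_coiso_def)

lemma unit_mult_iso_coiso:
  assumes U: "unit U" and A: "iso_coiso A"
  shows "iso_coiso (U * A)"
proof -
  have "(U * A)\<^sup>\<dagger> * (U * A) = A\<^sup>\<dagger> * (U\<^sup>\<dagger> * U) * A" "(U * A) * (U * A)\<^sup>\<dagger> = U * (A * A\<^sup>\<dagger>) * U\<^sup>\<dagger>"
    by (simp_all add: mult.assoc)
  then show ?thesis using assms by (auto simp: unit_def iso_coiso_def)
qed

lemma iso_coiso_mult_unit: "unit U \<Longrightarrow> iso_coiso A \<Longrightarrow> iso_coiso (A * U)"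
  using unit_mult_iso_coiso[of "U\<^sup>\<dagger>" "A\<^sup>\<dagger>"] by (metis iso_coiso_star star_mult star_star unit_star)

text \<open>A co-isometry that is not an isometry has a nonzero kernel vector \<open>z\<close>.
  There \<open>T - X\<close> acts as \<open>- X\<close>, which preserves the norm of
  \<open>z\<close>, so \<open>T\<close> is at distance at least 1 from \<open>X\<close>.\<close>

lemma isometry_near_isometry:
  assumes X: "X\<^sup>\<dagger> * X = 1" and T: "iso_coiso T" and near: "norm (T - X) < 1"
  shows "T\<^sup>\<dagger> * T = 1"
proof (rule ccontr)
  assume n: "T\<^sup>\<dagger> * T \<noteq> 1"
  then obtain y where y: "T\<^sup>\<dagger> \<rhd> T \<rhd> y \<noteq> y" by (metis app_mult app_one cop_eqI)
  define z where "z = T\<^sup>\<dagger> \<rhd> T \<rhd> y - y"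
  have "T * T\<^sup>\<dagger> = 1" using T n by (simp add: iso_coiso_def)
  then have "T \<rhd> T\<^sup>\<dagger> \<rhd> v = v" for v by (metis app_mult app_one)
  then have "T \<rhd> z = 0" by (simp add: z_def app_diff_right)
  then have "norm ((T - X) \<rhd> z) = norm z"
    using X by (simp add: app_diff isom_iff_norm)
  moreover have "norm ((T - X) \<rhd> z) < norm z"
    using order_le_less_trans[OF norm_app mult_strict_right_mono[OF near, of "norm z"]] y
    by (simp add: z_def)
  ultimately show False by simp
qed

definition clin_on :: "'h::chilbert_space cop set \<Rightarrow> ('h cop \<Rightarrow> 'h cop) \<Rightarrow> bool" where
  "clin_on M \<Phi> \<longleftrightarrow> (\<forall>A\<in>M. \<Phi> A \<in> M) \<and> (\<forall>A\<in>M. \<forall>B\<in>M. \<Phi> (A + B) = \<Phi> A + \<Phi> B) \<and>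
     (\<forall>c. \<forall>A\<in>M. \<Phi> (c \<odot> A) = c \<odot> \<Phi> A)"

context star_algebra begin

context
  fixes \<Phi> assumes \<Phi>: "clin_on M \<Phi>"
begin

lemma clin_mem: "A \<in> M \<Longrightarrow> \<Phi> A \<in> M"
  and clin_add: "A \<in> M \<Longrightarrow> B \<in> M \<Longrightarrow> \<Phi> (A + B) = \<Phi> A + \<Phi> B"
  and clin_cscale: "A \<in> M \<Longrightarrow> \<Phi> (c \<odot> A) = c \<odot> \<Phi> A"
  using \<Phi> by (auto simp: clin_on_def)

lemma clin_scaleR: "A \<in> M \<Longrightarrow> \<Phi> (r *\<^sub>R A) = r *\<^sub>R \<Phi> A"
  using clin_cscale[of A "complex_of_real r"] by (simp add: cscale_of_real)

lemma clin_minus: "A \<in> M \<Longrightarrow> \<Phi> (- A) = - \<Phi> A"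
  using clin_scaleR[of A "-1"] by simp

lemma clin_diff: "A \<in> M \<Longrightarrow> B \<in> M \<Longrightarrow> \<Phi> (A - B) = \<Phi> A - \<Phi> B"
  using clin_add[of A "- B"] by (simp add: clin_minus minus_mem)

lemma clin_zero: "\<Phi> 0 = 0"
  using clin_cscale[of 1 0] by (simp add: one_mem)

text \<open>Under this dual map the roles of isometries and co-isometries among the images are
  exchanged, so every one-sided result has a mirror image.\<close>

lemma clin_on_dual: "clin_on M (\<lambda>A. (\<Phi> A\<^sup>\<dagger>)\<^sup>\<dagger>)"
  by (auto simp: clin_on_def clin_mem mem clin_add clin_cscale)

lemma clin_on_right: "V \<in> M \<Longrightarrow> clin_on M (\<lambda>A. \<Phi> (A * V))"
  by (auto simp: clin_on_def clin_mem mem clin_add clin_cscale distrib_right)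

lemma clin_on_left: "V \<in> M \<Longrightarrow> clin_on M (\<lambda>A. \<Phi> (V * A))"
  by (auto simp: clin_on_def clin_mem mem clin_add clin_cscale distrib_left)

lemma clin_on_left': "V \<in> M \<Longrightarrow> clin_on M (\<lambda>A. V * \<Phi> A)"
  by (auto simp: clin_on_def clin_mem mem clin_add clin_cscale distrib_left)

end

lemmas clin = clin_add clin_cscale clin_scaleR clin_minus clin_diff clin_zero

end

locale vn_algebra = star_algebra M for M :: "'h::chilbert_space cop set" +
  assumes bicommutant: "(\<And>T. (\<And>A. A \<in> M \<Longrightarrow> A * T = T * A) \<Longrightarrow> B * T = T * B) \<Longrightarrow> B \<in> M"
begin

text \<open>Commuting with a fixed \<open>T\<close> survives strong limits. The filter is arbitrary,
  so nets along chains are covered as well as sequences.\<close>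

lemma strong_limit_mem:
  assumes F: "F \<noteq> bot" and A: "\<forall>\<^sub>F i in F. A i \<in> M"
    and lim: "\<And>x. ((\<lambda>i. A i \<rhd> x) \<longlongrightarrow> B \<rhd> x) F"
  shows "B \<in> M"
proof (rule bicommutant, rule cop_eqI)
  fix T x
  assume T: "\<And>A. A \<in> M \<Longrightarrow> A * T = T * A"
  have "\<forall>\<^sub>F i in F. T \<rhd> A i \<rhd> x = A i \<rhd> T \<rhd> x"
    using A by eventually_elim (metis T app_mult)
  moreover have "((\<lambda>i. T \<rhd> A i \<rhd> x) \<longlongrightarrow> T \<rhd> B \<rhd> x) F" by (intro tendsto_intros lim)
  ultimately have "((\<lambda>i. A i \<rhd> T \<rhd> x) \<longlongrightarrow> T \<rhd> B \<rhd> x) F"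
    by (rule tendsto_cong[THEN iffD1])
  from tendsto_unique[OF F lim this] show "(B * T) \<rhd> x = (T * B) \<rhd> x" by simp
qed

lemma limit_mem:
  assumes "\<And>n::nat. A n \<in> M" "A \<longlonglongrightarrow> B"
  shows "B \<in> M"
proof (rule strong_limit_mem)
  have "bounded_linear (\<lambda>A::'h cop. A \<rhd> x)" for x
    by (rule bounded_linear_intro[where K = "norm x"]) (simp_all add: app_simps norm_app)
  then show "(\<lambda>n. A n \<rhd> x) \<longlonglongrightarrow> B \<rhd> x" for x
    by (rule bounded_linear.tendsto) (rule assms)
qed (use assms in auto)

text \<open>\<open>B\<close> is 1 - sqrt(1 - A^2), and the two unitaries are sqrt(1 - A^2)
  \<plusminus> iA. The equation (1 - B)^2 = 1 - A^2 reads B = (A^2 + B^2)/2, which is solved by a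
  contraction; since B is of the order of A^2, the remainder B^2/2 is of fourth order.\<close>

lemma unitary_second_order:
  assumes A: "A \<in> M" "A\<^sup>\<dagger> = A" "norm A \<le> 1/2"
  obtains B where "B \<in> M" "B\<^sup>\<dagger> = B" "norm (B - (1/2) *\<^sub>R (A * A)) \<le> (norm A)^4"
    "unit (1 + \<i> \<odot> A - B)" "unit (1 - \<i> \<odot> A - B)"
proof -
  \<comment> \<open>All conditions are closed, so the fixed point inherits them. Commuting with
    \<open>A\<close> makes the two candidates multiply to \<open>1\<close>; on the radius 1/2 the
    map \<open>f\<close> contracts by 1/2.\<close>
  define S where "S = {B \<in> M. B\<^sup>\<dagger> = B \<and> A * B = B * A \<and> norm B \<le> 1/2}"
  define f where "f = (\<lambda>B. (1/2) *\<^sub>R (A * A + B * B))"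
  have nA: "norm (A * A) \<le> 1/4"
    using norm_mult_ineq[of A A] mult_mono[OF A(3) A(3)] by simp
  have "\<exists>!B\<in>S. f B = B"
  proof (rule Banach_fix[where c = "1/2"])
    show "complete S"
      unfolding complete_eq_closed closed_sequential_limits
    proof (intro allI impI)
      fix X L
      assume "(\<forall>n. X n \<in> S) \<and> X \<longlonglongrightarrow> L"
      then have X: "\<And>n. X n \<in> M" "\<And>n. (X n)\<^sup>\<dagger> = X n" "\<And>n. A * X n = X n * A"
        "\<And>n. norm (X n) \<le> 1/2" and L: "X \<longlonglongrightarrow> L"
        unfolding S_def by auto
      have "L\<^sup>\<dagger> = L" using LIMSEQ_unique[OF tendsto_star[OF L]] X(2) L by simp
      moreover have "A * L = L * A"
      proof (rule LIMSEQ_unique)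
        show "(\<lambda>n. A * X n) \<longlonglongrightarrow> A * L" by (intro tendsto_intros L)
        show "(\<lambda>n. A * X n) \<longlonglongrightarrow> L * A" unfolding X(3) by (intro tendsto_intros L)
      qed
      moreover have "norm L \<le> 1/2"
        by (rule LIMSEQ_le_const2[OF tendsto_norm[OF L]]) (use X(4) in blast)
      ultimately show "L \<in> S" using limit_mem[OF X(1) L] by (simp add: S_def)
    qed
    show "S \<noteq> {}" using zero_mem by (auto simp: S_def intro!: exI[of _ 0])
    show "f ` S \<subseteq> S"
    proof (intro image_subsetI)
      fix B assume B: "B \<in> S"
      then have "norm (B * B) \<le> 1/4"
        using norm_mult_ineq[of B B] mult_mono[of "norm B" "1/2" "norm B" "1/2"] by (simp add: S_def)
      then have "norm (A * A + B * B) \<le> 1/2"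
        using nA norm_triangle_ineq[of "A * A" "B * B"] by linarith
      moreover have "A * (B * B) = B * B * A" using B unfolding S_def by (metis (mono_tags, lifting) mem_Collect_eq mult.assoc)
      moreover have "norm (f B) = 1/2 * norm (A * A + B * B)" by (simp add: f_def)
      ultimately show "f B \<in> S"
        using B A(1,2) by (simp add: S_def mem) (simp add: f_def mem algebra_simps)
    qed
    show "dist (f B) (f C) \<le> 1/2 * dist B C" if "B \<in> S" "C \<in> S" for B C
    proof -
      have "f B - f C = (1/2) *\<^sub>R (B * (B - C) + (B - C) * C)"
        by (simp add: f_def algebra_simps)
      then have "norm (f B - f C) \<le> 1/2 * (norm (B * (B - C)) + norm ((B - C) * C))"
        using norm_triangle_ineq[of "B * (B - C)" "(B - C) * C"] by simp
      also have "\<dots> \<le> 1/2 * (norm B * norm (B - C) + norm (B - C) * norm C)"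
        by (intro mult_left_mono add_mono norm_mult_ineq) simp
      also have "\<dots> \<le> 1/2 * (1/2 * norm (B - C) + norm (B - C) * (1/2))"
        using that by (intro mult_left_mono add_mono mult_right_mono) (auto simp: S_def)
      finally show ?thesis by (simp add: dist_norm)
    qed
  qed auto
  then obtain B where B: "B \<in> M" "B\<^sup>\<dagger> = B" "A * B = B * A" "norm B \<le> 1/2" "f B = B"
    by (auto simp: S_def)
  have B2: "B = (1/2) *\<^sub>R (A * A) + (1/2) *\<^sub>R (B * B)"
    using B(5) by (simp add: f_def scaleR_add_right)
  have nBB: "norm (B * B) \<le> 1/2 * norm B"
    using norm_mult_ineq[of B B] mult_right_mono[OF B(4), of "norm B"] by simp
  have "norm B \<le> 1/2 * norm (A * A) + 1/2 * norm (B * B)"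
    using norm_triangle_ineq[of "(1/2) *\<^sub>R (A * A)" "(1/2) *\<^sub>R (B * B)"] B2 by simp
  then have nB: "norm B \<le> (norm A)\<^sup>2"
    using nBB norm_mult_ineq[of A A] norm_ge_zero[of B] unfolding power2_eq_square by linarith
  have "norm (B - (1/2) *\<^sub>R (A * A)) = 1/2 * norm (B * B)"
    by (subst B2) simp
  moreover have "norm (B * B) \<le> (norm A)^4"
    using order_trans[OF norm_mult_ineq mult_mono[OF nB nB]]
    by (simp add: power2_eq_square power4_eq_xxxx mult.assoc)
  ultimately have "norm (B - (1/2) *\<^sub>R (A * A)) \<le> (norm A)^4"
    using norm_ge_zero[of "B * B"] by linarith
  moreover
  define J where "J = \<i> \<odot> A"
  have J: "J\<^sup>\<dagger> = - J" "J * J = - (A * A)" "J * B = B * J"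
    by (simp_all add: J_def A B)
  have AA: "A * A = B + B - B * B"
    using arg_cong[OF B2, of "\<lambda>X. 2 *\<^sub>R X"] by (simp add: scaleR_add_right scaleR_2)
  \<comment> \<open>Both products are (1 - B)^2 - J^2 = (1 - B)^2 + A^2, which is \<open>1\<close>
    by the choice of \<open>B\<close>.\<close>
  have "(1 - J - B) * (1 + J - B) = 1 - (B + B - B * B) - J * J"
    "(1 + J - B) * (1 - J - B) = 1 - (B + B - B * B) - J * J"
    by (simp_all add: algebra_simps J(3))
  then have "unit (1 + J - B)" "unit (1 - J - B)"
    by (simp_all add: unit_def J(1,2) B(2) AA)
  ultimately show thesis using that B(1,2) by (simp add: J_def)
qed

text \<open>Automatic continuity. If \<open>S\<close> is self-adjoint of norm at most 1/2, then 2iS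
  is the difference of two unitaries, so the image of \<open>S\<close> has norm at most 1. Rescaling
  gives the factor 2 on self-adjoint elements, and the real and imaginary parts together give
  4.\<close>

lemma norm_clin_le:
  assumes \<Phi>: "clin_on M \<Phi>" and contr: "\<And>U. U \<in> M \<Longrightarrow> unit U \<Longrightarrow> norm (\<Phi> U) \<le> 1"
    and A: "A \<in> M"
  shows "norm (\<Phi> A) \<le> 4 * norm A"
proof -
  have small: "norm (\<Phi> S) \<le> 1" if S: "S \<in> M" "S\<^sup>\<dagger> = S" "norm S \<le> 1/2" for S
  proof -
    obtain B where B: "B \<in> M" and U: "unit (1 + \<i> \<odot> S - B)" "unit (1 - \<i> \<odot> S - B)"
      using unitary_second_order[OF S] by metis
    let ?U = "1 + \<i> \<odot> S - B" and ?V = "1 - \<i> \<odot> S - B"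
    have UV: "?U \<in> M" "?V \<in> M" by (simp_all add: S B mem)
    have "2 *\<^sub>R (\<i> \<odot> S) = ?U - ?V" by (simp add: scaleR_2)
    then have "2 *\<^sub>R (\<i> \<odot> \<Phi> S) = \<Phi> ?U - \<Phi> ?V"
      using clin_diff[OF \<Phi> UV] clin_scaleR[OF \<Phi>, of "\<i> \<odot> S" 2] clin_cscale[OF \<Phi>, of S]
      by (simp add: S mem)
    then have "2 * norm (\<Phi> S) = norm (\<Phi> ?U - \<Phi> ?V)"
      by (metis norm_scaleR norm_cscale norm_ii mult_1 abs_numeral)
    also have "\<dots> \<le> 2"
      using norm_triangle_ineq4[of "\<Phi> ?U" "\<Phi> ?V"] contr[OF UV(1) U(1)] contr[OF UV(2) U(2)] by simp
    finally show ?thesis by simp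
  qed
  have sa: "norm (\<Phi> S) \<le> 2 * norm S" if S: "S \<in> M" "S\<^sup>\<dagger> = S" for S
  proof (cases "S = 0")
    case True
    then show ?thesis by (simp add: clin_zero[OF \<Phi>])
  next
    case False
    let ?r = "1 / (2 * norm S)"
    have "norm (\<Phi> (?r *\<^sub>R S)) \<le> 1" using S False by (intro small) (auto simp: mem)
    then show ?thesis using False by (simp add: clin_scaleR[OF \<Phi>] S field_simps)
  qed
  obtain S T where ST: "S \<in> M" "T \<in> M" "S\<^sup>\<dagger> = S" "T\<^sup>\<dagger> = T" "A = S + \<i> \<odot> T"
      "norm S \<le> norm A" "norm T \<le> norm A"
    using cartesian_decomposition[OF A] by metis
  have "norm (\<Phi> A) \<le> norm (\<Phi> S) + norm (\<Phi> T)"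
    using norm_triangle_ineq[of "\<Phi> S" "\<i> \<odot> \<Phi> T"] ST
    by (simp add: clin_add[OF \<Phi>] clin_cscale[OF \<Phi>] mem norm_cscale)
  then show ?thesis using sa[OF ST(1,3)] sa[OF ST(2,4)] ST(6,7) by linarith
qed

context
  fixes \<Theta> X
  assumes \<Theta>: "clin_on M \<Theta>" and units: "\<And>U. U \<in> M \<Longrightarrow> unit U \<Longrightarrow> iso_coiso (\<Theta> U)"
    and X: "X = \<Theta> 1" "X\<^sup>\<dagger> * X = 1"
begin

text \<open>The unitaries 1 \<plusminus> itS - B have images X \<plusminus> itY - t^2 c, where Y =
  \<open>\<Theta> S\<close> and c tends to half of \<open>\<Theta> (S * S)\<close>. For small t both
  images are isometries. The odd part of this condition gives the first identity, the even part
  divided by t^2 the second.\<close>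

lemma second_order_variation:
  assumes S: "S \<in> M" "S\<^sup>\<dagger> = S"
  shows "X\<^sup>\<dagger> * \<Theta> S = (\<Theta> S)\<^sup>\<dagger> * X"
    and "2 *\<^sub>R ((\<Theta> S)\<^sup>\<dagger> * \<Theta> S) = X\<^sup>\<dagger> * \<Theta> (S * S) + (\<Theta> (S * S))\<^sup>\<dagger> * X"
proof -
  \<comment> \<open>This factor keeps \<open>t n *\<^sub>R S\<close> within norm 1/2 for every
    \<open>n\<close>, as the construction of the unitaries requires.\<close>
  define r where "r = 1 / (2 * (1 + norm S))"
  define t where "t = (\<lambda>n. r * (1 / real (Suc n)))"
  let ?Y = "\<Theta> S" and ?Z = "\<Theta> (S * S)"
  have r: "0 < r" by (simp add: r_def add_pos_nonneg)
  have t0: "0 < t n" "t n \<noteq> 0" for n using r by (auto simp: t_def)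
  have "(\<lambda>n. r * (1 / real (Suc n))) \<longlonglongrightarrow> r * 0"
    by (intro tendsto_mult tendsto_const LIMSEQ_Suc lim_1_over_n)
  then have t_lim: "t \<longlonglongrightarrow> 0" by (simp add: t_def)
  have small: "norm (t n *\<^sub>R S) \<le> 1/2" for n
  proof -
    have "t n \<le> r" using r by (simp add: t_def field_simps)
    then have "norm (t n *\<^sub>R S) \<le> r * norm S"
      using t0[of n] by (simp add: mult_right_mono)
    also have "\<dots> \<le> 1/2" by (simp add: r_def divide_le_eq add_pos_nonneg)
    finally show ?thesis .
  qed
  have "\<exists>B. B \<in> M \<and> norm (B - (1/2) *\<^sub>R ((t n *\<^sub>R S) * (t n *\<^sub>R S))) \<le> (norm (t n *\<^sub>R S))^4 \<and>
     unit (1 + \<i> \<odot> (t n *\<^sub>R S) - B) \<and> unit (1 - \<i> \<odot> (t n *\<^sub>R S) - B)" for n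
    using unitary_second_order[OF _ _ small[of n]] S by (metis scaleR_mem star_scaleR)
  then obtain B where B: "\<And>n. B n \<in> M"
      "\<And>n. norm (B n - (1/2) *\<^sub>R ((t n *\<^sub>R S) * (t n *\<^sub>R S))) \<le> (norm (t n *\<^sub>R S))^4"
      "\<And>n. unit (1 + \<i> \<odot> (t n *\<^sub>R S) - B n)" "\<And>n. unit (1 - \<i> \<odot> (t n *\<^sub>R S) - B n)"
    by metis
  \<comment> \<open>The image of \<open>B n\<close>, rescaled. As \<open>\<Theta>\<close> is bounded
    and \<open>B n\<close> differs from its quadratic part by a term of order t^4, it converges to
    half of \<open>?Z\<close>.\<close>
  define c where "c = (\<lambda>n. (1 / (t n)\<^sup>2) *\<^sub>R \<Theta> (B n))"
  have \<Theta>B: "\<Theta> (B n) = (t n)\<^sup>2 *\<^sub>R c n" for n using t0 by (simp add: c_def)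
  have "norm (c n - (1/2) *\<^sub>R ?Z) \<le> (t n)\<^sup>2 * (4 * (norm S)^4)" for n
  proof -
    have "c n - (1/2) *\<^sub>R ?Z = (1 / (t n)\<^sup>2) *\<^sub>R \<Theta> (B n - (1/2) *\<^sub>R ((t n *\<^sub>R S) * (t n *\<^sub>R S)))"
      using t0[of n] S B(1)[of n]
      by (simp add: clin_diff[OF \<Theta>] clin_scaleR[OF \<Theta>] mem c_def scaleR_diff_right power2_eq_square)
    then have "norm (c n - (1/2) *\<^sub>R ?Z)
        = (1 / (t n)\<^sup>2) * norm (\<Theta> (B n - (1/2) *\<^sub>R ((t n *\<^sub>R S) * (t n *\<^sub>R S))))"
      by simp
    also have "\<dots> \<le> (1 / (t n)\<^sup>2) * (4 * (norm (t n *\<^sub>R S))^4)"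
    proof (intro mult_left_mono)
      have "norm (\<Theta> (B n - (1/2) *\<^sub>R ((t n *\<^sub>R S) * (t n *\<^sub>R S))))
          \<le> 4 * norm (B n - (1/2) *\<^sub>R ((t n *\<^sub>R S) * (t n *\<^sub>R S)))"
        by (rule norm_clin_le[OF \<Theta>]) (use units norm_iso_coiso_le S B(1) in \<open>auto simp: mem\<close>)
      then show "norm (\<Theta> (B n - (1/2) *\<^sub>R ((t n *\<^sub>R S) * (t n *\<^sub>R S)))) \<le> 4 * (norm (t n *\<^sub>R S))^4"
        using B(2)[of n] by linarith
    qed simp
    also have "\<dots> = (t n)\<^sup>2 * (4 * (norm S)^4)"
      using t0[of n] by (simp add: power2_eq_square power4_eq_xxxx)
    finally show ?thesis .
  qed
  moreover have "(\<lambda>n. (t n)\<^sup>2 * (4 * (norm S)^4)) \<longlonglongrightarrow> 0"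
    using tendsto_mult[OF tendsto_power[OF t_lim, of 2] tendsto_const[of "4 * (norm S)^4"]] by simp
  ultimately have "(\<lambda>n. c n - (1/2) *\<^sub>R ?Z) \<longlonglongrightarrow> 0"
    by (rule Lim_null_comparison[OF always_eventually[OF allI]])
  then have c_lim: "c \<longlonglongrightarrow> (1/2) *\<^sub>R ?Z" by (simp add: LIM_zero_iff)
  define D where "D = (\<lambda>n. X - (t n)\<^sup>2 *\<^sub>R c n)"
  have "D \<longlonglongrightarrow> X - 0\<^sup>2 *\<^sub>R ((1/2) *\<^sub>R ?Z)"
    unfolding D_def by (intro tendsto_intros t_lim c_lim)
  then have D_lim: "D \<longlonglongrightarrow> X" by simp
  \<comment> \<open>The sign \<open>e\<close> handles both unitaries at once. Their images converge
    to the isometry \<open>X\<close>, so eventually they cannot be mere co-isometries.\<close>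
  have isom: "\<forall>\<^sub>F n in sequentially. (D n + (e * t n) *\<^sub>R (\<i> \<odot> ?Y))\<^sup>\<dagger> * (D n + (e * t n) *\<^sub>R (\<i> \<odot> ?Y)) = 1"
    if e: "e = 1 \<or> e = - 1" for e :: real
  proof -
    have "(\<lambda>n. D n + (e * t n) *\<^sub>R (\<i> \<odot> ?Y)) \<longlonglongrightarrow> X + (e * 0) *\<^sub>R (\<i> \<odot> ?Y)"
      by (intro tendsto_intros t_lim D_lim)
    then have "(\<lambda>n. D n + (e * t n) *\<^sub>R (\<i> \<odot> ?Y)) \<longlonglongrightarrow> X" by simp
    then have "\<forall>\<^sub>F n in sequentially. norm (D n + (e * t n) *\<^sub>R (\<i> \<odot> ?Y) - X) < 1"
      unfolding tendsto_iff dist_norm by (metis zero_less_one)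
    then show ?thesis
    proof eventually_elim
      case (elim n)
      have "\<Theta> (1 + e *\<^sub>R (\<i> \<odot> (t n *\<^sub>R S)) - B n) = D n + (e * t n) *\<^sub>R (\<i> \<odot> ?Y)"
        using S B(1)[of n]
        by (simp add: clin_diff[OF \<Theta>] clin_add[OF \<Theta>] clin_cscale[OF \<Theta>] clin_scaleR[OF \<Theta>] cscale_scaleR mem D_def
            \<Theta>B X(1))
      moreover have "unit (1 + e *\<^sub>R (\<i> \<odot> (t n *\<^sub>R S)) - B n)"
        using e B(3,4)[of n] by auto
      moreover have "1 + e *\<^sub>R (\<i> \<odot> (t n *\<^sub>R S)) - B n \<in> M" using S B(1)[of n] by (simp add: mem)
      ultimately have "iso_coiso (D n + (e * t n) *\<^sub>R (\<i> \<odot> ?Y))" using units by metis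
      then show ?case using isometry_near_isometry[OF X(2) _ elim] by blast
    qed
  qed
  have i1: "\<forall>\<^sub>F n in sequentially. (D n + t n *\<^sub>R (\<i> \<odot> ?Y))\<^sup>\<dagger> * (D n + t n *\<^sub>R (\<i> \<odot> ?Y)) = 1"
    using isom[of 1] by simp
  have i2: "\<forall>\<^sub>F n in sequentially. (D n - t n *\<^sub>R (\<i> \<odot> ?Y))\<^sup>\<dagger> * (D n - t n *\<^sub>R (\<i> \<odot> ?Y)) = 1"
    using isom[of "-1"] by simp
  have "\<forall>\<^sub>F n in sequentially. (D n)\<^sup>\<dagger> * ?Y = ?Y\<^sup>\<dagger> * D n \<and>
      ?Y\<^sup>\<dagger> * ?Y = X\<^sup>\<dagger> * c n + (c n)\<^sup>\<dagger> * X - (t n)\<^sup>2 *\<^sub>R ((c n)\<^sup>\<dagger> * c n)"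
    using i1 i2
  proof eventually_elim
    case (elim n)
    \<comment> \<open>\<open>?p\<close> collects the terms that change sign with \<open>e\<close>,
      \<open>?q\<close> those that do not.\<close>
    let ?p = "t n *\<^sub>R (\<i> \<odot> ((D n)\<^sup>\<dagger> * ?Y - ?Y\<^sup>\<dagger> * D n))"
      and ?q = "(D n)\<^sup>\<dagger> * D n + (t n)\<^sup>2 *\<^sub>R (?Y\<^sup>\<dagger> * ?Y)"
    have e1: "?q + ?p = 1" using elim(1)
      by (simp add: algebra_simps power2_eq_square cscale_diff_right cscale_add_right)
    have e2: "?q - ?p = 1" using elim(2)
      by (simp add: algebra_simps power2_eq_square cscale_diff_right cscale_add_right)
    note p = add_diff_same_eq(1)[OF e1 e2] and q = add_diff_same_eq(2)[OF e1 e2]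
    from p have "- \<i> \<odot> \<i> \<odot> ((D n)\<^sup>\<dagger> * ?Y - ?Y\<^sup>\<dagger> * D n) = 0" using t0[of n] by simp
    then have "(D n)\<^sup>\<dagger> * ?Y = ?Y\<^sup>\<dagger> * D n" by (simp del: cscale_minus_left)
    moreover have "(t n)\<^sup>2 *\<^sub>R (?Y\<^sup>\<dagger> * ?Y) = (t n)\<^sup>2 *\<^sub>R (X\<^sup>\<dagger> * c n + (c n)\<^sup>\<dagger> * X - (t n)\<^sup>2 *\<^sub>R ((c n)\<^sup>\<dagger> * c n))"
      using q X(2) by (simp add: D_def algebra_simps)
    ultimately show ?case using t0[of n] by simp
  qed
  then have ev: "\<forall>\<^sub>F n in sequentially. (D n)\<^sup>\<dagger> * ?Y = ?Y\<^sup>\<dagger> * D n"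
      "\<forall>\<^sub>F n in sequentially. X\<^sup>\<dagger> * c n + (c n)\<^sup>\<dagger> * X - (t n)\<^sup>2 *\<^sub>R ((c n)\<^sup>\<dagger> * c n) = ?Y\<^sup>\<dagger> * ?Y"
    by (auto elim: eventually_mono)
  show "X\<^sup>\<dagger> * ?Y = ?Y\<^sup>\<dagger> * X"
  proof (rule LIMSEQ_unique)
    show "(\<lambda>n. (D n)\<^sup>\<dagger> * ?Y) \<longlonglongrightarrow> X\<^sup>\<dagger> * ?Y" by (intro tendsto_intros D_lim)
    have "(\<lambda>n. ?Y\<^sup>\<dagger> * D n) \<longlonglongrightarrow> ?Y\<^sup>\<dagger> * X" by (intro tendsto_intros D_lim)
    then show "(\<lambda>n. (D n)\<^sup>\<dagger> * ?Y) \<longlonglongrightarrow> ?Y\<^sup>\<dagger> * X" using tendsto_cong[OF ev(1)] by blast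
  qed
  have "?Y\<^sup>\<dagger> * ?Y = X\<^sup>\<dagger> * ((1/2) *\<^sub>R ?Z) + ((1/2) *\<^sub>R ?Z)\<^sup>\<dagger> * X
      - 0\<^sup>2 *\<^sub>R (((1/2) *\<^sub>R ?Z)\<^sup>\<dagger> * ((1/2) *\<^sub>R ?Z))"
  proof (rule LIMSEQ_unique)
    let ?f = "\<lambda>n. X\<^sup>\<dagger> * c n + (c n)\<^sup>\<dagger> * X - (t n)\<^sup>2 *\<^sub>R ((c n)\<^sup>\<dagger> * c n)"
    show "?f \<longlonglongrightarrow> ?Y\<^sup>\<dagger> * ?Y" using tendsto_cong[OF ev(2)] by simp
    show "?f \<longlonglongrightarrow> X\<^sup>\<dagger> * ((1/2) *\<^sub>R ?Z) + ((1/2) *\<^sub>R ?Z)\<^sup>\<dagger> * X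
      - 0\<^sup>2 *\<^sub>R (((1/2) *\<^sub>R ?Z)\<^sup>\<dagger> * ((1/2) *\<^sub>R ?Z))"
      by (intro tendsto_intros t_lim c_lim)
  qed
  then have "?Y\<^sup>\<dagger> * ?Y = (1/2) *\<^sub>R (X\<^sup>\<dagger> * ?Z + ?Z\<^sup>\<dagger> * X)" by (simp add: scaleR_add_right)
  then show "2 *\<^sub>R (?Y\<^sup>\<dagger> * ?Y) = X\<^sup>\<dagger> * ?Z + ?Z\<^sup>\<dagger> * X" by simp
qed

text \<open>The first-order identity applied to \<open>S * S\<close> shows that
  \<open>X\<^sup>\<dagger> * \<Theta> (S * S)\<close> is self-adjoint, so the two terms of the
  second-order identity coincide.\<close>

lemma square_selfadj:
  assumes S: "S \<in> M" "S\<^sup>\<dagger> = S"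
  shows "(\<Theta> S)\<^sup>\<dagger> * \<Theta> S = X\<^sup>\<dagger> * \<Theta> (S * S)"
proof -
  have "X\<^sup>\<dagger> * \<Theta> (S * S) = (\<Theta> (S * S))\<^sup>\<dagger> * X"
    by (rule second_order_variation) (simp_all add: S mem)
  then have "2 *\<^sub>R ((\<Theta> S)\<^sup>\<dagger> * \<Theta> S) = 2 *\<^sub>R (X\<^sup>\<dagger> * \<Theta> (S * S))"
    using second_order_variation(2)[OF S] by (simp add: scaleR_2)
  then show ?thesis by simp
qed

text \<open>With A = S + iT the mixed terms cancel on both sides because \<open>A\<close> and its
  adjoint enter symmetrically; what remains are the squares of \<open>S\<close> and
  \<open>T\<close>.\<close>

lemma star_square_sum:
  assumes A: "A \<in> M"
  shows "(\<Theta> A)\<^sup>\<dagger> * \<Theta> A + (\<Theta> A\<^sup>\<dagger>)\<^sup>\<dagger> * \<Theta> A\<^sup>\<dagger> = X\<^sup>\<dagger> * \<Theta> (A\<^sup>\<dagger> * A + A * A\<^sup>\<dagger>)"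
proof -
  obtain S T where ST: "S \<in> M" "T \<in> M" "S\<^sup>\<dagger> = S" "T\<^sup>\<dagger> = T" "A = S + \<i> \<odot> T" "A\<^sup>\<dagger> = S - \<i> \<odot> T"
    using cartesian_decomposition[OF A] by metis
  have 1: "\<Theta> A = \<Theta> S + \<i> \<odot> \<Theta> T" "\<Theta> A\<^sup>\<dagger> = \<Theta> S - \<i> \<odot> \<Theta> T"
    using ST by (simp_all add: clin_add[OF \<Theta>] clin_diff[OF \<Theta>] clin_cscale[OF \<Theta>] mem)
  have 2: "A\<^sup>\<dagger> * A + A * A\<^sup>\<dagger> = (S * S + S * S) + (T * T + T * T)"
    unfolding ST(6) unfolding ST(5) by (simp add: algebra_simps cscale_add_right cscale_diff_right)
  have "(\<Theta> A)\<^sup>\<dagger> * \<Theta> A + (\<Theta> A\<^sup>\<dagger>)\<^sup>\<dagger> * \<Theta> A\<^sup>\<dagger>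
      = ((\<Theta> S)\<^sup>\<dagger> * \<Theta> S + (\<Theta> S)\<^sup>\<dagger> * \<Theta> S) + ((\<Theta> T)\<^sup>\<dagger> * \<Theta> T + (\<Theta> T)\<^sup>\<dagger> * \<Theta> T)"
    unfolding 1 by (simp add: algebra_simps cscale_add_right cscale_diff_right)
  also have "\<dots> = X\<^sup>\<dagger> * \<Theta> (A\<^sup>\<dagger> * A + A * A\<^sup>\<dagger>)"
    unfolding 2 using ST square_selfadj[OF ST(1,3)] square_selfadj[OF ST(2,4)]
    by (simp add: clin_add[OF \<Theta>] mem distrib_left)
  finally show ?thesis .
qed

end

end

section \<open>From extreme point preservers to Jordan homomorphisms\<close>

definition preserves_iso_coiso :: "'h::chilbert_space cop set \<Rightarrow> ('h cop \<Rightarrow> 'h cop) \<Rightarrow> bool" where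
  "preserves_iso_coiso M \<Phi> \<longleftrightarrow> (\<forall>A\<in>M. iso_coiso A \<longrightarrow> iso_coiso (\<Phi> A))"

text \<open>Each summand is bounded by \<open>1\<close>, so a sum of \<open>1 + 1\<close> forces
  equality in both.\<close>

lemma isometry_of_sum:
  assumes sum: "W\<^sup>\<dagger> * W + C\<^sup>\<dagger> * C = 1 + 1" and W: "norm W \<le> 1" and C: "norm C \<le> 1"
  shows "W\<^sup>\<dagger> * W = 1"
  unfolding isom_iff_norm
proof
  fix x
  have "Re (cinner ((W\<^sup>\<dagger> * W + C\<^sup>\<dagger> * C) \<rhd> x) x) = Re (cinner ((1 + 1) \<rhd> x) x)"
    using sum by simp
  then have "(norm (W \<rhd> x))\<^sup>2 + (norm (C \<rhd> x))\<^sup>2 = (norm x)\<^sup>2 + (norm x)\<^sup>2"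
    by (simp add: app_add cinner_add_left cinner_eq_norm cinner_self)
  moreover have "(norm (C \<rhd> x))\<^sup>2 \<le> (norm x)\<^sup>2"
    using norm_app_le[OF C, of x] by (simp add: power_mono)
  ultimately have "(norm x)\<^sup>2 \<le> (norm (W \<rhd> x))\<^sup>2" by linarith
  then have "norm x \<le> norm (W \<rhd> x)" by (rule power2_le_imp_le) simp
  then show "norm (W \<rhd> x) = norm x" using norm_app_le[OF W, of x] by simp
qed

context star_algebra begin

text \<open>With x o y = xy + yx one has 2(ABC + CBA) = A o (B o C) + C o (A o B) - B o (A o C), and
  \<Psi> respects o.\<close>

lemma jordan_triple:
  assumes \<Psi>: "clin_on M \<Psi>"
    and jordan: "\<And>A B. A \<in> M \<Longrightarrow> B \<in> M \<Longrightarrow> \<Psi> (A * B + B * A) = \<Psi> A * \<Psi> B + \<Psi> B * \<Psi> A"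
    and A: "A \<in> M" and B: "B \<in> M" and C: "C \<in> M"
  shows "\<Psi> (A * B * C + C * B * A) = \<Psi> A * \<Psi> B * \<Psi> C + \<Psi> C * \<Psi> B * \<Psi> A"
proof -
  let ?X = "B * C + C * B" and ?Y = "A * B + B * A" and ?Z = "A * C + C * A"
  have m: "?X \<in> M" "?Y \<in> M" "?Z \<in> M" using A B C by (simp_all add: mem)
  have "2 *\<^sub>R (A * B * C + C * B * A) = (A * ?X + ?X * A) + (C * ?Y + ?Y * C) - (B * ?Z + ?Z * B)"
    by (simp add: scaleR_2 algebra_simps)
  then have "2 *\<^sub>R \<Psi> (A * B * C + C * B * A)
      = \<Psi> ((A * ?X + ?X * A) + (C * ?Y + ?Y * C) - (B * ?Z + ?Z * B))"
    using clin_scaleR[OF \<Psi>, of "A * B * C + C * B * A" 2] A B C by (simp add: mem)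
  also have "\<dots> = \<Psi> (A * ?X + ?X * A) + \<Psi> (C * ?Y + ?Y * C) - \<Psi> (B * ?Z + ?Z * B)"
    using A B C m by (simp only: clin_diff[OF \<Psi>] clin_add[OF \<Psi>] mem)
  also have "\<dots> = 2 *\<^sub>R (\<Psi> A * \<Psi> B * \<Psi> C + \<Psi> C * \<Psi> B * \<Psi> A)"
    unfolding jordan[OF A m(1)] jordan[OF C m(2)] jordan[OF B m(3)] jordan[OF A B] jordan[OF B C] jordan[OF A C]
    by (simp add: scaleR_2 algebra_simps)
  finally show ?thesis by simp
qed

end

context vn_algebra begin

context
  fixes \<Psi> assumes \<Psi>: "clin_on M \<Psi>" and units: "\<And>U. U \<in> M \<Longrightarrow> unit U \<Longrightarrow> iso_coiso (\<Psi> U)"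
    and one: "\<Psi> 1 = 1"
begin

lemma unital_selfadj:
  assumes "S \<in> M" "S\<^sup>\<dagger> = S"
  shows "(\<Psi> S)\<^sup>\<dagger> = \<Psi> S" "\<Psi> (S * S) = \<Psi> S * \<Psi> S"
proof -
  show sa: "(\<Psi> S)\<^sup>\<dagger> = \<Psi> S"
    using second_order_variation(1)[OF \<Psi> units, of 1 S] one assms by simp
  show "\<Psi> (S * S) = \<Psi> S * \<Psi> S"
    using square_selfadj[OF \<Psi> units, of 1 S] one assms sa by simp
qed

lemma unital_star:
  assumes "A \<in> M"
  shows "\<Psi> A\<^sup>\<dagger> = (\<Psi> A)\<^sup>\<dagger>"
proof -
  obtain S T where "S \<in> M" "T \<in> M" "S\<^sup>\<dagger> = S" "T\<^sup>\<dagger> = T" "A = S + \<i> \<odot> T" "A\<^sup>\<dagger> = S - \<i> \<odot> T"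
    using cartesian_decomposition[OF assms] by metis
  then show ?thesis by (simp add: clin[OF \<Psi>] mem unital_selfadj)
qed

text \<open>Squares of sums of self-adjoint elements give the identity for self-adjoint factors;
  both sides are complex-bilinear, which extends it to all of \<open>M\<close>.\<close>

lemma unital_jordan:
  assumes A: "A \<in> M" and B: "B \<in> M"
  shows "\<Psi> (A * B + B * A) = \<Psi> A * \<Psi> B + \<Psi> B * \<Psi> A"
proof -
  have sa: "\<Psi> (S * T) + \<Psi> (T * S) = \<Psi> S * \<Psi> T + \<Psi> T * \<Psi> S"
    if "S \<in> M" "S\<^sup>\<dagger> = S" "T \<in> M" "T\<^sup>\<dagger> = T" for S T
    using unital_selfadj(2)[of "S + T"] unital_selfadj(2)[of S] unital_selfadj(2)[of T] that
    by (simp add: clin_add[OF \<Psi>] mem algebra_simps)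
  obtain S T where ST: "S \<in> M" "T \<in> M" "S\<^sup>\<dagger> = S" "T\<^sup>\<dagger> = T" "A = S + \<i> \<odot> T"
    using cartesian_decomposition[OF A] by metis
  obtain U V where UV: "U \<in> M" "V \<in> M" "U\<^sup>\<dagger> = U" "V\<^sup>\<dagger> = V" "B = U + \<i> \<odot> V"
    using cartesian_decomposition[OF B] by metis
  have "\<Psi> (A * B + B * A) = (\<Psi> (S * U) + \<Psi> (U * S)) + \<i> \<odot> (\<Psi> (S * V) + \<Psi> (V * S))
      + \<i> \<odot> (\<Psi> (T * U) + \<Psi> (U * T)) - (\<Psi> (T * V) + \<Psi> (V * T))"
    unfolding ST(5) UV(5) using ST(1,2) UV(1,2)
    by (simp add: clin[OF \<Psi>] mem algebra_simps cscale_add_right)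
  also have "\<dots> = \<Psi> A * \<Psi> B + \<Psi> B * \<Psi> A"
    unfolding sa[OF ST(1,3) UV(1,3)] sa[OF ST(1,3) UV(2,4)] sa[OF ST(2,4) UV(1,3)] sa[OF ST(2,4) UV(2,4)]
    unfolding ST(5) UV(5) using ST(1,2) UV(1,2)
    by (simp add: clin[OF \<Psi>] mem algebra_simps cscale_add_right)
  finally show ?thesis .
qed

end

text \<open>If \<open>V\<close> is an isometry, take \<open>star_square_sum\<close> for
  \<open>\<Theta> A = \<Phi> (A * V)\<close> at \<open>A = V\<^sup>\<dagger>\<close>. The two images
  are \<open>\<Phi> 1\<close> and \<open>\<Phi> (V * V)\<close>, and the right-hand side is
  \<open>(\<Phi> V)\<^sup>\<dagger> * \<Phi> (V + V) = 1 + 1\<close>. Both images are contractions,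
  hence isometries. For a co-isometry the factor \<open>V\<close> stands on the left.\<close>

lemma isometry_image_one:
  assumes \<Phi>: "clin_on M \<Phi>" and pres: "preserves_iso_coiso M \<Phi>"
    and V: "V \<in> M" "iso_coiso V" and iso: "(\<Phi> V)\<^sup>\<dagger> * \<Phi> V = 1"
  shows "(\<Phi> 1)\<^sup>\<dagger> * \<Phi> 1 = 1"
proof -
  have "(\<Phi> 1)\<^sup>\<dagger> * \<Phi> 1 + (\<Phi> (V * V))\<^sup>\<dagger> * \<Phi> (V * V) = 1 + 1 \<and> iso_coiso (V * V)"
  proof (cases "V\<^sup>\<dagger> * V = 1")
    case True
    have "(\<Phi> (V\<^sup>\<dagger> * V))\<^sup>\<dagger> * \<Phi> (V\<^sup>\<dagger> * V) + (\<Phi> (V\<^sup>\<dagger>\<^sup>\<dagger> * V))\<^sup>\<dagger> * \<Phi> (V\<^sup>\<dagger>\<^sup>\<dagger> * V)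
        = (\<Phi> V)\<^sup>\<dagger> * \<Phi> ((V\<^sup>\<dagger>\<^sup>\<dagger> * V\<^sup>\<dagger> + V\<^sup>\<dagger> * V\<^sup>\<dagger>\<^sup>\<dagger>) * V)"
    proof (rule star_square_sum[OF clin_on_right[OF \<Phi> V(1)]])
      show "iso_coiso (\<Phi> (U * V))" if "U \<in> M" "unit U" for U
        using that pres V unfolding preserves_iso_coiso_def by (blast intro: mult_mem unit_mult_iso_coiso)
    qed (use V iso in \<open>simp_all add: mem\<close>)
    moreover have "(V\<^sup>\<dagger>\<^sup>\<dagger> * V\<^sup>\<dagger> + V\<^sup>\<dagger> * V\<^sup>\<dagger>\<^sup>\<dagger>) * V = V + V"
      by (simp add: distrib_right mult.assoc True)
    moreover have "(V * V)\<^sup>\<dagger> * (V * V) = V\<^sup>\<dagger> * (V\<^sup>\<dagger> * V) * V" by (simp add: mult.assoc)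
    ultimately show ?thesis
      using True V iso by (simp add: clin_add[OF \<Phi>] distrib_left iso_coiso_def)
  next
    case False
    then have co: "V * V\<^sup>\<dagger> = 1" using V(2) by (simp add: iso_coiso_def)
    have "(\<Phi> (V * V\<^sup>\<dagger>))\<^sup>\<dagger> * \<Phi> (V * V\<^sup>\<dagger>) + (\<Phi> (V * V\<^sup>\<dagger>\<^sup>\<dagger>))\<^sup>\<dagger> * \<Phi> (V * V\<^sup>\<dagger>\<^sup>\<dagger>)
        = (\<Phi> V)\<^sup>\<dagger> * \<Phi> (V * (V\<^sup>\<dagger>\<^sup>\<dagger> * V\<^sup>\<dagger> + V\<^sup>\<dagger> * V\<^sup>\<dagger>\<^sup>\<dagger>))"
    proof (rule star_square_sum[OF clin_on_left[OF \<Phi> V(1)]])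
      show "iso_coiso (\<Phi> (V * U))" if "U \<in> M" "unit U" for U
        using that pres V unfolding preserves_iso_coiso_def by (blast intro: mult_mem iso_coiso_mult_unit)
    qed (use V iso in \<open>simp_all add: mem\<close>)
    moreover have "V * (V\<^sup>\<dagger>\<^sup>\<dagger> * V\<^sup>\<dagger> + V\<^sup>\<dagger> * V\<^sup>\<dagger>\<^sup>\<dagger>) = V + V"
      by (simp add: distrib_left co flip: mult.assoc)
    moreover have "(V * V) * (V * V)\<^sup>\<dagger> = V * (V * V\<^sup>\<dagger>) * V\<^sup>\<dagger>" by (simp add: mult.assoc)
    ultimately show ?thesis
      using co V iso by (simp add: clin_add[OF \<Phi>] distrib_left iso_coiso_def)
  qed
  moreover have "norm (\<Phi> 1) \<le> 1"
    using pres one_mem by (intro norm_iso_coiso_le) (auto simp: preserves_iso_coiso_def iso_coiso_def)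
  ultimately show ?thesis
    using isometry_of_sum norm_iso_coiso_le pres V(1) unfolding preserves_iso_coiso_def by (metis mult_mem)
qed

lemma preserves_iso_coiso_dual:
  "preserves_iso_coiso M \<Phi> \<Longrightarrow> preserves_iso_coiso M (\<lambda>A. (\<Phi> A\<^sup>\<dagger>)\<^sup>\<dagger>)"
  by (simp add: preserves_iso_coiso_def iso_coiso_star star_mem)

lemma coisometry_image_one:
  assumes \<Phi>: "clin_on M \<Phi>" and pres: "preserves_iso_coiso M \<Phi>"
    and V: "V \<in> M" "iso_coiso V" and co: "\<Phi> V * (\<Phi> V)\<^sup>\<dagger> = 1"
  shows "\<Phi> 1 * (\<Phi> 1)\<^sup>\<dagger> = 1"
  using isometry_image_one[OF clin_on_dual[OF \<Phi>] preserves_iso_coiso_dual[OF pres], of "V\<^sup>\<dagger>"] V co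
  by (simp add: star_mem iso_coiso_star)

end

section \<open>Algebras with two orthogonal isometries: the image of \<open>1\<close> and the
  dichotomy for Jordan maps\<close>

locale properly_infinite_vn_algebra = vn_algebra M for M :: "'h::chilbert_space cop set" +
  fixes V1 V2 :: "'h cop"
  assumes V1: "V1 \<in> M" "V1\<^sup>\<dagger> * V1 = 1" and V2: "V2 \<in> M" "V2\<^sup>\<dagger> * V2 = 1"
    and orth: "V1\<^sup>\<dagger> * V2 = 0" and nontrivial: "(1 :: 'h cop) \<noteq> 0"
begin

lemma orth': "V2\<^sup>\<dagger> * V1 = 0"
  using arg_cong[OF orth, of star] by simp

text \<open>Otherwise every isometry and co-isometry is mapped to an isometry, and then
  \<open>B \<mapsto> (\<Phi> 1)\<^sup>\<dagger> * \<Phi> B\<close> takes the value \<open>1\<close> at both of the orthogonal range projections of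
  \<open>V1\<close> and \<open>V2\<close>, hence the value \<open>-1\<close> at a projection; but it is positive.\<close>

lemma image_one_coisometry:
  assumes \<Phi>: "clin_on M \<Phi>" and pres: "preserves_iso_coiso M \<Phi>"
  shows "\<Phi> 1 * (\<Phi> 1)\<^sup>\<dagger> = 1"
proof (rule ccontr)
  assume nco: "\<Phi> 1 * (\<Phi> 1)\<^sup>\<dagger> \<noteq> 1"
  have iso: "(\<Phi> V)\<^sup>\<dagger> * \<Phi> V = 1" if "V \<in> M" "iso_coiso V" for V
    using coisometry_image_one[OF \<Phi> pres that] nco that pres
    by (auto simp: preserves_iso_coiso_def iso_coiso_def)
  have one: "(\<Phi> 1)\<^sup>\<dagger> * \<Phi> 1 = 1" by (rule iso) (simp_all add: mem iso_coiso_def)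
  have units: "iso_coiso (\<Phi> U)" if "U \<in> M" "unit U" for U
    using iso[OF that(1) iso_coiso_unit[OF that(2)]] by (simp add: iso_coiso_def)
  \<comment> \<open>Both \<open>V\<close> and its adjoint are sent to isometries, so
    \<open>star_square_sum\<close> has \<open>1 + 1\<close> on the left; the term with
    \<open>V\<^sup>\<dagger> * V = 1\<close> accounts for one of the two.\<close>
  have range: "(\<Phi> 1)\<^sup>\<dagger> * \<Phi> (V * V\<^sup>\<dagger>) = 1" if V: "V \<in> M" "V\<^sup>\<dagger> * V = 1" for V
  proof -
    have "(\<Phi> V)\<^sup>\<dagger> * \<Phi> V + (\<Phi> V\<^sup>\<dagger>)\<^sup>\<dagger> * \<Phi> V\<^sup>\<dagger> = (\<Phi> 1)\<^sup>\<dagger> * \<Phi> (V\<^sup>\<dagger> * V + V * V\<^sup>\<dagger>)"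
      by (rule star_square_sum[OF \<Phi> units]) (simp_all add: one V)
    moreover have "iso_coiso V" "iso_coiso V\<^sup>\<dagger>" using V by (simp_all add: iso_coiso_def)
    ultimately show ?thesis
      using V by (simp add: iso mem clin_add[OF \<Phi>] distrib_left one)
  qed
  define P where "P = V1 * V1\<^sup>\<dagger>"
  define Q where "Q = V2 * V2\<^sup>\<dagger>"
  have idem: "P * P = P" "Q * Q = Q" "P * Q = 0" "Q * P = 0"
    unfolding P_def Q_def using V1 V2 orth orth'
    by (metis mult.assoc mult_1_left mult_1 mult_zero_left mult_zero_right)+
  have PQ: "P \<in> M" "Q \<in> M" "P\<^sup>\<dagger> = P" "Q\<^sup>\<dagger> = Q" using V1 V2 by (simp_all add: P_def Q_def mem)
  \<comment> \<open>\<open>S\<close> is the projection whose image would satisfy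
    \<open>(\<Phi> S)\<^sup>\<dagger> * \<Phi> S = 1 - 1 - 1\<close>.\<close>
  define S where "S = 1 - P - Q"
  have S: "S \<in> M" "S\<^sup>\<dagger> = S" "S * S = S"
    using PQ by (simp_all add: S_def mem idem algebra_simps)
  have "(\<Phi> S)\<^sup>\<dagger> * \<Phi> S = (\<Phi> 1)\<^sup>\<dagger> * \<Phi> S"
    using square_selfadj[OF \<Phi> units _ _ S(1,2), of "\<Phi> 1"] one S(3) by simp
  also have "\<dots> = - 1"
    using PQ range[OF V1] range[OF V2] one
    by (simp add: S_def P_def Q_def clin_diff[OF \<Phi>] mem right_diff_distrib)
  finally have "(norm (\<Phi> S \<rhd> x))\<^sup>2 = - ((norm x)\<^sup>2)" for x
    using cinner_eq_norm[of "\<Phi> S" x]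
    by (simp add: app_minus cinner_minus_left cinner_self flip: app_mult)
  then have "x = 0" for x :: 'h
    by (metis neg_0_le_iff_le zero_le_power2 power2_less_eq_zero_iff norm_eq_zero)
  then have "(1 :: 'h cop) = 0" by (intro cop_eqI) metis
  then show False using nontrivial by simp
qed

lemma image_one_unit:
  assumes \<Phi>: "clin_on M \<Phi>" and pres: "preserves_iso_coiso M \<Phi>"
  shows "unit (\<Phi> 1)"
  using image_one_coisometry[OF \<Phi> pres]
    image_one_coisometry[OF clin_on_dual[OF \<Phi>] preserves_iso_coiso_dual[OF pres]]
  by (simp add: unit_def)

text \<open>The multiplication \<open>m\<close> is either that of the operators or its opposite. The Peirce corners
  of the range projection \<open>P\<close> of \<open>V1\<close> are products of off-diagonal elements, and on the
  off-diagonal elements multiplicativity is read off from the Jordan identity.\<close>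

lemma jordan_multiplicative:
  fixes m :: "'h cop \<Rightarrow> 'h cop \<Rightarrow> 'h cop"
  assumes m_assoc: "\<And>a b c. m (m a b) c = m a (m b c)"
    and m_add: "\<And>a b c. m (a + b) c = m a c + m b c" "\<And>a b c. m a (b + c) = m a b + m a c"
    and \<Psi>: "clin_on M \<Psi>"
    and jordan: "\<And>A B. A \<in> M \<Longrightarrow> B \<in> M \<Longrightarrow> \<Psi> (A * B + B * A) = m (\<Psi> A) (\<Psi> B) + m (\<Psi> B) (\<Psi> A)"
    and P: "P = V1 * V1\<^sup>\<dagger>"
    and right: "\<And>A. A \<in> M \<Longrightarrow> \<Psi> (A * P) = m (\<Psi> A) (\<Psi> P)"
    and left: "\<And>A. A \<in> M \<Longrightarrow> \<Psi> (P * A) = m (\<Psi> P) (\<Psi> A)"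
    and A: "A \<in> M" and B: "B \<in> M"
  shows "\<Psi> (A * B) = m (\<Psi> A) (\<Psi> B)"
proof -
  have m_zero: "m 0 a = 0" "m a 0 = 0" for a
    using m_add(1)[of 0 0 a] m_add(2)[of a 0 0] by simp_all
  have PM: "P \<in> M" and PP: "P * P = P"
    using V1 by (simp_all add: P mem) (metis mult.assoc mult_1_left)
  have PP': "P * (P * a) = P * a" for a by (simp add: PP flip: mult.assoc)
  \<comment> \<open>Insert \<open>\<Psi> P\<close> between the two images: one neighbour absorbs it
    and the other is annihilated.\<close>
  have orth0: "m (\<Psi> a) (\<Psi> b) = 0"
    if "a \<in> M" "b \<in> M" "(a * P = 0 \<and> P * b = b) \<or> (a * P = a \<and> P * b = 0)" for a b
    using right[OF that(1)] left[OF that(2)] that(3) m_assoc[of "\<Psi> a" "\<Psi> P" "\<Psi> b"] clin_zero[OF \<Psi>]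
    by (auto simp: m_zero)
  have jordan': "\<Psi> (a * b) + \<Psi> (b * a) = m (\<Psi> a) (\<Psi> b) + m (\<Psi> b) (\<Psi> a)" if "a \<in> M" "b \<in> M" for a b
    using jordan[OF that] that by (simp add: clin_add[OF \<Psi>] mem)
  \<comment> \<open>Here both products in the order \<open>b\<close>, \<open>a\<close> vanish, and
    the Jordan identity reduces to the other order.\<close>
  have comp0: "\<Psi> (a * b) = m (\<Psi> a) (\<Psi> b)"
    if "a \<in> M" "b \<in> M" "b * a = 0" "(b * P = 0 \<and> P * a = a) \<or> (b * P = b \<and> P * a = 0)" for a b
    using jordan'[OF that(1,2)] orth0[OF that(2,1,4)] that(3) by (simp add: clin_zero[OF \<Psi>])
  \<comment> \<open>\<open>a * b\<close> lies in the corner of \<open>P\<close> and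
    \<open>b * a\<close> in the complementary one, so multiplying the Jordan identity by
    \<open>\<Psi> P\<close> keeps just the first.\<close>
  have off1: "\<Psi> (a * b) = m (\<Psi> a) (\<Psi> b)"
    if "a \<in> M" "b \<in> M" and a: "P * a = a" "a * P = 0" and b: "P * b = 0" "b * P = b" for a b
  proof -
    have "m (\<Psi> P) (\<Psi> (a * b) + \<Psi> (b * a)) = m (\<Psi> P) (m (\<Psi> a) (\<Psi> b) + m (\<Psi> b) (\<Psi> a))"
      using jordan'[OF that(1,2)] by simp
    moreover have "m (\<Psi> P) (\<Psi> (a * b)) = \<Psi> (a * b)" "m (\<Psi> P) (\<Psi> (b * a)) = 0"
      "m (\<Psi> P) (\<Psi> a) = \<Psi> a" "m (\<Psi> P) (\<Psi> b) = 0"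
      using left[of "a * b"] left[of "b * a"] left[of a] left[of b] that
      by (simp_all add: mem clin_zero[OF \<Psi>] flip: mult.assoc)
    ultimately show ?thesis by (simp add: m_add m_zero flip: m_assoc)
  qed
  have off2: "\<Psi> (a * b) = m (\<Psi> a) (\<Psi> b)"
    if "a \<in> M" "b \<in> M" and a: "P * a = 0" "a * P = a" and b: "P * b = b" "b * P = 0" for a b
    using jordan'[OF that(1,2)] off1[OF that(2,1) b a] by simp
  \<comment> \<open>The elements that are multiplicative as right factors. They are closed under
    sums and products, so it is enough to build \<open>B\<close> from off-diagonal elements.\<close>
  define G where "G = {b \<in> M. \<forall>a\<in>M. \<Psi> (a * b) = m (\<Psi> a) (\<Psi> b)}"
  have G_mult: "b * c \<in> G" if "b \<in> G" "c \<in> G" for b c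
  proof -
    have "\<Psi> (a * (b * c)) = m (\<Psi> a) (\<Psi> (b * c))" if a: "a \<in> M" for a
    proof -
      have "\<Psi> (a * b * c) = m (\<Psi> (a * b)) (\<Psi> c)" "\<Psi> (a * b) = m (\<Psi> a) (\<Psi> b)" "\<Psi> (b * c) = m (\<Psi> b) (\<Psi> c)"
        using \<open>b \<in> G\<close> \<open>c \<in> G\<close> a by (auto simp: G_def mem)
      then show ?thesis by (simp add: m_assoc mult.assoc)
    qed
    then show ?thesis using that by (simp add: G_def mem)
  qed
  have G_add: "b + c \<in> G" if "b \<in> G" "c \<in> G" for b c
    using that by (auto simp: G_def mem distrib_left clin_add[OF \<Psi>] m_add)
  have split: "\<Psi> (a * b) = m (\<Psi> a) (\<Psi> b)"
    if "a \<in> M" "b \<in> M" and 1: "\<Psi> (a * P * b) = m (\<Psi> (a * P)) (\<Psi> b)"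
      and 2: "\<Psi> ((a - a * P) * b) = m (\<Psi> (a - a * P)) (\<Psi> b)" for a b
  proof -
    have eq: "a * b = a * P * b + (a - a * P) * b" by (simp add: left_diff_distrib)
    have "\<Psi> (a * b) = \<Psi> (a * P * b) + \<Psi> ((a - a * P) * b)"
      by (subst eq, rule clin_add[OF \<Psi>]) (simp_all add: that mem PM)
    also have "\<dots> = m (\<Psi> (a * P) + \<Psi> (a - a * P)) (\<Psi> b)" by (simp only: 1 2 m_add)
    also have "\<Psi> (a * P) + \<Psi> (a - a * P) = \<Psi> a"
      by (subst clin_add[OF \<Psi>, symmetric]) (simp_all add: that mem PM)
    finally show ?thesis .
  qed
  have split': "\<Psi> (a * b) = m (\<Psi> a) (\<Psi> b)"
    if "a \<in> M" "b \<in> M" and 1: "\<Psi> (P * a * b) = m (\<Psi> (P * a)) (\<Psi> b)"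
      and 2: "\<Psi> ((a - P * a) * b) = m (\<Psi> (a - P * a)) (\<Psi> b)" for a b
  proof -
    have eq: "a * b = P * a * b + (a - P * a) * b" by (simp add: left_diff_distrib)
    have "\<Psi> (a * b) = \<Psi> (P * a * b) + \<Psi> ((a - P * a) * b)"
      by (subst eq, rule clin_add[OF \<Psi>]) (simp_all add: that mem PM)
    also have "\<dots> = m (\<Psi> (P * a) + \<Psi> (a - P * a)) (\<Psi> b)" by (simp only: 1 2 m_add)
    also have "\<Psi> (P * a) + \<Psi> (a - P * a) = \<Psi> a"
      by (subst clin_add[OF \<Psi>, symmetric]) (simp_all add: that mem PM)
    finally show ?thesis .
  qed
  \<comment> \<open>The left factor is cut into Peirce pieces: \<open>a * P\<close> annihilates
    \<open>c\<close>, also after \<Psi>; \<open>P * d\<close> is off-diagonal and falls under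
    \<open>off1\<close>; what is left satisfies \<open>comp0\<close>.\<close>
  have G_off1: "c \<in> G" if c: "c \<in> M" "P * c = 0" "c * P = c" for c
  proof -
    have "\<Psi> (a * c) = m (\<Psi> a) (\<Psi> c)" if a: "a \<in> M" for a
    proof (rule split[OF a c(1)])
      have "a * P * c = 0" using c by (simp add: mult.assoc)
      moreover have "m (\<Psi> (a * P)) (\<Psi> c) = 0"
        by (rule orth0) (simp_all add: a c mem PM PP mult.assoc)
      ultimately show "\<Psi> (a * P * c) = m (\<Psi> (a * P)) (\<Psi> c)" by (simp add: clin_zero[OF \<Psi>])
      define d where "d = a - a * P"
      have d: "d \<in> M" "d * P = 0" by (simp_all add: d_def a mem PM left_diff_distrib mult.assoc PP)
      show "\<Psi> (d * c) = m (\<Psi> d) (\<Psi> c)"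
      proof (rule split'[OF d(1) c(1)])
        show "\<Psi> (P * d * c) = m (\<Psi> (P * d)) (\<Psi> c)"
          by (rule off1) (simp_all add: c d mem PM PP' mult.assoc)
        show "\<Psi> ((d - P * d) * c) = m (\<Psi> (d - P * d)) (\<Psi> c)"
        proof (rule comp0)
          have "c * (P * d) = c * d" using c(3) by (simp flip: mult.assoc)
          then show "c * (d - P * d) = 0" by (simp add: right_diff_distrib)
        qed (simp_all add: c d mem PM PP' right_diff_distrib)
      qed
    qed
    then show ?thesis using c by (simp add: G_def)
  qed
  have G_off2: "c \<in> G" if c: "c \<in> M" "P * c = c" "c * P = 0" for c
  proof -
    have "\<Psi> (a * c) = m (\<Psi> a) (\<Psi> c)" if a: "a \<in> M" for a
    proof (rule split[OF a c(1)])
      define d where "d = a * P"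
      have d: "d \<in> M" "d * P = d" by (simp_all add: d_def a mem PM mult.assoc PP)
      show "\<Psi> (d * c) = m (\<Psi> d) (\<Psi> c)"
      proof (rule split'[OF d(1) c(1)])
        show "\<Psi> (P * d * c) = m (\<Psi> (P * d)) (\<Psi> c)"
        proof (rule comp0)
          show "c * (P * d) = 0" using c(3) by (simp flip: mult.assoc)
        qed (simp_all add: c d mem PM PP')
        show "\<Psi> ((d - P * d) * c) = m (\<Psi> (d - P * d)) (\<Psi> c)"
          by (rule off2) (simp_all add: c d mem PM PP' algebra_simps)
      qed
      have "(a - a * P) * c = 0" using c by (simp add: left_diff_distrib mult.assoc)
      moreover have "m (\<Psi> (a - a * P)) (\<Psi> c) = 0"
        by (rule orth0) (simp_all add: a c mem PM PP left_diff_distrib mult.assoc)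
      ultimately show "\<Psi> ((a - a * P) * c) = m (\<Psi> (a - a * P)) (\<Psi> c)" by (simp add: clin_zero[OF \<Psi>])
    qed
    then show ?thesis using c by (simp add: G_def)
  qed
  have V1': "V1\<^sup>\<dagger> * (V1 * a) = a" and V2': "V2\<^sup>\<dagger> * (V2 * a) = a" for a
    using V1 V2 by (simp_all flip: mult.assoc)
  have V12: "V1\<^sup>\<dagger> * (V2 * a) = 0" and V21: "V2\<^sup>\<dagger> * (V1 * a) = 0" for a
    using orth orth' by (simp_all flip: mult.assoc)
  \<comment> \<open>\<open>V2\<^sup>\<dagger> * V2 = 1\<close> is inserted through the range of
    \<open>V2\<close>, which is orthogonal to \<open>P\<close>. This writes the corner element as a
    product of two off-diagonal ones.\<close>
  have PB: "P * B * P \<in> G"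
  proof -
    have "P * B * P * V1 * V2\<^sup>\<dagger> \<in> G"
      by (rule G_off2) (simp_all add: mem PM B V1 V2 PP' mult.assoc, simp add: P orth' mult.assoc V21)
    moreover have "V2 * V1\<^sup>\<dagger> \<in> G"
      by (rule G_off1) (simp_all add: mem V1 V2 P mult.assoc V12 V1')
    moreover have "P * B * P * V1 * V2\<^sup>\<dagger> * (V2 * V1\<^sup>\<dagger>) = P * B * P"
    proof -
      have "P * B * P * V1 * V2\<^sup>\<dagger> * (V2 * V1\<^sup>\<dagger>) = P * B * (P * P)"
        by (simp add: mult.assoc V2' P V1')
      then show ?thesis by (simp only: PP)
    qed
    ultimately show ?thesis using G_mult by metis
  qed
  let ?Q = "1 - P"
  have PV1: "P * V1 = V1" using V1 by (simp add: P mult.assoc)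
  \<comment> \<open>Here \<open>V1\<^sup>\<dagger> * V1 = 1\<close> is inserted: the range of
    \<open>V1\<close> is that of \<open>P\<close>, so both factors are off-diagonal.\<close>
  have QB: "?Q * B * ?Q \<in> G"
  proof -
    have "?Q * B * ?Q * V1\<^sup>\<dagger> \<in> G"
      by (rule G_off1) (simp_all add: mem PM B V1 PP' algebra_simps, simp_all add: P V1')
    moreover have "V1 * ?Q \<in> G"
      by (rule G_off2) (simp_all add: mem PM V1 PP algebra_simps, simp add: PV1 flip: mult.assoc)
    moreover have "?Q * B * ?Q * V1\<^sup>\<dagger> * (V1 * ?Q) = ?Q * B * ?Q"
    proof -
      have "?Q * B * ?Q * V1\<^sup>\<dagger> * (V1 * ?Q) = ?Q * B * (?Q * ?Q)"
        by (simp add: mult.assoc V1')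
      moreover have "?Q * ?Q = ?Q" by (simp add: algebra_simps PP)
      ultimately show ?thesis by metis
    qed
    ultimately show ?thesis using G_mult by metis
  qed
  have "P * B * ?Q \<in> G" "?Q * B * P \<in> G"
    by (rule G_off2 G_off1; simp add: mem PM B PP PP' algebra_simps)+
  then have "(P * B * P + P * B * ?Q) + (?Q * B * P + ?Q * B * ?Q) \<in> G"
    using PB QB by (intro G_add)
  moreover have "(P * B * P + P * B * ?Q) + (?Q * B * P + ?Q * B * ?Q) = B"
    by (simp add: algebra_simps)
  ultimately show ?thesis using A by (simp add: G_def)
qed

text \<open>The Jordan triple product of \<open>V1\<^sup>\<dagger>\<close>, \<open>V1\<close>,
  \<open>A\<close> gives \<open>\<Psi> A + \<Psi> (A * P) = X\<^sup>\<dagger> * X * \<Psi> A +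
  \<Psi> A * X * X\<^sup>\<dagger>\<close>. If \<open>X\<close> is an isometry,
  \<open>\<Psi> A\<close> cancels on the left of the sum and
  \<open>\<Psi> P = X * X\<^sup>\<dagger>\<close> multiplies from the right; if \<open>X\<close> is
  a co-isometry, the other term cancels and \<open>\<Psi> P = X\<^sup>\<dagger> * X\<close>
  multiplies from the left.\<close>

lemma jordan_hom_or_antihom:
  assumes \<Psi>: "clin_on M \<Psi>" and one: "\<Psi> 1 = 1" and star: "\<And>A. A \<in> M \<Longrightarrow> \<Psi> A\<^sup>\<dagger> = (\<Psi> A)\<^sup>\<dagger>"
    and jordan: "\<And>A B. A \<in> M \<Longrightarrow> B \<in> M \<Longrightarrow> \<Psi> (A * B + B * A) = \<Psi> A * \<Psi> B + \<Psi> B * \<Psi> A"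
    and V1_image: "iso_coiso (\<Psi> V1)"
  shows "(\<forall>A\<in>M. \<forall>B\<in>M. \<Psi> (A * B) = \<Psi> A * \<Psi> B) \<or> (\<forall>A\<in>M. \<forall>B\<in>M. \<Psi> (A * B) = \<Psi> B * \<Psi> A)"
proof -
  define P where "P = V1 * V1\<^sup>\<dagger>"
  define X where "X = \<Psi> V1"
  have PM: "P \<in> M" using V1 by (simp add: P_def mem)
  have X': "\<Psi> V1\<^sup>\<dagger> = X\<^sup>\<dagger>" using star V1 by (simp add: X_def)
  have r: "\<Psi> A + \<Psi> (A * P) = X\<^sup>\<dagger> * X * \<Psi> A + \<Psi> A * X * X\<^sup>\<dagger>" if A: "A \<in> M" for A
    using jordan_triple[OF \<Psi> jordan, of "V1\<^sup>\<dagger>" V1 A] V1 A PM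
    by (simp add: mem clin_add[OF \<Psi>] X' mult.assoc flip: X_def P_def)
  have l: "\<Psi> A + \<Psi> (P * A) = \<Psi> A * X\<^sup>\<dagger> * X + X * X\<^sup>\<dagger> * \<Psi> A" if A: "A \<in> M" for A
    using jordan_triple[OF \<Psi> jordan, of A "V1\<^sup>\<dagger>" V1] V1 A PM
    by (simp add: mem clin_add[OF \<Psi>] X' mult.assoc flip: X_def) (simp add: P_def mult.assoc)
  have \<Psi>P: "1 + \<Psi> P = X\<^sup>\<dagger> * X + X * X\<^sup>\<dagger>" using r[OF one_mem] one by simp
  consider "X\<^sup>\<dagger> * X = 1" | "X * X\<^sup>\<dagger> = 1" using V1_image by (auto simp: iso_coiso_def X_def)
  then show ?thesis
  proof cases
    case 1
    have p: "\<Psi> P = X * X\<^sup>\<dagger>" using \<Psi>P 1 by simp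
    have "\<Psi> (A * B) = \<Psi> A * \<Psi> B" if "A \<in> M" "B \<in> M" for A B
    proof (rule jordan_multiplicative[where m = "(*)", OF _ _ _ \<Psi> jordan P_def _ _ that])
      show "\<Psi> (A * P) = \<Psi> A * \<Psi> P" if "A \<in> M" for A
        using r[OF that] by (simp add: 1 p mult.assoc)
      show "\<Psi> (P * A) = \<Psi> P * \<Psi> A" if "A \<in> M" for A
        using l[OF that] by (simp add: 1 p mult.assoc)
    qed (simp_all add: algebra_simps)
    then show ?thesis by blast
  next
    case 2
    have p: "\<Psi> P = X\<^sup>\<dagger> * X" using \<Psi>P 2 by (simp add: add.commute)
    have "\<Psi> (A * B) = \<Psi> B * \<Psi> A" if "A \<in> M" "B \<in> M" for A B
    proof (rule jordan_multiplicative[where m = "\<lambda>A B. B * A", OF _ _ _ \<Psi> _ P_def _ _ that])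
      show "\<Psi> (A * P) = \<Psi> P * \<Psi> A" if "A \<in> M" for A
        using r[OF that] by (simp add: 2 p mult.assoc add.commute)
      show "\<Psi> (P * A) = \<Psi> A * \<Psi> P" if "A \<in> M" for A
        using l[OF that] by (simp add: 2 p mult.assoc add.commute)
      show "\<Psi> (A * B + B * A) = \<Psi> B * \<Psi> A + \<Psi> A * \<Psi> B" if "A \<in> M" "B \<in> M" for A B
        using jordan[OF that] by (simp add: add.commute)
    qed (simp_all add: algebra_simps)
    then show ?thesis by blast
  qed
qed

theorem iso_coiso_preserver_structure:
  assumes \<Phi>: "clin_on M \<Phi>" and pres: "preserves_iso_coiso M \<Phi>"
  shows "\<exists>U\<in>M. \<exists>\<Psi>. unit U \<and> clin_on M \<Psi> \<and> \<Psi> 1 = 1 \<and> (\<forall>A\<in>M. \<Psi> A\<^sup>\<dagger> = (\<Psi> A)\<^sup>\<dagger>) \<and>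
    ((\<forall>A\<in>M. \<forall>B\<in>M. \<Psi> (A * B) = \<Psi> A * \<Psi> B) \<or> (\<forall>A\<in>M. \<forall>B\<in>M. \<Psi> (A * B) = \<Psi> B * \<Psi> A)) \<and>
    (\<forall>A. \<Phi> A = U * \<Psi> A)"
proof (intro bexI exI conjI)
  let ?W = "\<Phi> 1"
  define \<Psi> where "\<Psi> = (\<lambda>A. ?W\<^sup>\<dagger> * \<Phi> A)"
  have W: "?W \<in> M" "unit ?W" using \<Phi> one_mem image_one_unit[OF \<Phi> pres] by (auto simp: clin_on_def)
  have lin: "clin_on M \<Psi>" unfolding \<Psi>_def by (rule clin_on_left'[OF \<Phi>]) (simp add: W mem)
  have one: "\<Psi> 1 = 1" using W by (simp add: \<Psi>_def unit_def)
  have ic: "iso_coiso (\<Psi> A)" if "A \<in> M" "iso_coiso A" for A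
    unfolding \<Psi>_def by (rule unit_mult_iso_coiso)
      (use that pres W unit_star in \<open>auto simp: preserves_iso_coiso_def\<close>)
  have units: "iso_coiso (\<Psi> U)" if "U \<in> M" "unit U" for U
    using ic that iso_coiso_unit by blast
  show "clin_on M \<Psi>" "\<Psi> 1 = 1" by fact+
  show star: "\<forall>A\<in>M. \<Psi> A\<^sup>\<dagger> = (\<Psi> A)\<^sup>\<dagger>" using unital_star[OF lin units one] by blast
  show "(\<forall>A\<in>M. \<forall>B\<in>M. \<Psi> (A * B) = \<Psi> A * \<Psi> B) \<or> (\<forall>A\<in>M. \<forall>B\<in>M. \<Psi> (A * B) = \<Psi> B * \<Psi> A)"
    by (rule jordan_hom_or_antihom[OF lin one])
      (use star unital_jordan[OF lin units one] ic V1 in \<open>auto simp: iso_coiso_def\<close>)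
  show "\<forall>A. \<Phi> A = ?W * \<Psi> A"
    using W(2) by (simp add: \<Psi>_def unit_def flip: mult.assoc)
qed (fact | use \<Phi> one_mem image_one_unit[OF \<Phi> pres] in \<open>auto simp: clin_on_def\<close>)+

end

section \<open>Strong limits\<close>

lemma bounded_bilinear_cinner: "bounded_bilinear (cinner :: 'h::chilbert_space \<Rightarrow> 'h \<Rightarrow> complex)"
proof (rule bounded_bilinear.intro)
  show "\<exists>K. \<forall>x y :: 'h. norm (cinner x y) \<le> norm x * norm y * K"
  proof (intro exI allI)
    fix x y :: 'h
    have re: "\<bar>Re (cinner x y)\<bar> \<le> norm x * norm y" for x y :: 'h
      using Re_cinner_le[of x y] Re_cinner_le[of "- x" y] by (simp add: cinner_minus_left abs_le_iff)
    have "\<bar>Im (cinner x y)\<bar> = \<bar>Re (cinner (\<i> *\<^sub>C x) y)\<bar>" by (simp add: cinner_scaleC_left)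
    also have "\<dots> \<le> norm x * norm y" using re[of "\<i> *\<^sub>C x" y] by (simp add: norm_scaleC)
    finally show "norm (cinner x y) \<le> norm x * norm y * 2"
      using cmod_le[of "cinner x y"] re[of x y] by linarith
  qed
qed (simp_all add: cinner_add_left cinner_add_right cinner_scaleR_left cinner_scaleR_right scaleR_conv_of_real)

lemmas tendsto_cinner [tendsto_intros] = bounded_bilinear.tendsto[OF bounded_bilinear_cinner]

definition slim :: "('i \<Rightarrow> 'h::chilbert_space cop) \<Rightarrow> 'h cop \<Rightarrow> 'i filter \<Rightarrow> bool" where
  "slim A B F \<longleftrightarrow> (\<forall>x. ((\<lambda>i. A i \<rhd> x) \<longlongrightarrow> B \<rhd> x) F)"

lemma slim_unique: "F \<noteq> bot \<Longrightarrow> slim A B F \<Longrightarrow> slim A C F \<Longrightarrow> B = C"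
  by (rule cop_eqI) (auto simp: slim_def intro: tendsto_unique)

lemma slim_const [simp]: "slim (\<lambda>i. A) A F"
  by (simp add: slim_def)

lemma slim_cong:
  assumes "\<forall>\<^sub>F i in F. A i = B i" "slim A C F"
  shows "slim B C F"
  unfolding slim_def
proof
  fix x
  have "\<forall>\<^sub>F i in F. A i \<rhd> x = B i \<rhd> x" using assms(1) by eventually_elim simp
  moreover have "((\<lambda>i. A i \<rhd> x) \<longlongrightarrow> C \<rhd> x) F" using assms(2) by (simp add: slim_def)
  ultimately show "((\<lambda>i. B i \<rhd> x) \<longlongrightarrow> C \<rhd> x) F" by (rule tendsto_cong[THEN iffD1])
qed

text \<open>The eventual bound on the left factors controls \<open>A i\<close> on the vanishing
  difference \<open>B i \<rhd> x - B' \<rhd> x\<close>.\<close>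

lemma slim_mult:
  assumes A: "slim A A' F" and B: "slim B B' F" and bound: "\<forall>\<^sub>F i in F. norm (A i) \<le> 1"
  shows "slim (\<lambda>i. A i * B i) (A' * B') F"
  unfolding slim_def
proof
  fix x
  have "((\<lambda>i. A i \<rhd> (B i \<rhd> x - B' \<rhd> x)) \<longlongrightarrow> 0) F"
  proof (rule Lim_null_comparison)
    show "\<forall>\<^sub>F i in F. norm (A i \<rhd> (B i \<rhd> x - B' \<rhd> x)) \<le> norm (B i \<rhd> x - B' \<rhd> x)"
      using bound by eventually_elim (rule norm_app_le)
    have "((\<lambda>i. B i \<rhd> x) \<longlongrightarrow> B' \<rhd> x) F" using B by (simp add: slim_def)
    then show "((\<lambda>i. norm (B i \<rhd> x - B' \<rhd> x)) \<longlongrightarrow> 0) F"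
      by (simp add: LIM_zero_iff tendsto_norm_zero)
  qed
  moreover have "((\<lambda>i. A i \<rhd> B' \<rhd> x) \<longlongrightarrow> A' \<rhd> B' \<rhd> x) F" using A by (simp add: slim_def)
  ultimately have "((\<lambda>i. A i \<rhd> (B i \<rhd> x - B' \<rhd> x) + A i \<rhd> B' \<rhd> x) \<longlongrightarrow> 0 + A' \<rhd> B' \<rhd> x) F"
    by (rule tendsto_add)
  then show "((\<lambda>i. (A i * B i) \<rhd> x) \<longlongrightarrow> (A' * B') \<rhd> x) F" by (simp add: app_diff_right)
qed

lemma slim_mult_left: "slim A A' F \<Longrightarrow> slim (\<lambda>i. C * A i) (C * A') F"
  by (auto simp: slim_def intro!: tendsto_intros)

text \<open>Taking adjoints is not strongly continuous, so convergence of the adjoints is a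
  hypothesis; inner products then identify their limit.\<close>

lemma slim_star:
  assumes F: "F \<noteq> bot" and A: "slim A B F" and A': "slim (\<lambda>i. (A i)\<^sup>\<dagger>) C F"
  shows "C = B\<^sup>\<dagger>"
proof (rule sym, rule star_eqI)
  fix x y
  have "((\<lambda>i. cinner (A i \<rhd> x) y) \<longlongrightarrow> cinner (B \<rhd> x) y) F"
    "((\<lambda>i. cinner x ((A i)\<^sup>\<dagger> \<rhd> y)) \<longlongrightarrow> cinner x (C \<rhd> y)) F"
    using A A' by (auto simp: slim_def intro!: tendsto_intros)
  then show "cinner (B \<rhd> x) y = cinner x (C \<rhd> y)"
    using tendsto_unique[OF F] by (simp add: cinner_star)
qed

lemma slim_exists:
  assumes F: "F \<noteq> bot" and conv: "\<And>x. \<exists>y. ((\<lambda>i. A i \<rhd> x) \<longlongrightarrow> y) F"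
    and bound: "\<forall>\<^sub>F i in F. norm (A i) \<le> 1"
  shows "\<exists>B. slim A B F"
proof -
  obtain f where f: "\<And>x. ((\<lambda>i. A i \<rhd> x) \<longlongrightarrow> f x) F" using conv by metis
  have "\<exists>B. \<forall>x. B \<rhd> x = f x"
  proof (rule cop_of_bounded)
    show "f (x + y) = f x + f y" for x y
      using tendsto_unique[OF F f] tendsto_add[OF f f] by (simp add: app_add_right)
    show "f (c *\<^sub>C x) = c *\<^sub>C f x" for c x
    proof (rule tendsto_unique[OF F f])
      have "((\<lambda>i. (c \<odot> 1) \<rhd> A i \<rhd> x) \<longlongrightarrow> (c \<odot> 1) \<rhd> f x) F" by (intro tendsto_intros f)
      then show "((\<lambda>i. A i \<rhd> (c *\<^sub>C x)) \<longlongrightarrow> c *\<^sub>C f x) F" by (simp add: app_simps)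
    qed
    show "norm (f x) \<le> 1 * norm x" for x
    proof (rule tendsto_upperbound[OF tendsto_norm[OF f] _ F])
      show "\<forall>\<^sub>F i in F. norm (A i \<rhd> x) \<le> 1 * norm x"
        using bound by eventually_elim (simp add: norm_app_le)
    qed
  qed
  then obtain B where "\<And>x. B \<rhd> x = f x" by blast
  then have "slim A B F" using f by (simp add: slim_def)
  then show ?thesis by blast
qed

lemma (in vn_algebra) slim_mem:
  "F \<noteq> bot \<Longrightarrow> \<forall>\<^sub>F i in F. A i \<in> M \<Longrightarrow> slim A B F \<Longrightarrow> B \<in> M"
  unfolding slim_def by (rule strong_limit_mem) auto

text \<open>Common index sets for the two kinds of nets that occur: sequences, and the chains of
  Zorn's lemma.\<close>

locale directed =
  fixes C :: "'i set" and le :: "'i \<Rightarrow> 'i \<Rightarrow> bool"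
  assumes nonempty: "C \<noteq> {}" and refl: "i \<in> C \<Longrightarrow> le i i"
    and trans: "i \<in> C \<Longrightarrow> j \<in> C \<Longrightarrow> k \<in> C \<Longrightarrow> le i j \<Longrightarrow> le j k \<Longrightarrow> le i k"
    and upper: "i \<in> C \<Longrightarrow> j \<in> C \<Longrightarrow> \<exists>k\<in>C. le i k \<and> le j k"
begin

definition tail :: "'i filter" where
  "tail = (INF i\<in>C. principal {j \<in> C. le i j})"

lemma eventually_tail: "eventually P tail \<longleftrightarrow> (\<exists>i\<in>C. \<forall>j\<in>C. le i j \<longrightarrow> P j)"
proof -
  have "eventually P tail \<longleftrightarrow> (\<exists>i\<in>C. eventually P (principal {j \<in> C. le i j}))"
    unfolding tail_def
  proof (rule eventually_INF_base[OF nonempty])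
    fix i j assume ij: "i \<in> C" "j \<in> C"
    then obtain k where "k \<in> C" "le i k" "le j k" using upper by blast
    then show "\<exists>k\<in>C. principal {m \<in> C. le k m}
        \<le> inf (principal {m \<in> C. le i m}) (principal {m \<in> C. le j m})"
      using ij by (intro bexI[of _ k]) (auto intro: trans)
  qed
  then show ?thesis by (auto simp: eventually_principal)
qed

lemma tail_not_bot: "tail \<noteq> bot"
  using nonempty refl by (auto simp: trivial_limit_def eventually_tail)

lemma eventually_tail_in: "\<forall>\<^sub>F i in tail. i \<in> C"
  using nonempty by (auto simp: eventually_tail)

lemma eventually_tail_above: "i \<in> C \<Longrightarrow> \<forall>\<^sub>F j in tail. j \<in> C \<and> le i j"
  by (auto simp: eventually_tail)

text \<open>The squared norms are increasing and bounded, and their gaps dominate the squared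
  distances, so the net is Cauchy. Newton iterates and increasing partial isometries both have this
  form.\<close>

lemma increasing_net_converges:
  fixes X :: "'i \<Rightarrow> 'h::chilbert_space"
  assumes incr: "\<And>i j. i \<in> C \<Longrightarrow> j \<in> C \<Longrightarrow> le i j \<Longrightarrow>
      (norm (X j - X i))\<^sup>2 \<le> (norm (X j))\<^sup>2 - (norm (X i))\<^sup>2"
    and bound: "\<And>i. i \<in> C \<Longrightarrow> norm (X i) \<le> K"
  shows "\<exists>y. (X \<longlongrightarrow> y) tail"
proof -
  define s where "s = (SUP i\<in>C. (norm (X i))\<^sup>2)"
  have bdd: "bdd_above ((\<lambda>i. (norm (X i))\<^sup>2) ` C)"
    using bound by (intro bdd_aboveI2[of _ _ "K\<^sup>2"]) (simp add: power_mono)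
  have le_s: "(norm (X i))\<^sup>2 \<le> s" if "i \<in> C" for i
    unfolding s_def by (rule cSUP_upper[OF that bdd])
  have "cauchy_filter (filtermap X tail)"
    unfolding cauchy_filter_metric_filtermap
  proof (intro allI impI)
    fix e :: real assume e: "0 < e"
    then have "s - (e/2)\<^sup>2 < s" by simp
    then obtain i where i: "i \<in> C" "s - (e/2)\<^sup>2 < (norm (X i))\<^sup>2"
      unfolding s_def using less_cSUP_iff[OF nonempty bdd] by blast
    have near: "dist (X j) (X i) < e / 2" if "j \<in> C" "le i j" for j
    proof -
      have "(norm (X j - X i))\<^sup>2 < (e/2)\<^sup>2"
        using incr[OF i(1) that] le_s[OF that(1)] i(2) by linarith
      then have "norm (X j - X i) < e / 2" by (rule power2_less_imp_less) (use e in simp)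
      then show ?thesis by (simp add: dist_norm)
    qed
    have "dist (X j) (X k) < e" if "j \<in> C \<and> le i j" "k \<in> C \<and> le i k" for j k
      by (rule dist_triangle_half_l) (use near that in auto)
    then show "\<exists>P. eventually P tail \<and> (\<forall>x y. P x \<and> P y \<longrightarrow> dist (X x) (X y) < e)"
      using eventually_tail_above[OF i(1)] by blast
  qed
  then show ?thesis
    using cauchy_filter_complete_converges[of "filtermap X tail" UNIV] tail_not_bot
    by (auto simp: filterlim_def filtermap_bot_iff complete_UNIV)
qed

end

interpretation nat_directed: directed "UNIV :: nat set" "(\<le>)"
proof unfold_locales
  show "\<exists>k\<in>UNIV. i \<le> k \<and> j \<le> k" for i j :: nat by (rule bexI[of _ "max i j"]) auto
qed auto

lemma nat_tail: "nat_directed.tail = sequentially"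
  unfolding nat_directed.tail_def at_top_def by (simp add: atLeast_def)

section \<open>Polar decomposition by Newton's iteration\<close>

definition ev :: "'h::chilbert_space cop \<Rightarrow> real poly \<Rightarrow> 'h cop" where
  "ev a p = fold_coeffs (\<lambda>c R. c *\<^sub>R 1 + a * R) p 0"

lemma ev_zero [simp]: "ev a 0 = 0"
  by (simp add: ev_def)

lemma ev_pCons [simp]: "ev a (pCons c p) = c *\<^sub>R 1 + a * ev a p"
  by (cases "p = 0 \<and> c = 0") (auto simp: ev_def)

lemma ev_one [simp]: "ev a 1 = 1"
  by (simp add: one_pCons)

lemma ev_add: "ev a (p + q) = ev a p + ev a q"
  by (induction p q rule: poly_induct2) (simp_all add: scaleR_add_left distrib_left)

lemma ev_diff: "ev a (p - q) = ev a p - ev a q"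
  using ev_add[of a "p - q" q] by simp

lemma ev_smult: "ev a (smult c p) = c *\<^sub>R ev a p"
  by (induction p) (simp_all add: scaleR_add_right)

lemma ev_mult: "ev a (p * q) = ev a p * ev a q"
  by (induction p) (simp_all add: ev_add ev_smult distrib_right mult.assoc)

lemma ev_intertwine: "Y * a = b * Y \<Longrightarrow> Y * ev a p = ev b p * Y"
  by (induction p) (simp_all add: distrib_left distrib_right mult.assoc[symmetric], simp add: mult.assoc)

lemma star_ev: "a\<^sup>\<dagger> = a \<Longrightarrow> (ev a p)\<^sup>\<dagger> = ev a p"
  by (induction p) (simp_all add: ev_intertwine)

lemma (in star_algebra) ev_mem: "a \<in> M \<Longrightarrow> ev a p \<in> M"
  by (induction p) (simp_all add: mem)

text \<open>If all powers of \<open>a\<close> are positive operators, such a polynomial has a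
  positive value at \<open>a\<close>. Operator inequalities thus become statements about signs of
  coefficients.\<close>

definition nonneg_poly :: "real poly \<Rightarrow> bool" where
  "nonneg_poly p \<longleftrightarrow> (\<forall>n. 0 \<le> coeff p n)"

lemma nonneg_poly_add: "nonneg_poly p \<Longrightarrow> nonneg_poly q \<Longrightarrow> nonneg_poly (p + q)"
  and nonneg_poly_mult: "nonneg_poly p \<Longrightarrow> nonneg_poly q \<Longrightarrow> nonneg_poly (p * q)"
  and nonneg_poly_one: "nonneg_poly 1"
  by (auto simp: nonneg_poly_def coeff_mult intro!: sum_nonneg)

lemma nonneg_poly_const: "0 \<le> c \<Longrightarrow> nonneg_poly [:c:]"
  by (simp add: nonneg_poly_def coeff_pCons split: nat.split)

lemma nonneg_poly_smult: "0 \<le> c \<Longrightarrow> nonneg_poly p \<Longrightarrow> nonneg_poly (smult c p)"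
  by (simp add: nonneg_poly_def)

lemma nonneg_poly_numeral: "nonneg_poly (numeral n)"
  unfolding numeral_poly by (rule nonneg_poly_const) simp

lemma nonneg_poly_power: "nonneg_poly p \<Longrightarrow> nonneg_poly (p ^ n)"
  by (induction n) (simp_all add: nonneg_poly_one nonneg_poly_mult)

lemma nonneg_poly_pCons: "nonneg_poly (pCons c p) \<longleftrightarrow> 0 \<le> c \<and> nonneg_poly p"
  by (force simp: nonneg_poly_def coeff_pCons split: nat.split)

lemmas nonneg_poly = nonneg_poly_add nonneg_poly_mult nonneg_poly_one nonneg_poly_const nonneg_poly_smult
  nonneg_poly_numeral nonneg_poly_power

text \<open>Newton's iteration \<open>Y \<mapsto> Y (3 - Y\<^sup>\<dagger> Y) / 2\<close> for the polar part of \<open>Y\<close>: its \<open>k\<close>-th iterate is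
  \<open>Y g\<^sub>k(a)\<close> and the defect \<open>1 - Y\<^sub>k\<^sup>\<dagger> Y\<^sub>k\<close> is \<open>d\<^sub>k(a)\<close>, where \<open>a = 1 - Y\<^sup>\<dagger> Y\<close>. In the variable
  \<open>a\<close> all coefficients are nonnegative, which makes the iterates increase.\<close>

primrec newton_defect :: "nat \<Rightarrow> real poly" where
  "newton_defect 0 = [:0, 1:]"
| "newton_defect (Suc k) = [:1/2:]^2 * (3 * newton_defect k ^ 2 + newton_defect k ^ 3)"

primrec newton_factor :: "nat \<Rightarrow> real poly" where
  "newton_factor 0 = 1"
| "newton_factor (Suc k) = newton_factor k * (1 + [:1/2:] * newton_defect k)"

lemma nonneg_newton_defect: "nonneg_poly (newton_defect k)"
  by (induction k) (auto intro!: nonneg_poly simp: nonneg_poly_pCons nonneg_poly_def[of 0])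

lemma nonneg_newton_factor: "nonneg_poly (newton_factor k)"
  by (induction k) (auto intro!: nonneg_poly nonneg_newton_defect)

lemma newton_factor_mono: "k \<le> m \<Longrightarrow> nonneg_poly (newton_factor m - newton_factor k)"
proof (induction m rule: dec_induct)
  case base
  show ?case by (simp add: nonneg_poly_def)
next
  case (step m)
  have "newton_factor (Suc m) - newton_factor k
      = (newton_factor m - newton_factor k) + newton_factor m * ([:1/2:] * newton_defect m)"
    by (simp add: algebra_simps)
  also have "nonneg_poly \<dots>"
    using step.IH by (intro nonneg_poly nonneg_newton_defect nonneg_newton_factor) simp_all
  finally show ?case .
qed

text \<open>One step multiplies the factor by 1 + d/2, and (1 - d)(1 + d/2)^2 = 1 - (3d^2 + d^3)/4,
  which is where the recursion for the defect comes from.\<close>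

lemma newton_identity: "1 - newton_defect k = (1 - [:0, 1:]) * newton_factor k ^ 2"
proof (induction k)
  case (Suc k)
  \<comment> \<open>The constant polynomial 1/2 is treated as an unknown \<open>h\<close> with these
    two relations, which makes the identity a matter of polynomial algebra.\<close>
  have h: "4 * [:1/2::real:]^2 = 1" "2 * [:1/2::real:] = 1"
    by (simp_all add: numeral_poly one_pCons power2_eq_square)
  have step: "(1 - d) * (1 + h * d)^2 = 1 - h^2 * (3 * d^2 + d^3)"
    if "4 * h^2 = 1" "2 * h = 1" for d h :: "real poly"
    using that by algebra
  show ?case
    using step[OF h, of "newton_defect k"] Suc.IH by (simp add: power_mult_distrib mult.assoc[symmetric])
qed simp

definition newton :: "'h::chilbert_space cop \<Rightarrow> nat \<Rightarrow> 'h cop" where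
  "newton Y k = Y * ev (1 - Y\<^sup>\<dagger> * Y) (newton_factor k)"

lemma newton_zero [simp]: "newton Y 0 = Y"
  by (simp add: newton_def)

lemma star_newton: "(newton Y k)\<^sup>\<dagger> = newton Y\<^sup>\<dagger> k"
proof -
  have "Y\<^sup>\<dagger> * ev (1 - Y * Y\<^sup>\<dagger>) p = ev (1 - Y\<^sup>\<dagger> * Y) p * Y\<^sup>\<dagger>" for p
    by (rule ev_intertwine) (simp add: algebra_simps)
  then show ?thesis by (simp add: newton_def star_ev)
qed

lemma newton_square: "(newton Y k)\<^sup>\<dagger> * newton Y k = 1 - ev (1 - Y\<^sup>\<dagger> * Y) (newton_defect k)"
proof -
  define a where "a = 1 - Y\<^sup>\<dagger> * Y"
  have a: "a\<^sup>\<dagger> = a" "Y\<^sup>\<dagger> * Y = ev a (1 - [:0, 1:])" by (simp_all add: a_def ev_diff)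
  have "(newton Y k)\<^sup>\<dagger> * newton Y k = ev a (newton_factor k) * (Y\<^sup>\<dagger> * Y) * ev a (newton_factor k)"
    unfolding newton_def a_def[symmetric] by (simp add: star_ev a(1) mult.assoc)
  also have "\<dots> = ev a ((1 - [:0, 1:]) * newton_factor k ^ 2)"
    unfolding a(2) by (simp only: power2_eq_square mult_ac flip: ev_mult)
  also have "\<dots> = 1 - ev a (newton_defect k)" by (simp only: ev_diff ev_one flip: newton_identity)
  finally show ?thesis by (simp only: a_def)
qed

lemma newton_Suc: "newton Y (Suc k) = newton Y k + (1/2) *\<^sub>R (newton Y k * ev (1 - Y\<^sup>\<dagger> * Y) (newton_defect k))"
  by (simp add: newton_def ev_add ev_mult ev_smult distrib_left mult.assoc)

text \<open>An even power is split evenly: C a^(2k) = a^k C a^k is positive with C. For an odd power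
  the same is done with C a in place of C.\<close>

lemma power_positive:
  assumes a: "a\<^sup>\<dagger> = a" and comm: "C * a = a * C"
    and pos: "\<And>x. 0 \<le> Re (cinner (C \<rhd> x) x)" "\<And>x. 0 \<le> Re (cinner ((C * a) \<rhd> x) x)"
  shows "0 \<le> Re (cinner ((C * a ^ n) \<rhd> x) x)"
proof -
  have comm': "B * a ^ k = a ^ k * B" if "B * a = a * B" for B k
    by (induction k) (simp_all add: that mult.assoc, metis that mult.assoc)
  have sq: "Re (cinner ((B * a ^ (k + k)) \<rhd> x) x) = Re (cinner (B \<rhd> (a ^ k) \<rhd> x) ((a ^ k) \<rhd> x))"
    if "B * a = a * B" for B k
  proof -
    have "B * a ^ (k + k) = (B * a ^ k) * a ^ k" by (simp only: power_add mult.assoc)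
    also have "\<dots> = a ^ k * B * a ^ k" by (simp only: comm'[OF that])
    also have "\<dots> = a ^ k * (B * a ^ k)" by (simp only: mult.assoc)
    finally have "B * a ^ (k + k) = a ^ k * (B * a ^ k)" .
    then show ?thesis by (simp add: cinner_star a)
  qed
  show ?thesis
  proof (cases "even n")
    case True
    then obtain k where "n = k + k" by (metis evenE mult_2)
    then show ?thesis using sq[OF comm, of k] pos(1) by simp
  next
    case False
    then obtain k where "n = Suc (k + k)" by (metis oddE mult_2 Suc_eq_plus1)
    moreover have "C * a * a = a * C * a" by (simp only: comm)
    then have "C * a * a = a * (C * a)" by (simp only: mult.assoc)
    then have "Re (cinner ((C * a * a ^ (k + k)) \<rhd> x) x) = Re (cinner ((C * a) \<rhd> (a ^ k) \<rhd> x) ((a ^ k) \<rhd> x))"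
      by (rule sq)
    ultimately show ?thesis using pos(2)[of "(a ^ k) \<rhd> x"] by (simp add: mult.assoc)
  qed
qed

lemma ev_positive:
  assumes pos: "\<And>n x. 0 \<le> Re (cinner ((C * a ^ n) \<rhd> x) x)" and p: "nonneg_poly p"
  shows "0 \<le> Re (cinner ((C * ev a p) \<rhd> x) x)"
proof -
  \<comment> \<open>Stated for every power \<open>n\<close>, so that each coefficient of
    \<open>p\<close> moves one factor \<open>a\<close> into the power.\<close>
  have "0 \<le> Re (cinner ((C * a ^ n * ev a p) \<rhd> x) x)" for n
    using p
  proof (induction p arbitrary: n)
    case (pCons c p)
    then have c: "0 \<le> c" and "nonneg_poly p" by (simp_all add: nonneg_poly_pCons)
    then have "0 \<le> Re (cinner ((C * a ^ Suc n * ev a p) \<rhd> x) x)" using pCons.IH by blast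
    moreover have "0 \<le> c * Re (cinner ((C * a ^ n) \<rhd> x) x)" using c pos by simp
    moreover have "C * a ^ n * ev a (pCons c p) = c *\<^sub>R (C * a ^ n) + C * a ^ Suc n * ev a p"
      by (simp add: distrib_left mult.assoc power_commutes)
        (simp add: mult.assoc[symmetric] power_commutes)
    ultimately show ?case
      by (simp only: app_add app_scaleR cinner_add_left cinner_scaleR_left) simp
  qed simp
  from this[of 0] show ?thesis by simp
qed

context
  fixes Y :: "'h::chilbert_space cop" assumes Y: "norm Y \<le> 1"
begin

lemma newton_ev_positive:
  assumes "nonneg_poly p"
  shows "0 \<le> Re (cinner (ev (1 - Y\<^sup>\<dagger> * Y) p \<rhd> x) x)"
    and "0 \<le> Re (cinner ((Y\<^sup>\<dagger> * Y * ev (1 - Y\<^sup>\<dagger> * Y) p) \<rhd> x) x)"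
proof -
  let ?a = "1 - Y\<^sup>\<dagger> * Y"
  have Y2: "(norm (Y \<rhd> x))\<^sup>2 \<le> (norm x)\<^sup>2" "(norm (Y\<^sup>\<dagger> \<rhd> x))\<^sup>2 \<le> (norm x)\<^sup>2" for x
    using norm_app_le[OF Y, of x] norm_app_le[of "Y\<^sup>\<dagger>" x] Y by (simp_all add: power_mono)
  have "0 \<le> Re (cinner ((1 * ?a ^ n) \<rhd> x) x)" for n x
    by (rule power_positive) (use Y2 in \<open>simp_all add: app_diff cinner_diff_left cinner_eq_norm cinner_self\<close>)
  from ev_positive[OF this assms] show "0 \<le> Re (cinner (ev ?a p \<rhd> x) x)" by simp
  have "0 \<le> Re (cinner ((Y\<^sup>\<dagger> * Y * ?a ^ n) \<rhd> x) x)" for n x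
  proof (rule power_positive)
    show "0 \<le> Re (cinner ((Y\<^sup>\<dagger> * Y * ?a) \<rhd> x) x)" for x
    proof -
      have "cinner (Y\<^sup>\<dagger> \<rhd> Y \<rhd> Y\<^sup>\<dagger> \<rhd> Y \<rhd> x) x = cinner (Y\<^sup>\<dagger> \<rhd> Y \<rhd> x) (Y\<^sup>\<dagger> \<rhd> Y \<rhd> x)"
        by (simp only: cinner_star'[of Y _ x] cinner_star[of Y "Y\<^sup>\<dagger> \<rhd> Y \<rhd> x"])
      then show ?thesis
        using Y2(2)[of "Y \<rhd> x"]
        by (simp only: app_mult app_diff app_one app_diff_right cinner_diff_left minus_complex.sel
            cinner_eq_norm) (simp add: cinner_self)
    qed
  qed (simp_all add: cinner_eq_norm algebra_simps)
  from ev_positive[OF this assms] show "0 \<le> Re (cinner ((Y\<^sup>\<dagger> * Y * ev ?a p) \<rhd> x) x)" by simp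
qed

lemma norm_newton: "norm (newton Y k) \<le> 1"
proof (rule norm_cop_bound)
  fix x
  have "(norm (newton Y k \<rhd> x))\<^sup>2 = Re (cinner (((newton Y k)\<^sup>\<dagger> * newton Y k) \<rhd> x) x)"
    by (simp add: cinner_eq_norm)
  also have "\<dots> \<le> (norm x)\<^sup>2"
    unfolding newton_square using newton_ev_positive(1)[OF nonneg_newton_defect, of k x]
    by (simp add: app_diff cinner_diff_left cinner_self)
  finally have "norm (newton Y k \<rhd> x) \<le> norm x" by (rule power2_le_imp_le) simp
  then show "norm (newton Y k \<rhd> x) \<le> 1 * norm x" by simp
qed simp

text \<open>The inner product of the earlier iterate with the increment is the form of Y^* Y times a
  polynomial with nonnegative coefficients, hence nonnegative; expanding the square of the sum gives
  the estimate.\<close>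

lemma newton_increasing:
  assumes "k \<le> m"
  shows "(norm (newton Y m \<rhd> x - newton Y k \<rhd> x))\<^sup>2 \<le> (norm (newton Y m \<rhd> x))\<^sup>2 - (norm (newton Y k \<rhd> x))\<^sup>2"
proof -
  let ?a = "1 - Y\<^sup>\<dagger> * Y" and ?g = "newton_factor k" and ?r = "newton_factor m - newton_factor k"
  let ?d = "newton Y m \<rhd> x - newton Y k \<rhd> x"
  have d: "?d = Y \<rhd> ev ?a ?r \<rhd> x"
    by (simp add: newton_def ev_diff app_diff app_diff_right)
  have "ev ?a ?r * (Y\<^sup>\<dagger> * Y) = Y\<^sup>\<dagger> * Y * ev ?a ?r"
    by (rule ev_intertwine[symmetric]) (simp add: algebra_simps)
  then have eq: "ev ?a ?r * (Y\<^sup>\<dagger> * Y) * ev ?a ?g = Y\<^sup>\<dagger> * Y * ev ?a (?r * ?g)"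
    by (simp add: ev_mult mult.assoc)
  have "cinner (newton Y k \<rhd> x) ?d = cinner ((ev ?a ?r * (Y\<^sup>\<dagger> * Y) * ev ?a ?g) \<rhd> x) x"
    unfolding d by (simp add: newton_def cinner_star star_ev)
  then have "0 \<le> Re (cinner (newton Y k \<rhd> x) ?d)"
    unfolding eq using newton_ev_positive(2) newton_factor_mono[OF assms] nonneg_newton_factor
    by (simp add: nonneg_poly_mult)
  then show ?thesis using norm_add_sq[of "newton Y k \<rhd> x" ?d] by simp
qed

lemma newton_slim: "\<exists>u. slim (newton Y) u sequentially"
proof (rule slim_exists)
  show "\<exists>y. (\<lambda>k. newton Y k \<rhd> x) \<longlonglongrightarrow> y" for x
    unfolding nat_tail[symmetric]
    by (rule nat_directed.increasing_net_converges[where K = "norm x"])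
      (auto intro: newton_increasing norm_app_le norm_newton)
qed (simp_all add: norm_newton)

end

definition pisom :: "'h::chilbert_space cop \<Rightarrow> bool" where
  "pisom v \<longleftrightarrow> v * v\<^sup>\<dagger> * v = v"

text \<open>\<open>u\<close> is the strong limit of Newton's iteration for \<open>Y\<close> scaled
  to norm 1. It is nonzero because the norms at a vector increase from that of the start, and the
  operators \<open>E\<close> that fix \<open>Y\<close> on one side fix every iterate. The iteration
  for the adjoint converges too, which gives the strong limit of the adjoints.\<close>

lemma (in vn_algebra) polar_partial_isometry:
  assumes Y: "Y \<in> M" "Y \<noteq> 0"
  shows "\<exists>u\<in>M. pisom u \<and> u \<noteq> 0 \<and> (\<forall>E. E * Y = Y \<longrightarrow> E * u = u) \<and> (\<forall>E. Y * E = Y \<longrightarrow> u * E = u)"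
proof -
  define Z where "Z = (1 / norm Y) *\<^sub>R Y"
  have Z: "Z \<in> M" "norm Z \<le> 1" "norm Z\<^sup>\<dagger> \<le> 1" "Z \<noteq> 0" using Y by (simp_all add: Z_def mem)
  obtain u where u: "slim (newton Z) u sequentially" using newton_slim[OF Z(2)] by blast
  obtain z where z: "slim (newton Z\<^sup>\<dagger>) z sequentially" using newton_slim[OF Z(3)] by blast
  have zu: "z = u\<^sup>\<dagger>" by (rule slim_star[OF _ u]) (use z in \<open>simp_all add: star_newton\<close>)
  have "slim (\<lambda>k. newton Z k * (newton Z\<^sup>\<dagger> k * newton Z k)) (u * (z * u)) sequentially"
    by (intro slim_mult u z) (simp_all add: norm_newton Z)
  \<comment> \<open>This is the Newton recursion solved for the triple product; its limit reads
    \<open>u * u\<^sup>\<dagger> * u = 3 *\<^sub>R u - 2 *\<^sub>R u\<close>.\<close>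
  moreover have step: "newton Z k * (newton Z\<^sup>\<dagger> k * newton Z k) = 3 *\<^sub>R newton Z k - 2 *\<^sub>R newton Z (Suc k)" for k
  proof -
    have "newton Z\<^sup>\<dagger> k * newton Z k = 1 - ev (1 - Z\<^sup>\<dagger> * Z) (newton_defect k)"
      using newton_square[of Z k] by (simp add: star_newton)
    then show ?thesis
      by (simp add: newton_Suc right_diff_distrib scaleR_add_right) (simp flip: scaleR_left_diff_distrib add: algebra_simps)
  qed
  ultimately have "slim (\<lambda>k. 3 *\<^sub>R newton Z k - 2 *\<^sub>R newton Z (Suc k)) (u * (z * u)) sequentially"
    by (simp only:)
  moreover have "slim (\<lambda>k. 3 *\<^sub>R newton Z k - 2 *\<^sub>R newton Z (Suc k)) (3 *\<^sub>R u - 2 *\<^sub>R u) sequentially"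
    unfolding slim_def app_diff app_scaleR
    using u by (auto simp: slim_def intro!: tendsto_intros LIMSEQ_Suc)
  ultimately have "u * (z * u) = 3 *\<^sub>R u - 2 *\<^sub>R u" by (rule slim_unique[OF trivial_limit_sequentially])
  then have p: "pisom u" by (simp add: zu pisom_def mult.assoc flip: scaleR_left_diff_distrib)
  obtain x where x: "Z \<rhd> x \<noteq> 0" using Z(4) by (metis app_zero cop_eqI)
  have "norm (Z \<rhd> x) \<le> norm (u \<rhd> x)"
  proof (rule LIMSEQ_le_const)
    show "(\<lambda>k. norm (newton Z k \<rhd> x)) \<longlonglongrightarrow> norm (u \<rhd> x)"
      using u by (auto simp: slim_def intro!: tendsto_intros)
    have "(norm (Z \<rhd> x))\<^sup>2 \<le> (norm (newton Z k \<rhd> x))\<^sup>2" for k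
      using order_trans[OF zero_le_power2 newton_increasing[OF Z(2), of 0 k x]] by simp
    then show "\<exists>N. \<forall>k\<ge>N. norm (Z \<rhd> x) \<le> norm (newton Z k \<rhd> x)"
      using power2_le_imp_le[OF _ norm_ge_zero] by blast
  qed
  then have "u \<noteq> 0" using x by auto
  moreover have absorb: "E * w = w" if "slim (newton W) w sequentially" "E * W = W" for E W w
  proof (rule slim_unique[OF _ slim_mult_left[OF that(1)] slim_cong[OF _ that(1)]])
    show "\<forall>\<^sub>F k in sequentially. newton W k = E * newton W k"
      using that(2) by (simp add: newton_def flip: mult.assoc)
  qed simp
  moreover have "E * u = u" if "E * Y = Y" for E
    by (rule absorb[OF u]) (simp add: Z_def that)
  moreover have "u * E = u" if "Y * E = Y" for E
  proof -
    have "E\<^sup>\<dagger> * Z\<^sup>\<dagger> = Z\<^sup>\<dagger>" using arg_cong[OF that, of star] by (simp add: Z_def)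
    then have "E\<^sup>\<dagger> * u\<^sup>\<dagger> = u\<^sup>\<dagger>" using absorb[OF z] zu by simp
    then show ?thesis by (metis star_mult star_star)
  qed
  moreover have "u \<in> M"
    by (rule slim_mem[OF _ _ u]) (use Z in \<open>simp_all add: newton_def ev_mem mem\<close>)
  ultimately show ?thesis using p by blast
qed

section \<open>Partial isometries ordered by extension\<close>

lemma pisom_star: "pisom v \<Longrightarrow> pisom v\<^sup>\<dagger>"
  unfolding pisom_def by (metis mult.assoc star_mult star_star)

lemma pisom_zero [simp]: "pisom 0"
  by (simp add: pisom_def)

lemma pisom_proj: "pisom v \<Longrightarrow> proj (v\<^sup>\<dagger> * v)"
  unfolding pisom_def proj_def by (metis mult.assoc star_mult star_star)

lemma norm_pisom:
  assumes "pisom v"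
  shows "norm v \<le> 1"
proof (rule norm_cop_bound)
  fix x
  have "(norm (v \<rhd> x))\<^sup>2 = (norm ((v\<^sup>\<dagger> * v) \<rhd> x))\<^sup>2"
    using norm_proj_sq[OF pisom_proj[OF assms], of x] by (simp add: cinner_eq_norm)
  then have "norm (v \<rhd> x) = norm ((v\<^sup>\<dagger> * v) \<rhd> x)" by (simp del: app_mult)
  then show "norm (v \<rhd> x) \<le> 1 * norm x"
    using norm_proj_le[OF pisom_proj[OF assms], of x] by simp
qed simp

text \<open>For partial isometries: \<open>w\<close> agrees with \<open>v\<close> on the initial
  space of \<open>v\<close>.\<close>

definition extends :: "'h::chilbert_space cop \<Rightarrow> 'h cop \<Rightarrow> bool" where
  "extends v w \<longleftrightarrow> w * (v\<^sup>\<dagger> * v) = v"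

lemma extends_refl: "pisom v \<Longrightarrow> extends v v"
  by (simp add: extends_def pisom_def mult.assoc)

text \<open>With the initial projections p of \<open>v\<close> and q of \<open>w\<close>, comparing
  \<open>v = w * p\<close> with its adjoint gives pqp = p, and then (p - qp)^* (p - qp) = p - pqp =
  0.\<close>

lemma extends_initial:
  assumes v: "pisom v" and w: "pisom w" and ext: "extends v w"
  shows "w\<^sup>\<dagger> * w * (v\<^sup>\<dagger> * v) = v\<^sup>\<dagger> * v"
proof -
  define p q where "p = v\<^sup>\<dagger> * v" and "q = w\<^sup>\<dagger> * w"
  have p: "p\<^sup>\<dagger> = p" "p * p = p" using pisom_proj[OF v] by (auto simp: p_def proj_def)
  have q: "q\<^sup>\<dagger> = q" "q * q = q" using pisom_proj[OF w] by (auto simp: q_def proj_def)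
  have "w * p = v" using ext by (simp add: extends_def p_def)
  then have "p = (w * p)\<^sup>\<dagger> * (w * p)" by (simp add: p_def)
  then have pqp: "p * (q * p) = p" by (simp add: q_def p mult.assoc)
  have "(p - q * p)\<^sup>\<dagger> * (p - q * p) = p * p - p * (q * p) - p * (q * p) + p * (q * q * p)"
    by (simp add: p(1) q(1) algebra_simps)
  then have "(p - q * p)\<^sup>\<dagger> * (p - q * p) = 0" by (simp only: p q pqp) simp
  then have "q * p = p" by (simp only: star_mult_self_zero) simp
  then show ?thesis by (simp only: p_def q_def)
qed

text \<open>Through this the adjoints of an increasing net increase as well, and so converge
  strongly.\<close>

lemma extends_star:
  assumes "pisom v" "pisom w" "extends v w"
  shows "extends v\<^sup>\<dagger> w\<^sup>\<dagger>"
proof -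
  have "w\<^sup>\<dagger> * (v * v\<^sup>\<dagger>) = w\<^sup>\<dagger> * (w * (v\<^sup>\<dagger> * v)) * v\<^sup>\<dagger>"
    using assms(3) by (simp add: extends_def mult.assoc)
  also have "\<dots> = (w\<^sup>\<dagger> * w * (v\<^sup>\<dagger> * v)) * v\<^sup>\<dagger>" by (simp add: mult.assoc)
  also have "\<dots> = v\<^sup>\<dagger>"
    unfolding extends_initial[OF assms] using pisom_star[OF assms(1)] by (simp add: pisom_def mult.assoc)
  finally show ?thesis by (simp add: extends_def)
qed

lemma extends_trans:
  assumes "pisom u" "pisom v" "extends u v" "extends v w"
  shows "extends u w"
proof -
  have "w * (u\<^sup>\<dagger> * u) = w * (v\<^sup>\<dagger> * v) * (u\<^sup>\<dagger> * u)"
    using extends_initial[OF assms(1-3)] by (simp add: mult.assoc)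
  then show ?thesis using assms(3,4) by (simp add: extends_def)
qed

lemma extends_antisym:
  assumes "pisom v" "pisom w" "extends v w" "extends w v"
  shows "v = w"
proof -
  define p q where "p = v\<^sup>\<dagger> * v" and "q = w\<^sup>\<dagger> * w"
  have "p\<^sup>\<dagger> = p" "q\<^sup>\<dagger> = q" by (simp_all add: p_def q_def)
  moreover have "q * p = p" "p * q = q"
    using extends_initial[OF assms(1-3)] extends_initial[OF assms(2,1,4)] by (simp_all add: p_def q_def)
  ultimately have "p = q" by (metis star_mult)
  moreover have "w * p = v" using assms(3) by (simp only: extends_def p_def)
  moreover have "w * q = w" using assms(2) by (simp only: pisom_def q_def mult.assoc)
  ultimately show ?thesis by simp
qed

lemma extends_norm_increasing:
  assumes "pisom v" "pisom w" "extends v w"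
  shows "(norm (w \<rhd> x - v \<rhd> x))\<^sup>2 = (norm (w \<rhd> x))\<^sup>2 - (norm (v \<rhd> x))\<^sup>2"
proof -
  have "w\<^sup>\<dagger> * v = w\<^sup>\<dagger> * w * (v\<^sup>\<dagger> * v)" using assms(3) by (simp add: extends_def mult.assoc)
  then have "w\<^sup>\<dagger> * v = v\<^sup>\<dagger> * v" using extends_initial[OF assms] by simp
  then have "cinner (v \<rhd> x) (w \<rhd> x) = cinner (v\<^sup>\<dagger> \<rhd> v \<rhd> x) x"
    by (metis app_mult cinner_star')
  then have "Re (cinner (w \<rhd> x) (v \<rhd> x)) = (norm (v \<rhd> x))\<^sup>2"
    by (metis Re_cinner_commute cinner_eq_norm)
  then show ?thesis using norm_diff_sq[of "w \<rhd> x" "v \<rhd> x"] by simp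
qed

locale increasing_pisoms = vn_algebra M + directed C le
  for M :: "'h::chilbert_space cop set" and C :: "'i set" and le +
  fixes v :: "'i \<Rightarrow> 'h cop"
  assumes v_mem: "i \<in> C \<Longrightarrow> v i \<in> M" and v_pisom: "i \<in> C \<Longrightarrow> pisom (v i)"
    and v_extends: "i \<in> C \<Longrightarrow> j \<in> C \<Longrightarrow> le i j \<Longrightarrow> extends (v i) (v j)"
begin

lemma ev_norm: "\<forall>\<^sub>F i in tail. norm (v i) \<le> 1" "\<forall>\<^sub>F i in tail. norm (v i)\<^sup>\<dagger> \<le> 1"
  using eventually_tail_in by (eventually_elim, simp add: norm_pisom v_pisom)+

text \<open>Provides the upper bounds for Zorn's lemma. Since \<open>v i\<close> and their adjoints
  converge strongly with norms at most 1, algebraic relations such as that of a partial isometry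
  pass to the limit.\<close>

lemma limit_exists: "\<exists>w\<in>M. pisom w \<and> (\<forall>i\<in>C. extends (v i) w) \<and> slim v w tail \<and> slim (\<lambda>i. (v i)\<^sup>\<dagger>) w\<^sup>\<dagger> tail"
proof -
  have "\<exists>w. slim v w tail"
  proof (rule slim_exists[OF tail_not_bot _ ev_norm(1)])
    show "\<exists>y. ((\<lambda>i. v i \<rhd> x) \<longlongrightarrow> y) tail" for x
      by (rule increasing_net_converges[where K = "norm x"])
        (simp_all add: extends_norm_increasing v_pisom v_extends norm_app_le norm_pisom)
  qed
  then obtain w where w: "slim v w tail" by blast
  have "\<exists>z. slim (\<lambda>i. (v i)\<^sup>\<dagger>) z tail"
  proof (rule slim_exists[OF tail_not_bot _ ev_norm(2)])
    show "\<exists>y. ((\<lambda>i. (v i)\<^sup>\<dagger> \<rhd> x) \<longlongrightarrow> y) tail" for x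
      by (rule increasing_net_converges[where K = "norm x"])
        (simp_all add: extends_norm_increasing extends_star pisom_star v_pisom v_extends norm_app_le norm_pisom)
  qed
  then have w': "slim (\<lambda>i. (v i)\<^sup>\<dagger>) w\<^sup>\<dagger> tail" using slim_star[OF tail_not_bot w] by blast
  have "slim (\<lambda>i. v i * ((v i)\<^sup>\<dagger> * v i)) (w * (w\<^sup>\<dagger> * w)) tail"
    by (intro slim_mult w w' ev_norm)
  moreover have "\<forall>\<^sub>F i in tail. v i = v i * ((v i)\<^sup>\<dagger> * v i)"
    using eventually_tail_in by eventually_elim (use v_pisom in \<open>simp add: pisom_def mult.assoc\<close>)
  ultimately have "w * (w\<^sup>\<dagger> * w) = w"
    using slim_unique[OF tail_not_bot] slim_cong[OF _ w] by metis
  then have "pisom w" by (simp add: pisom_def mult.assoc)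
  moreover have "extends (v i) w" if i: "i \<in> C" for i
  proof -
    let ?p = "(v i)\<^sup>\<dagger> * v i"
    have "slim (\<lambda>j. v j * ?p) (w * ?p) tail" by (intro slim_mult w slim_const ev_norm)
    moreover have "\<forall>\<^sub>F j in tail. v i = v j * ?p"
      using eventually_tail_above[OF i]
      by eventually_elim (use v_extends[OF i] in \<open>simp add: extends_def\<close>)
    then have "slim (\<lambda>j. v j * ?p) (v i) tail" by (rule slim_cong) simp
    ultimately show ?thesis using slim_unique[OF tail_not_bot] unfolding extends_def by blast
  qed
  moreover have "w \<in> M"
    by (rule slim_mem[OF tail_not_bot _ w]) (use eventually_tail_in v_mem in \<open>auto elim: eventually_mono\<close>)
  ultimately show ?thesis using w w' by blast
qed

end

section \<open>Comparison of projections in a factor\<close>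

locale vn_factor = vn_algebra M for M :: "'h::chilbert_space cop set" +
  assumes central_scalar: "A \<in> M \<Longrightarrow> (\<And>B. B \<in> M \<Longrightarrow> A * B = B * A) \<Longrightarrow> \<exists>c. A = c \<odot> 1"

text \<open>Invariance of the range under \<open>T\<close> gives PTP = TP; invariance under the
  adjoint gives PTP = PT.\<close>

lemma proj_commute:
  assumes P: "proj P" and T: "\<And>x. P \<rhd> x = x \<Longrightarrow> P \<rhd> T \<rhd> x = T \<rhd> x"
    and T': "\<And>x. P \<rhd> x = x \<Longrightarrow> P \<rhd> T\<^sup>\<dagger> \<rhd> x = T\<^sup>\<dagger> \<rhd> x"
  shows "T * P = P * T"
proof -
  have idem: "P \<rhd> P \<rhd> x = P \<rhd> x" for x using P by (metis app_mult proj_def)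
  have 1: "P * T * P = T * P" by (rule cop_eqI) (simp add: T idem)
  have "P * T\<^sup>\<dagger> * P = T\<^sup>\<dagger> * P" by (rule cop_eqI) (simp add: T' idem)
  from arg_cong[OF this, of star] have "P * T * P = P * T" using P by (simp add: proj_def mult.assoc)
  with 1 show ?thesis by simp
qed

text \<open>The subspace \<open>N\<close> annihilated by all A X is invariant under \<open>M\<close>
  and under the commutant of \<open>M\<close>, so its projection is central and hence a scalar
  \<open>c\<close>. If c = 1 then A = 0; otherwise the range of \<open>B\<close>, contained in
  \<open>N\<close>, must vanish.\<close>

lemma (in vn_factor) prime:
  assumes A: "A \<in> M" and B: "B \<in> M" and zero: "\<And>X. X \<in> M \<Longrightarrow> A * X * B = 0"
  shows "A = 0 \<or> B = 0"
proof -
  define N where "N = {x. \<forall>X\<in>M. A \<rhd> X \<rhd> x = 0}"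
  have "N = (\<Inter>X\<in>M. {x. (A * X) \<rhd> x = 0})" by (auto simp: N_def)
  moreover have "closed {x. (A * X) \<rhd> x = 0}" for X
    by (intro closed_Collect_eq linear_continuous_on bounded_linear_app continuous_on_const)
  ultimately have "closed N" by (simp add: closed_INT)
  then have "\<exists>P. proj P \<and> range (app P) = N"
    by (rule projection_exists) (auto simp: N_def app_simps)
  then obtain P where P: "proj P" "range (app P) = N" by blast
  have fixed: "P \<rhd> x = x \<longleftrightarrow> x \<in> N" for x
    using P by (metis app_mult proj_def rangeE rangeI)
  have comm: "P * T = T * P" if T: "T \<in> M" for T
  proof (rule sym, rule proj_commute[OF P(1)])
    have inv: "S \<rhd> x \<in> N" if "S \<in> M" "x \<in> N" for S x
      using that by (auto simp: N_def) (metis app_mult mult_mem)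
    show "P \<rhd> T \<rhd> x = T \<rhd> x" "P \<rhd> T\<^sup>\<dagger> \<rhd> x = T\<^sup>\<dagger> \<rhd> x" if "P \<rhd> x = x" for x
      using that inv T star_mem unfolding fixed by blast+
  qed
  have "P \<in> M"
  proof (rule bicommutant)
    fix T assume T: "\<And>A. A \<in> M \<Longrightarrow> A * T = T * A"
    \<comment> \<open>An operator commuting with \<open>M\<close> moves past \<open>A\<close> and
      \<open>X\<close>, so it maps \<open>N\<close> into itself.\<close>
    have inv: "S \<rhd> x \<in> N" if S: "\<And>A. A \<in> M \<Longrightarrow> A * S = S * A" and x: "x \<in> N" for S x
    proof -
      have "A \<rhd> X \<rhd> S \<rhd> x = S \<rhd> A \<rhd> X \<rhd> x" if "X \<in> M" for X
        using S[OF A] S[OF that] by (metis app_mult)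
      then show ?thesis using x by (simp add: N_def)
    qed
    have "A * T\<^sup>\<dagger> = T\<^sup>\<dagger> * A" if "A \<in> M" for A
      using T[OF star_mem[OF that]] by (metis star_mult star_star)
    then show "P * T = T * P"
      using inv T unfolding fixed[symmetric] by (intro sym[OF proj_commute[OF P(1)]]) blast+
  qed
  then obtain c where c: "P = c \<odot> 1" using central_scalar comm by blast
  have cP: "P \<rhd> x = c *\<^sub>C x" for x by (simp add: c app_cscale)
  show ?thesis
  proof (cases "c = 1")
    case True
    then have "A \<rhd> x = 0" for x
      using fixed[of x] one_mem by (auto simp: cP N_def)
    then show ?thesis by (metis app_zero cop_eqI)
  next
    case False
    have "B \<rhd> x = 0" for x
    proof -
      have "B \<rhd> x \<in> N" using zero by (auto simp: N_def) (metis app_mult app_zero)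
      then have "c *\<^sub>C (B \<rhd> x) = B \<rhd> x" using fixed cP by metis
      then have "(c - 1) *\<^sub>C (B \<rhd> x) = 0"
        using scaleC_add_left[of "c - 1" 1 "B \<rhd> x"] by simp
      then show ?thesis using False norm_scaleC[of "c - 1" "B \<rhd> x"] by simp
    qed
    then show ?thesis by (metis app_zero cop_eqI)
  qed
qed

lemma Chains_total:
  assumes "K \<in> Chains (relation_of P A)"
  shows "K \<subseteq> A" "\<And>i j. i \<in> K \<Longrightarrow> j \<in> K \<Longrightarrow> P i j \<or> P j i"
  using assms unfolding Chains_def relation_of_def by blast+

text \<open>Zorn's lemma for partial isometries from a part of \<open>e\<close> onto a part of
  \<open>f\<close>, ordered by extension. For a maximal \<open>v\<close> one of the remainders
  \<open>e - v\<^sup>\<dagger> * v\<close> and \<open>f - v * v\<^sup>\<dagger>\<close> must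
  vanish.\<close>

lemma (in vn_factor) projections_comparable:
  assumes e: "e \<in> M" "proj e" and f: "f \<in> M" "proj f"
  shows "\<exists>v\<in>M. pisom v \<and> v * e = v \<and> f * v = v \<and> (v\<^sup>\<dagger> * v = e \<or> v * v\<^sup>\<dagger> = f)"
proof -
  define A where "A = {v \<in> M. pisom v \<and> v * e = v \<and> f * v = v}"
  have "\<exists>m\<in>A. \<forall>a\<in>A. extends m a \<longrightarrow> a = m"
  proof (rule predicate_Zorn)
    show "partial_order_on A (relation_of extends A)"
      by (rule partial_order_on_relation_ofI)
        (auto simp: A_def intro: extends_refl extends_trans extends_antisym)
    fix K assume K: "K \<in> Chains (relation_of extends A)"
    note K = Chains_total[OF K]
    show "\<exists>u\<in>A. \<forall>a\<in>K. extends a u"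
    proof (cases "K = {}")
      case True
      then show ?thesis by (intro bexI[of _ 0]) (auto simp: A_def zero_mem)
    next
      case False
      interpret increasing_pisoms M K extends "\<lambda>v. v"
      proof unfold_locales
        show "\<exists>k\<in>K. extends i k \<and> extends j k" if "i \<in> K" "j \<in> K" for i j
          using K that extends_refl by (auto simp: A_def) blast
      qed (use K False in \<open>auto simp: A_def intro: extends_refl extends_trans\<close>)
      obtain w where w: "w \<in> M" "pisom w" "\<forall>i\<in>K. extends i w" "slim (\<lambda>v. v) w tail"
        "slim (\<lambda>i. i\<^sup>\<dagger>) w\<^sup>\<dagger> tail"
        using limit_exists by auto
      have absorb: "g * z = z"
        if "slim h z tail" "\<And>i. i \<in> K \<Longrightarrow> g * h i = h i" for g z and h :: "'h cop \<Rightarrow> 'h cop"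
      proof (rule slim_unique[OF tail_not_bot slim_mult_left[OF that(1)] slim_cong[OF _ that(1)]])
        show "\<forall>\<^sub>F i in tail. h i = g * h i"
          using eventually_tail_in by eventually_elim (simp add: that(2))
      qed
      have "f * w = w" by (rule absorb[OF w(4)]) (use K in \<open>auto simp: A_def\<close>)
      moreover have "e * w\<^sup>\<dagger> = w\<^sup>\<dagger>"
      proof (rule absorb[OF w(5)])
        fix i assume "i \<in> K"
        then have "i * e = i" using K by (auto simp: A_def)
        from arg_cong[OF this, of star] show "e * i\<^sup>\<dagger> = i\<^sup>\<dagger>" using e by (simp add: proj_def)
      qed
      then have "w * e = w" using e by (metis proj_def star_mult star_star)
      ultimately show ?thesis using w by (auto simp: A_def)
    qed
  qed
  then obtain v where v: "v \<in> M" "pisom v" "v * e = v" "f * v = v"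
      and max: "\<And>w. w \<in> M \<Longrightarrow> pisom w \<Longrightarrow> w * e = w \<Longrightarrow> f * w = w \<Longrightarrow> extends v w \<Longrightarrow> w = v"
    unfolding A_def by blast
  have v': "v * (v\<^sup>\<dagger> * v) = v" "v\<^sup>\<dagger> * (v * v\<^sup>\<dagger>) = v\<^sup>\<dagger>"
    using v(2) pisom_star[OF v(2)] by (simp_all add: pisom_def mult.assoc)
  have ev: "e * v\<^sup>\<dagger> = v\<^sup>\<dagger>" and vf: "v\<^sup>\<dagger> * f = v\<^sup>\<dagger>"
    using arg_cong[OF v(3), of star] arg_cong[OF v(4), of star] e f by (simp_all add: proj_def)
  define E F where "E = e - v\<^sup>\<dagger> * v" and "F = f - v * v\<^sup>\<dagger>"
  have EF: "E \<in> M" "F \<in> M" using e f v(1) by (simp_all add: E_def F_def mem)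
  have Ev: "E * v\<^sup>\<dagger> = 0" using ev v'(2) by (simp add: E_def left_diff_distrib mult.assoc)
  have vF: "v\<^sup>\<dagger> * F = 0" using vf v'(2) by (simp add: F_def right_diff_distrib)
  have "e * e = e" "f * f = f" using e f by (simp_all add: proj_def)
  then have Ee: "E * e = E" and fF: "f * F = F"
    using v(3,4) by (simp_all add: E_def F_def left_diff_distrib right_diff_distrib mult.assoc)
      (simp flip: mult.assoc)
  have "E * E = E" "F * F = F"
  proof -
    have "E * E = E * e - E * v\<^sup>\<dagger> * v" by (simp add: E_def right_diff_distrib mult.assoc)
    then show "E * E = E" by (simp add: Ee Ev)
    have "F * F = f * F - v * (v\<^sup>\<dagger> * F)" by (simp add: F_def left_diff_distrib mult.assoc)
    then show "F * F = F" by (simp add: fF vF)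
  qed
  have "F = 0 \<or> E = 0"
  proof (rule ccontr)
    assume "\<not> (F = 0 \<or> E = 0)"
    \<comment> \<open>Primeness links two nonzero remainders. The polar part of
      \<open>F * X * E\<close> starts below \<open>E\<close> and ends below \<open>F\<close>, so
      adding it to \<open>v\<close> gives a proper extension.\<close>
    then obtain X where X: "X \<in> M" "F * X * E \<noteq> 0" using prime[OF EF(2,1)] by blast
    obtain u where u: "u \<in> M" "pisom u" "u \<noteq> 0"
        and uF: "\<And>G. G * (F * X * E) = F * X * E \<Longrightarrow> G * u = u"
        and uE: "\<And>G. F * X * E * G = F * X * E \<Longrightarrow> u * G = u"
      using polar_partial_isometry[OF _ X(2)] X(1) EF by (metis mult_mem)
    have Fu: "F * u = u" by (rule uF) (simp add: \<open>F * F = F\<close> flip: mult.assoc)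
    have uE': "u * E = u" by (rule uE) (simp add: \<open>E * E = E\<close> mult.assoc)
    have vu: "v\<^sup>\<dagger> * u = 0" using vF Fu by (metis mult.assoc mult_zero_left)
    have uv: "u * v\<^sup>\<dagger> = 0" using Ev uE' by (metis mult.assoc mult_zero_right)
    have uv': "u\<^sup>\<dagger> * v = 0" "v * u\<^sup>\<dagger> = 0"
      using arg_cong[OF vu, of star] arg_cong[OF uv, of star] by simp_all
    have "(v + u) * (v + u)\<^sup>\<dagger> * (v + u) = v * v\<^sup>\<dagger> * v + u * u\<^sup>\<dagger> * u"
      by (simp add: distrib_left distrib_right uv uv' vu mult.assoc)
    then have "pisom (v + u)" using v(2) u(2) by (simp add: pisom_def)
    moreover have "(v + u) * e = v + u" using v(3) uE' Ee by (metis distrib_right mult.assoc)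
    moreover have "f * (v + u) = v + u" using v(4) Fu fF by (metis distrib_left mult.assoc)
    moreover have "extends v (v + u)"
      unfolding extends_def using v'(1) uv by (simp add: distrib_right flip: mult.assoc)
    ultimately have "v + u = v" by (intro max add_mem u v)
    then show False using u(3) by simp
  qed
  then show ?thesis using v by (auto simp: E_def F_def)
qed

section \<open>Orthogonal isometries in an infinite factor\<close>

text \<open>The pair \<open>(a, b)\<close> exhibits its common initial projection as properly infinite.\<close>

definition halving :: "'h::chilbert_space cop \<times> 'h cop \<Rightarrow> bool" where
  "halving = (\<lambda>(a, b). pisom a \<and> pisom b \<and> a\<^sup>\<dagger> * a = b\<^sup>\<dagger> * b \<and> a\<^sup>\<dagger> * b = 0 \<and>
     a\<^sup>\<dagger> * a * a = a \<and> a\<^sup>\<dagger> * a * b = b)"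

definition extends2 :: "'h::chilbert_space cop \<times> 'h cop \<Rightarrow> 'h cop \<times> 'h cop \<Rightarrow> bool" where
  "extends2 v w \<longleftrightarrow> extends (fst v) (fst w) \<and> extends (snd v) (snd w)"

text \<open>In \<open>absorb\<close> the initial projection may belong to a later index: partial
  sums of the Hilbert hotel have ranges outside their own initial spaces, and only the limit is a
  halving pair. For chains of halving pairs the index itself serves.\<close>

lemma (in vn_algebra) halving_limit:
  assumes C: "directed C le"
    and v: "\<And>i. i \<in> C \<Longrightarrow> v i \<in> M \<and> pisom (v i)" and w: "\<And>i. i \<in> C \<Longrightarrow> w i \<in> M \<and> pisom (w i)"
    and initial: "\<And>i. i \<in> C \<Longrightarrow> (v i)\<^sup>\<dagger> * v i = (w i)\<^sup>\<dagger> * w i"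
    and orth: "\<And>i. i \<in> C \<Longrightarrow> (v i)\<^sup>\<dagger> * w i = 0"
    and ext: "\<And>i j. i \<in> C \<Longrightarrow> j \<in> C \<Longrightarrow> le i j \<Longrightarrow> extends (v i) (v j) \<and> extends (w i) (w j)"
    and absorb: "\<And>i. i \<in> C \<Longrightarrow> \<exists>j\<in>C. (v j)\<^sup>\<dagger> * v j * v i = v i \<and> (v j)\<^sup>\<dagger> * v j * w i = w i"
  shows "\<exists>a\<in>M. \<exists>b\<in>M. halving (a, b) \<and> (\<forall>i\<in>C. extends2 (v i, w i) (a, b))"
proof -
  interpret directed C le by (rule C)
  interpret v: increasing_pisoms M C le v by unfold_locales (use v ext in auto)
  interpret w: increasing_pisoms M C le w by unfold_locales (use w ext in auto)
  obtain a where a: "a \<in> M" "pisom a" "\<forall>i\<in>C. extends (v i) a" "slim v a tail" "slim (\<lambda>i. (v i)\<^sup>\<dagger>) a\<^sup>\<dagger> tail"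
    using v.limit_exists by blast
  obtain b where b: "b \<in> M" "pisom b" "\<forall>i\<in>C. extends (w i) b" "slim w b tail" "slim (\<lambda>i. (w i)\<^sup>\<dagger>) b\<^sup>\<dagger> tail"
    using w.limit_exists by blast
  note eq = slim_unique[OF tail_not_bot]
  have aa: "slim (\<lambda>i. (v i)\<^sup>\<dagger> * v i) (a\<^sup>\<dagger> * a) tail" by (intro slim_mult a v.ev_norm)
  have bb: "slim (\<lambda>i. (w i)\<^sup>\<dagger> * w i) (b\<^sup>\<dagger> * b) tail" by (intro slim_mult b w.ev_norm)
  have ab: "slim (\<lambda>i. (v i)\<^sup>\<dagger> * w i) (a\<^sup>\<dagger> * b) tail" by (intro slim_mult a b v.ev_norm)
  have "\<forall>\<^sub>F i in tail. (v i)\<^sup>\<dagger> * v i = (w i)\<^sup>\<dagger> * w i"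
    using eventually_tail_in by eventually_elim (rule initial)
  then have "a\<^sup>\<dagger> * a = b\<^sup>\<dagger> * b" using eq[OF slim_cong[OF _ aa] bb] by blast
  moreover have "\<forall>\<^sub>F i in tail. (v i)\<^sup>\<dagger> * w i = 0"
    using eventually_tail_in by eventually_elim (rule orth)
  then have "a\<^sup>\<dagger> * b = 0" using eq[OF slim_cong[OF _ ab] slim_const] by blast
  moreover have P: "a\<^sup>\<dagger> * a * v i = v i" "a\<^sup>\<dagger> * a * w i = w i" if i: "i \<in> C" for i
  proof -
    obtain j where j: "j \<in> C" "(v j)\<^sup>\<dagger> * v j * v i = v i" "(v j)\<^sup>\<dagger> * v j * w i = w i"
      using absorb[OF i] by blast
    have "a\<^sup>\<dagger> * a * ((v j)\<^sup>\<dagger> * v j) = (v j)\<^sup>\<dagger> * v j"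
      using extends_initial v j(1) a by blast
    then show "a\<^sup>\<dagger> * a * v i = v i" "a\<^sup>\<dagger> * a * w i = w i" using j by (metis mult.assoc)+
  qed
  have "\<forall>\<^sub>F i in tail. v i = a\<^sup>\<dagger> * a * v i" "\<forall>\<^sub>F i in tail. w i = a\<^sup>\<dagger> * a * w i"
    using eventually_tail_in by (eventually_elim, simp only: P)+
  then have "a\<^sup>\<dagger> * a * a = a" "a\<^sup>\<dagger> * a * b = b"
    using eq[OF slim_mult_left[OF a(4)] slim_cong[OF _ a(4)]]
      eq[OF slim_mult_left[OF b(4)] slim_cong[OF _ b(4)]] by blast+
  ultimately have "halving (a, b)" using a(2) b(2) by (simp add: halving_def)
  then show ?thesis
    using a b by (intro bexI[of _ a] bexI[of _ b] conjI ballI) (simp_all add: extends2_def)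
qed

text \<open>The start of the maximality argument: from the shift \<open>V\<close> with defect \<open>e\<close> the operators
  \<open>\<Sum>\<^sub>k V\<^sup>2\<^sup>k e V\<^sup>*\<^sup>k\<close> and \<open>\<Sum>\<^sub>k V\<^sup>2\<^sup>k\<^sup>+\<^sup>1 e V\<^sup>*\<^sup>k\<close>, whose partial sums are \<open>shift n\<close> and \<open>V * shift n\<close>.\<close>

lemma (in vn_algebra) nonzero_halving_exists:
  assumes V: "V \<in> M" "V\<^sup>\<dagger> * V = 1" "V * V\<^sup>\<dagger> \<noteq> 1"
  shows "\<exists>a\<in>M. \<exists>b\<in>M. halving (a, b) \<and> a \<noteq> 0"
proof -
  define e where "e = 1 - V * V\<^sup>\<dagger>"
  have VV: "V\<^sup>\<dagger> * (V * x) = x" for x using V(2) by (simp flip: mult.assoc)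
  have e: "e \<in> M" "e\<^sup>\<dagger> = e" "e \<noteq> 0" using V by (simp_all add: e_def mem)
  have eV: "e * (V * x) = 0" "V\<^sup>\<dagger> * (e * x) = 0" "e * (e * x) = e * x" for x
    by (simp_all add: e_def left_diff_distrib right_diff_distrib VV mult.assoc)
  have eV': "e * V = 0" "V\<^sup>\<dagger> * e = 0" "e * e = e"
    using eV[of 1] by simp_all
  define shift where "shift = rec_nat 0 (\<lambda>n s. e + V * (V * (s * V\<^sup>\<dagger>)))"
  \<comment> \<open>\<open>p n\<close> is the sum of V^k e V^{*k} over k < n and the initial
    projection of \<open>shift n\<close>. Calling the range of V^k e level k, \<open>shift n\<close>
    sends level k to level 2k and \<open>V * shift n\<close> sends it to level 2k + 1.\<close>
  define p where "p = rec_nat 0 (\<lambda>n s. e + V * (s * V\<^sup>\<dagger>))"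
  have s: "shift 0 = 0" "\<And>n. shift (Suc n) = e + V * (V * (shift n * V\<^sup>\<dagger>))"
    by (simp_all add: shift_def)
  have p: "p 0 = 0" "\<And>n. p (Suc n) = e + V * (p n * V\<^sup>\<dagger>)"
    by (simp_all add: p_def)
  note red = distrib_left distrib_right mult.assoc eV eV' VV e(2)
  have s_mem: "shift n \<in> M" for n by (induction n) (simp_all add: s mem V e)
  \<comment> \<open>The trailing factor \<open>x\<close> keeps products nested to the right, so the
    induction hypothesis, taken at \<open>V\<^sup>\<dagger> * x\<close>, works as a rewrite
    rule.\<close>
  have init: "(shift n)\<^sup>\<dagger> * (shift n * x) = p n * x" for n x
  proof (induction n arbitrary: x)
    case (Suc n)
    show ?case using Suc[of "V\<^sup>\<dagger> * x"] by (simp add: s p red)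
  qed (simp add: s p)
  have sp: "shift n * (p n * x) = shift n * x" for n x
  proof (induction n arbitrary: x)
    case (Suc n)
    show ?case using Suc[of "V\<^sup>\<dagger> * x"] by (simp add: s p red)
  qed (simp add: s p)
  have orth: "(shift n)\<^sup>\<dagger> * (V * (shift n * x)) = 0" for n x
  proof (induction n arbitrary: x)
    case (Suc n)
    show ?case using Suc[of "V\<^sup>\<dagger> * x"] by (simp add: s p red)
  qed (simp add: s p)
  have step: "shift (Suc n) * (p n * x) = shift n * x" for n x
  proof (induction n arbitrary: x)
    case (Suc n)
    have "shift (Suc (Suc n)) * (p (Suc n) * x) = e * x + V * (V * (shift (Suc n) * (p n * (V\<^sup>\<dagger> * x))))"
      unfolding s(2)[of "Suc n"] p(2) by (simp add: red)
    then show ?case by (simp add: Suc) (simp add: s red)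
  qed (simp add: s p)
  have inv: "p (n + n) * (shift n * x) = shift n * x" for n x
  proof (induction n arbitrary: x)
    case (Suc n)
    show ?case using Suc[of "V\<^sup>\<dagger> * x"] by (simp add: s p red)
  qed (simp add: s p)
  have invV: "p (Suc (n + n)) * (V * (shift n * x)) = V * (shift n * x)" for n x
    using inv[of n x] by (simp add: p red)
  have s_pisom: "pisom (shift n)" "pisom (V * shift n)" for n
    using init[of n 1] sp[of n 1] by (simp_all add: pisom_def mult.assoc VV)
  have pn: "(shift n)\<^sup>\<dagger> * shift n = p n" for n using init[of n 1] by simp
  have ext: "extends (shift n) (shift m) \<and> extends (V * shift n) (V * shift m)" if "n \<le> m" for n m
    using that
  proof (induction m rule: dec_induct)
    case base
    show ?case by (simp add: extends_refl s_pisom)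
  next
    case (step m)
    have 1: "shift (Suc m) * p m = shift m" using \<open>\<And>x n. shift (Suc n) * (p n * x) = shift n * x\<close>[of m 1] by simp
    have "extends (shift m) (shift (Suc m))" "extends (V * shift m) (V * shift (Suc m))"
      by (simp_all add: extends_def pn 1 mult.assoc VV)
    then show ?case using step.IH extends_trans s_pisom by blast
  qed
  have p_mono: "p m * (p n * x) = p n * x" if "n \<le> m" for n m x
  proof -
    have "(shift m)\<^sup>\<dagger> * shift m * ((shift n)\<^sup>\<dagger> * shift n) = (shift n)\<^sup>\<dagger> * shift n"
      using extends_initial s_pisom ext[OF that] by blast
    then have "p m * p n = p n" by (simp only: pn)
    then show ?thesis by (simp flip: mult.assoc)
  qed
  have "\<exists>a\<in>M. \<exists>b\<in>M. halving (a, b) \<and> (\<forall>i\<in>UNIV. extends2 (shift i, V * shift i) (a, b))"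
  proof (rule halving_limit[OF nat_directed.directed_axioms])
    show "\<exists>j\<in>UNIV. (shift j)\<^sup>\<dagger> * shift j * shift i = shift i \<and> (shift j)\<^sup>\<dagger> * shift j * (V * shift i) = V * shift i" for i
    \<comment> \<open>Both ranges for index \<open>i\<close> lie in levels below 2i, which
      \<open>p (2i + 1)\<close> covers.\<close>
    proof (intro bexI[of _ "Suc (i + i)"] conjI)
      have "p (i + i) * shift i = shift i" using inv[of i 1] by simp
      then have "p (Suc (i + i)) * shift i = shift i"
        using p_mono[of "i + i" "Suc (i + i)" "shift i"] by simp
      then show "(shift (Suc (i + i)))\<^sup>\<dagger> * shift (Suc (i + i)) * shift i = shift i" by (simp only: pn)
      show "(shift (Suc (i + i)))\<^sup>\<dagger> * shift (Suc (i + i)) * (V * shift i) = V * shift i"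
        using invV[of i 1] by (simp only: pn) simp
    qed simp
    show "(shift i)\<^sup>\<dagger> * (V * shift i) = 0" for i using orth[of i 1] by simp
  qed (use ext s_mem s_pisom V in \<open>simp_all add: mem mult.assoc VV\<close>)
  then obtain a b where ab: "a \<in> M" "b \<in> M" "halving (a, b)" "extends2 (shift 1, V * shift 1) (a, b)"
    by blast
  have "shift 1 = e" by (simp add: s)
  then have "a \<noteq> 0" using ab(4) e(3) by (auto simp: extends2_def extends_def)
  then show ?thesis using ab by blast
qed

text \<open>A maximal halving pair has an initial projection \<open>p\<close> that is compared with
  \<open>1 - p\<close>. If \<open>p\<close> were equivalent to a part of \<open>1 - p\<close>, a
  copy of the pair could be added there; so \<open>1 - p\<close> is equivalent to a part of
  \<open>p\<close>, and the whole space fits twice into \<open>p\<close>.\<close>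

lemma (in vn_factor) orthogonal_isometries:
  assumes V: "V \<in> M" "V\<^sup>\<dagger> * V = 1" "V * V\<^sup>\<dagger> \<noteq> 1"
  shows "\<exists>V1\<in>M. \<exists>V2\<in>M. V1\<^sup>\<dagger> * V1 = 1 \<and> V2\<^sup>\<dagger> * V2 = 1 \<and> V1\<^sup>\<dagger> * V2 = 0"
proof -
  obtain a0 b0 where s: "a0 \<in> M" "b0 \<in> M" "halving (a0, b0)" "a0 \<noteq> 0"
    using nonzero_halving_exists[OF V] by blast
  define A where "A = {v. fst v \<in> M \<and> snd v \<in> M \<and> halving v \<and> extends2 (a0, b0) v}"
  have hp: "pisom (fst v) \<and> pisom (snd v)" if "halving v" for v :: "'h cop \<times> 'h cop"
    using that by (auto simp: halving_def)
  have e2_trans: "extends2 u w" if "halving u" "halving v" "extends2 u v" "extends2 v w" for u v w :: "'h cop \<times> 'h cop"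
    using that hp extends_trans unfolding extends2_def by blast
  have e2_refl: "extends2 u u" if "halving u" for u :: "'h cop \<times> 'h cop"
    using that hp extends_refl unfolding extends2_def by blast
  have "\<exists>m\<in>A. \<forall>a\<in>A. extends2 m a \<longrightarrow> a = m"
  proof (rule predicate_Zorn)
    show "partial_order_on A (relation_of extends2 A)"
    proof (rule partial_order_on_relation_ofI)
      show "u = v" if "u \<in> A" "v \<in> A" "extends2 u v" "extends2 v u" for u v
        using that hp extends_antisym unfolding extends2_def A_def by (intro prod_eqI) blast+
      show "extends2 u w" if "u \<in> A" "v \<in> A" "w \<in> A" "extends2 u v" "extends2 v w" for u v w
        using that e2_trans unfolding A_def by blast
      show "extends2 u u" if "u \<in> A" for u using that e2_refl by (simp add: A_def)
    qed
    fix K assume K: "K \<in> Chains (relation_of extends2 A)"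
    note K = Chains_total[OF K]
    show "\<exists>u\<in>A. \<forall>a\<in>K. extends2 a u"
    proof (cases "K = {}")
      case True
      moreover have "(a0, b0) \<in> A" using s e2_refl[OF s(3)] by (simp add: A_def)
      ultimately show ?thesis by blast
    next
      case False
      have KA: "halving k" "fst k \<in> M" "snd k \<in> M" "extends2 (a0, b0) k" if "k \<in> K" for k
        using K(1) that by (auto simp: A_def)
      have "\<exists>a\<in>M. \<exists>b\<in>M. halving (a, b) \<and> (\<forall>i\<in>K. extends2 (fst i, snd i) (a, b))"
      proof (rule halving_limit[where le = extends2])
        show "directed K extends2"
        proof
          show "\<exists>k\<in>K. extends2 i k \<and> extends2 j k" if "i \<in> K" "j \<in> K" for i j
            using K(2)[OF that] that e2_refl KA by blast
          show "extends2 i k" if "i \<in> K" "j \<in> K" "k \<in> K" "extends2 i j" "extends2 j k" for i j k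
            using that e2_trans KA by blast
        qed (use False e2_refl KA in auto)
        show "\<exists>j\<in>K. (fst j)\<^sup>\<dagger> * fst j * fst i = fst i \<and> (fst j)\<^sup>\<dagger> * fst j * snd i = snd i" if "i \<in> K" for i
          using KA(1)[OF that, unfolded halving_def case_prod_unfold] that by blast
      qed (use KA in \<open>simp_all add: halving_def extends2_def case_prod_unfold\<close>)
      then obtain a b where ab: "a \<in> M" "b \<in> M" "halving (a, b)" "\<forall>i\<in>K. extends2 i (a, b)" by auto
      obtain k where "k \<in> K" using False by blast
      then have "extends2 (a0, b0) (a, b)" using e2_trans s(3) KA ab(4) by blast
      then show ?thesis using ab by (auto simp: A_def)
    qed
  qed
  then obtain a b where ab: "a \<in> M" "b \<in> M" "halving (a, b)" "extends2 (a0, b0) (a, b)"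
      and max: "\<And>c d. c \<in> M \<Longrightarrow> d \<in> M \<Longrightarrow> halving (c, d) \<Longrightarrow> extends2 (a0, b0) (c, d) \<Longrightarrow>
        extends2 (a, b) (c, d) \<Longrightarrow> c = a"
    unfolding A_def by auto
  have a0: "a \<noteq> 0" using ab(4) s(4) by (auto simp: extends2_def extends_def)
  define p where "p = a\<^sup>\<dagger> * a"
  have h: "pisom a" "pisom b" "b\<^sup>\<dagger> * b = p" "a\<^sup>\<dagger> * b = 0" "p * a = a" "p * b = b"
    using ab(3) by (auto simp: halving_def p_def)
  have pp: "proj p" unfolding p_def by (rule pisom_proj[OF h(1)])
  have p: "p \<in> M" "p\<^sup>\<dagger> = p" "p * p = p" using pp ab(1) by (simp_all add: p_def mem proj_def)
  have ap: "a * p = a" "b * p = b"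
    using h(1-3) by (simp_all add: pisom_def p_def mult.assoc)
  have ba: "b\<^sup>\<dagger> * a = 0" using arg_cong[OF h(4), of star] by simp
  obtain w where w: "w \<in> M" "pisom w" "w * (1 - p) = w" "p * w = w" "w\<^sup>\<dagger> * w = 1 - p \<or> w * w\<^sup>\<dagger> = p"
    using projections_comparable[OF _ proj_compl[OF pp] p(1) pp] p(1) by (auto simp: mem)
  have wp: "w * p = 0" using w(3) by (simp add: right_diff_distrib)
  have pw: "p * w\<^sup>\<dagger> = 0" "w\<^sup>\<dagger> * p = w\<^sup>\<dagger>"
    using arg_cong[OF wp, of star] arg_cong[OF w(4), of star] by (simp_all add: p)
  have a_star: "a\<^sup>\<dagger> * (a * x) = p * x" "b\<^sup>\<dagger> * (b * x) = p * x" "a\<^sup>\<dagger> * (b * x) = 0" "b\<^sup>\<dagger> * (a * x) = 0"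
    "p * (a * x) = a * x" "p * (b * x) = b * x" "a * (p * x) = a * x" "b * (p * x) = b * x"
    "w * (p * x) = 0" "p * (w * x) = w * x" "p * (w\<^sup>\<dagger> * x) = 0" "w\<^sup>\<dagger> * (p * x) = w\<^sup>\<dagger> * x"
    "p * (p * x) = p * x" for x
    using h(3-6) ap ba wp w(4) pw p(3) by (simp_all add: p_def flip: mult.assoc)
  have a_dag: "a\<^sup>\<dagger> * p = a\<^sup>\<dagger>" "b\<^sup>\<dagger> * p = b\<^sup>\<dagger>"
    using arg_cong[OF h(5), of star] arg_cong[OF h(6), of star] by (simp_all add: p)
  have wa: "w * a = 0" "w * b = 0"
    using h(5,6) wp by (metis mult.assoc mult_zero_left)+
  have aw: "a * w\<^sup>\<dagger> = 0" "b * w\<^sup>\<dagger> = 0"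
    using ap pw by (metis mult.assoc mult_zero_right)+
  have aw_star: "a\<^sup>\<dagger> * w\<^sup>\<dagger> = 0" "b\<^sup>\<dagger> * w\<^sup>\<dagger> = 0"
    using arg_cong[OF wa(1), of star] arg_cong[OF wa(2), of star] by simp_all
  have red: "w * (a * x) = 0" "w * (b * x) = 0" "a * (w\<^sup>\<dagger> * x) = 0" "b * (w\<^sup>\<dagger> * x) = 0"
    "a\<^sup>\<dagger> * (w\<^sup>\<dagger> * x) = 0" "b\<^sup>\<dagger> * (w\<^sup>\<dagger> * x) = 0" "a\<^sup>\<dagger> * (p * x) = a\<^sup>\<dagger> * x" "b\<^sup>\<dagger> * (p * x) = b\<^sup>\<dagger> * x" for x
    using wa aw aw_star a_dag by (simp_all flip: mult.assoc)
  have "w\<^sup>\<dagger> * w = 1 - p"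
  proof (rule ccontr)
    assume "w\<^sup>\<dagger> * w \<noteq> 1 - p"
    then have ww: "w * w\<^sup>\<dagger> = p" using w(5) by blast
    have ww': "w * (w\<^sup>\<dagger> * x) = p * x" for x using ww by (simp flip: mult.assoc)
    \<comment> \<open>\<open>w\<^sup>\<dagger> * a * w\<close> and
      \<open>w\<^sup>\<dagger> * b * w\<close> are the pair transported below \<open>1 - p\<close>,
      with initial projection \<open>w\<^sup>\<dagger> * w\<close>.\<close>
    define c d where "c = a + w\<^sup>\<dagger> * a * w" and "d = b + w\<^sup>\<dagger> * b * w"
    have cd: "c \<in> M" "d \<in> M" using ab w by (simp_all add: c_def d_def mem)
    note rules = distrib_left distrib_right mult.assoc a_star red ww' wp pw w(4) wa aw aw_star a_dag h(3-6) ap ba p(3)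
      p_def[symmetric]
    have cc: "c\<^sup>\<dagger> * c = p + w\<^sup>\<dagger> * w" "d\<^sup>\<dagger> * d = p + w\<^sup>\<dagger> * w" "c\<^sup>\<dagger> * d = 0"
      by (simp_all add: c_def d_def rules)
    have cp: "c * (p + w\<^sup>\<dagger> * w) = c" "d * (p + w\<^sup>\<dagger> * w) = d" "(p + w\<^sup>\<dagger> * w) * c = c" "(p + w\<^sup>\<dagger> * w) * d = d"
      by (simp_all add: c_def d_def rules)
    have "pisom c" "pisom d" by (simp_all only: pisom_def mult.assoc cc cp)
    then have "halving (c, d)" by (simp add: halving_def cc cp)
    moreover have ext: "extends2 (a, b) (c, d)"
      by (simp add: extends2_def extends_def c_def d_def rules)
    moreover have "extends2 (a0, b0) (c, d)" using e2_trans[OF s(3) ab(3,4) ext] .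
    ultimately have "c = a" using max cd by blast
    then have "w\<^sup>\<dagger> * a * w = 0" by (simp add: c_def)
    \<comment> \<open>Undoing the transport by \<open>w\<close> and applying
      \<open>a\<^sup>\<dagger>\<close> leaves \<open>p\<close>.\<close>
    then have "a\<^sup>\<dagger> * (w * (w\<^sup>\<dagger> * a * w)) * w\<^sup>\<dagger> = 0" by simp
    then have "p = 0" by (simp add: mult.assoc ww' a_star ww p(3))
    then show False using a0 h(5) by simp
  qed
  then have ww: "w\<^sup>\<dagger> * w = 1 - p" .
  \<comment> \<open>On \<open>p\<close> the inner operator is \<open>a\<close>, on
    \<open>1 - p\<close> it is \<open>b * w\<close>; their ranges are orthogonal inside
    \<open>p\<close>, so they sum to an isometry into \<open>p\<close>. Following it by
    \<open>a\<close> or by \<open>b\<close> gives two isometries with orthogonal ranges.\<close>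
  define V1 V2 where "V1 = a * a + a * b * w" and "V2 = b * a + b * b * w"
  note rules = distrib_left distrib_right mult.assoc a_star red ww wp pw w(4) wa aw aw_star a_dag h(3-6) ap ba p(3)
    p_def[symmetric]
  have "V1\<^sup>\<dagger> * V1 = 1" "V2\<^sup>\<dagger> * V2 = 1" "V1\<^sup>\<dagger> * V2 = 0"
    by (simp_all add: V1_def V2_def rules)
  moreover have "V1 \<in> M" "V2 \<in> M" using ab w by (simp_all add: V1_def V2_def mem)
  ultimately show ?thesis by blast
qed

section \<open>Extreme points of the unit ball of a factor\<close>

lemma norm_convex_combination_sq:
  fixes x y :: "'h::chilbert_space"
  shows "(norm ((1 - u) *\<^sub>R x + u *\<^sub>R y))\<^sup>2
    = (1 - u) * (norm x)\<^sup>2 + u * (norm y)\<^sup>2 - u * (1 - u) * (norm (x - y))\<^sup>2"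
  unfolding norm_add_sq norm_diff_sq
  by (simp add: cinner_scaleR_left cinner_scaleR_right power_mult_distrib) algebra

text \<open>Strict convexity of the Hilbert norm: at each vector the combination would lose
  \<open>u * (1 - u)\<close> times the squared distance of \<open>B \<rhd> x\<close> and
  \<open>C \<rhd> x\<close>, but an isometry loses nothing.\<close>

lemma isometry_not_in_open_segment:
  assumes A: "A\<^sup>\<dagger> * A = 1" and B: "norm B \<le> 1" and C: "norm C \<le> 1"
  shows "A \<notin> open_segment B C"
proof
  assume "A \<in> open_segment B C"
  then obtain u where u: "0 < u" "u < 1" "A = (1 - u) *\<^sub>R B + u *\<^sub>R C" and "B \<noteq> C"
    by (auto simp: in_segment)
  have "B \<rhd> x = C \<rhd> x" for x
  proof -
    have "(norm x)\<^sup>2 = (norm (A \<rhd> x))\<^sup>2" using A by (simp add: isom_iff_norm)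
    also have "\<dots> = (1 - u) * (norm (B \<rhd> x))\<^sup>2 + u * (norm (C \<rhd> x))\<^sup>2 - u * (1 - u) * (norm (B \<rhd> x - C \<rhd> x))\<^sup>2"
      unfolding u(3) app_add app_scaleR by (rule norm_convex_combination_sq)
    also have "\<dots> \<le> (1 - u) * (norm x)\<^sup>2 + u * (norm x)\<^sup>2 - u * (1 - u) * (norm (B \<rhd> x - C \<rhd> x))\<^sup>2"
      using u B C by (intro diff_right_mono add_mono mult_left_mono power_mono norm_app_le) auto
    finally have "u * (1 - u) * (norm (B \<rhd> x - C \<rhd> x))\<^sup>2 \<le> 0" by (simp add: algebra_simps)
    then show ?thesis using u by (simp add: mult_le_0_iff)
  qed
  then have "B = C" by (rule cop_eqI)
  then show False using \<open>B \<noteq> C\<close> by simp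
qed

lemma iso_coiso_not_in_open_segment:
  assumes "iso_coiso A" "norm B \<le> 1" "norm C \<le> 1"
  shows "A \<notin> open_segment B C"
proof
  assume A: "A \<in> open_segment B C"
  then have "A\<^sup>\<dagger> \<in> open_segment B\<^sup>\<dagger> C\<^sup>\<dagger>" by (auto simp: in_segment)
  then show False
    using A isometry_not_in_open_segment[of A B C] isometry_not_in_open_segment[of "A\<^sup>\<dagger>" "B\<^sup>\<dagger>" "C\<^sup>\<dagger>"] assms
    by (auto simp: iso_coiso_def)
qed

text \<open>Half of Kadison's description of the extreme points: with \<open>D = 1 - A\<^sup>\<dagger> A\<close> and
  \<open>D' = 1 - A A\<^sup>\<dagger>\<close>, small multiples of \<open>D' X D\<close> can be added to and subtracted from \<open>A\<close>
  inside the unit ball, because \<open>D Y D \<le> \<parallel>Y\<parallel> D\<close>.\<close>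

lemma (in vn_factor) unperturbable_iso_coiso:
  assumes A: "A \<in> M" "norm A \<le> 1"
    and unperturbable: "\<And>B. B \<in> M \<Longrightarrow> norm (A + B) \<le> 1 \<Longrightarrow> norm (A - B) \<le> 1 \<Longrightarrow> B = 0"
  shows "iso_coiso A"
proof -
  define D D' where "D = 1 - A\<^sup>\<dagger> * A" and "D' = 1 - A * A\<^sup>\<dagger>"
  have D: "D \<in> M" "D' \<in> M" "D\<^sup>\<dagger> = D" "D'\<^sup>\<dagger> = D'" using A(1) by (simp_all add: D_def D'_def mem)
  \<comment> \<open>Moves the defect across \<open>A\<close>, so that the cross term between
    \<open>A\<close> and the perturbation depends on \<open>D \<rhd> x\<close> alone.\<close>
  have D'A: "D' * A = A * D" by (simp add: D_def D'_def algebra_simps)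
  \<comment> \<open>The room left below the unit norm, quadratic in
    \<open>D \<rhd> x\<close>.\<close>
  have nA: "(norm (A \<rhd> x))\<^sup>2 \<le> (norm x)\<^sup>2 - (norm (D \<rhd> x))\<^sup>2" for x
  proof -
    have "(norm (A\<^sup>\<dagger> \<rhd> A \<rhd> x))\<^sup>2 \<le> (norm (A \<rhd> x))\<^sup>2"
      using norm_app_le[of "A\<^sup>\<dagger>" "A \<rhd> x"] A(2) by (simp add: power_mono)
    moreover have "Re (cinner x (A\<^sup>\<dagger> \<rhd> A \<rhd> x)) = (norm (A \<rhd> x))\<^sup>2"
      using cinner_eq_norm Re_cinner_commute by metis
    moreover have "D \<rhd> x = x - A\<^sup>\<dagger> \<rhd> A \<rhd> x" by (simp add: D_def app_diff)
    ultimately show ?thesis using norm_diff_sq[of x "A\<^sup>\<dagger> \<rhd> A \<rhd> x"] by simp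
  qed
  have "D' * X * D = 0" if X: "X \<in> M" for X
  proof -
    define B where "B = D' * X * D"
    \<comment> \<open>With r k = 1/4 the perturbation costs at most 2/4 + 1/16 of the squared norm
      of \<open>D \<rhd> x\<close>, less than the room available; the summand 1 keeps
      \<open>k\<close> positive.\<close>
    define k where "k = 1 + norm X + norm (D' * X)"
    define r where "r = 1 / (4 * k)"
    have k: "0 < k" "norm X \<le> k" "norm (D' * X) \<le> k" by (simp_all add: k_def add_pos_nonneg)
    have rk: "r * k = 1 / 4" "0 < r" using k by (simp_all add: r_def)
    have perturbed: "norm (A + s *\<^sub>R B) \<le> 1" if s: "\<bar>s\<bar> = r" for s
    proof (rule norm_cop_bound)
      fix x
      let ?d = "norm (D \<rhd> x)"
      have "cinner (A \<rhd> x) (B \<rhd> x) = cinner ((D' * A) \<rhd> x) ((X * D) \<rhd> x)"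
        by (simp add: B_def cinner_star D)
      also have "\<dots> = cinner (A \<rhd> D \<rhd> x) (X \<rhd> D \<rhd> x)" unfolding D'A by simp
      finally have AB: "cinner (A \<rhd> x) (B \<rhd> x) = cinner (A \<rhd> D \<rhd> x) (X \<rhd> D \<rhd> x)" .
      have le: "norm (A \<rhd> D \<rhd> x) * norm (X \<rhd> D \<rhd> x) \<le> ?d * (k * ?d)"
        using A(2) k by (intro mult_mono norm_app_le order_trans[OF norm_app[of X] mult_right_mono]) auto
      have "\<bar>Re (cinner (A \<rhd> x) (B \<rhd> x))\<bar> \<le> ?d * (k * ?d)"
        unfolding AB using Re_cinner_le[of "A \<rhd> D \<rhd> x" "X \<rhd> D \<rhd> x"] Re_cinner_le[of "- (A \<rhd> D \<rhd> x)" "X \<rhd> D \<rhd> x"] le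
        by (simp add: cinner_minus_left abs_le_iff)
      then have "r * \<bar>Re (cinner (A \<rhd> x) (B \<rhd> x))\<bar> \<le> r * (?d * (k * ?d))"
        using rk(2) by (intro mult_left_mono) auto
      also have "\<dots> = (r * k) * ?d\<^sup>2" by (simp add: power2_eq_square)
      finally have cross: "r * \<bar>Re (cinner (A \<rhd> x) (B \<rhd> x))\<bar> \<le> 1/4 * ?d\<^sup>2" by (simp only: rk)
      have "norm (B \<rhd> x) \<le> k * ?d"
        using order_trans[OF norm_app[of "D' * X" "D \<rhd> x"] mult_right_mono[OF k(3)]] by (simp add: B_def)
      then have "r * norm (B \<rhd> x) \<le> r * (k * ?d)" using rk(2) by (intro mult_left_mono) auto
      also have "\<dots> = 1/4 * ?d" using rk(1) by (simp flip: mult.assoc)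
      finally have "(r * norm (B \<rhd> x))\<^sup>2 \<le> (1/4 * ?d)\<^sup>2" using rk(2) by (intro power_mono) auto
      then have sq: "(r * norm (B \<rhd> x))\<^sup>2 \<le> 1/16 * ?d\<^sup>2" by (simp add: power_mult_distrib power2_eq_square)
      have "(norm ((A + s *\<^sub>R B) \<rhd> x))\<^sup>2
          = (norm (A \<rhd> x))\<^sup>2 + (r * norm (B \<rhd> x))\<^sup>2 + 2 * (s * Re (cinner (A \<rhd> x) (B \<rhd> x)))"
        unfolding app_add app_scaleR norm_add_sq by (simp add: s cinner_scaleR_right)
      moreover have "s * Re (cinner (A \<rhd> x) (B \<rhd> x)) \<le> r * \<bar>Re (cinner (A \<rhd> x) (B \<rhd> x))\<bar>"
        using s by (metis abs_ge_self abs_mult)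
      ultimately have "(norm ((A + s *\<^sub>R B) \<rhd> x))\<^sup>2 \<le> (norm x)\<^sup>2"
        using nA[of x] cross sq zero_le_power2[of ?d] by linarith
      then have "norm ((A + s *\<^sub>R B) \<rhd> x) \<le> norm x" by (rule power2_le_imp_le) simp
      then show "norm ((A + s *\<^sub>R B) \<rhd> x) \<le> 1 * norm x" by simp
    qed simp
    have "r *\<^sub>R B = 0"
      using perturbed[of r] perturbed[of "- r"] rk(2) X D by (intro unperturbable) (simp_all add: B_def mem)
    then show ?thesis using rk(2) by (simp add: B_def)
  qed
  then have "D' = 0 \<or> D = 0" using prime D by blast
  then show ?thesis by (auto simp: iso_coiso_def D_def D'_def)
qed

text \<open>A perturbation admissible with both signs makes \<open>A\<close> the midpoint of a
  segment in the ball, so extreme points fall under \<open>unperturbable_iso_coiso\<close>.\<close>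

lemma (in vn_factor) extreme_point_iff:
  "A extreme_point_of {A \<in> M. norm A \<le> 1} \<longleftrightarrow> A \<in> M \<and> iso_coiso A"
proof
  assume ext: "A extreme_point_of {A \<in> M. norm A \<le> 1}"
  then have A: "A \<in> M" "norm A \<le> 1" by (auto simp: extreme_point_of_def)
  have "B = 0" if B: "B \<in> M" "norm (A + B) \<le> 1" "norm (A - B) \<le> 1" for B
  proof (rule ccontr)
    assume "B \<noteq> 0"
    have "A = (1 - 1/2) *\<^sub>R (A - B) + (1/2) *\<^sub>R (A + B)"
      by (simp add: scaleR_add_right scaleR_diff_right flip: scaleR_add_left)
    moreover have "A - B \<noteq> A + B"
    proof
      assume "A - B = A + B"
      then have "2 *\<^sub>R B = 0" by (simp add: scaleR_2 algebra_simps)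
      then show False using \<open>B \<noteq> 0\<close> by simp
    qed
    ultimately have "A \<in> open_segment (A - B) (A + B)"
      unfolding in_segment by (intro conjI exI[of _ "1/2"]) auto
    then show False using ext A B by (auto simp: extreme_point_of_def mem)
  qed
  then show "A \<in> M \<and> iso_coiso A" using unperturbable_iso_coiso A by blast
next
  assume "A \<in> M \<and> iso_coiso A"
  then show "A extreme_point_of {A \<in> M. norm A \<le> 1}"
    using iso_coiso_not_in_open_segment norm_iso_coiso_le by (auto simp: extreme_point_of_def)
qed

text \<open>A homomorphism keeps isometries and co-isometries apart, an antihomomorphism exchanges
  them; \<open>iso_coiso\<close> is stable under both.\<close>

lemma (in star_algebra) hom_preserves_iso_coiso:
  assumes U: "unit U" and one: "\<Psi> 1 = 1" and star: "\<And>A. A \<in> M \<Longrightarrow> \<Psi> A\<^sup>\<dagger> = (\<Psi> A)\<^sup>\<dagger>"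
    and mult: "(\<forall>A\<in>M. \<forall>B\<in>M. \<Psi> (A * B) = \<Psi> A * \<Psi> B) \<or> (\<forall>A\<in>M. \<forall>B\<in>M. \<Psi> (A * B) = \<Psi> B * \<Psi> A)"
    and A: "A \<in> M" "iso_coiso A"
  shows "iso_coiso (U * \<Psi> A)"
proof (rule unit_mult_iso_coiso[OF U])
  have "A\<^sup>\<dagger> \<in> M" by (rule star_mem[OF A(1)])
  then have "(\<Psi> (A\<^sup>\<dagger> * A) = (\<Psi> A)\<^sup>\<dagger> * \<Psi> A \<and> \<Psi> (A * A\<^sup>\<dagger>) = \<Psi> A * (\<Psi> A)\<^sup>\<dagger>) \<or>
      (\<Psi> (A\<^sup>\<dagger> * A) = \<Psi> A * (\<Psi> A)\<^sup>\<dagger> \<and> \<Psi> (A * A\<^sup>\<dagger>) = (\<Psi> A)\<^sup>\<dagger> * \<Psi> A)"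
    using mult A(1) star by auto
  then show "iso_coiso (\<Psi> A)" using A(2) one unfolding iso_coiso_def by metis
qed

section \<open>The main theorem\<close>

text \<open>Meaningful at \<open>A\<close> as soon as \<Phi> sends \<open>of_cop A\<close> to a
  complex-linear operator.\<close>

definition cop_map ::
    "(('h::chilbert_space \<Rightarrow>\<^sub>L 'h) \<Rightarrow> ('h \<Rightarrow>\<^sub>L 'h)) \<Rightarrow> 'h cop \<Rightarrow> 'h cop" where
  "cop_map \<Phi> A = cop (\<Phi> (of_cop A))"

context
  fixes M :: "('h::chilbert_space \<Rightarrow>\<^sub>L 'h) set" and N :: "'h cop set"
  assumes M: "M \<subseteq> clinear_ops" and N: "\<And>A. A \<in> N \<longleftrightarrow> of_cop A \<in> M" and alg: "star_algebra N"
begin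

lemma ball_of_cop: "(\<forall>A\<in>M. P A) \<longleftrightarrow> (\<forall>A\<in>N. P (of_cop A))"
  using M N by (metis cop_inverse subsetD)

lemma cop_map_homs:
  assumes \<Phi>: "\<And>A. A \<in> M \<Longrightarrow> \<Phi> A \<in> clinear_ops"
  shows "clinear_map_on M \<Phi> \<longleftrightarrow> clin_on N (cop_map \<Phi>)"
    and "star_homomorphism_on M \<Phi> \<longleftrightarrow> clin_on N (cop_map \<Phi>) \<and>
      (\<forall>A\<in>N. cop_map \<Phi> A\<^sup>\<dagger> = (cop_map \<Phi> A)\<^sup>\<dagger>) \<and>
      (\<forall>A\<in>N. \<forall>B\<in>N. cop_map \<Phi> (A * B) = cop_map \<Phi> A * cop_map \<Phi> B)"
    and "star_antihomomorphism_on M \<Phi> \<longleftrightarrow> clin_on N (cop_map \<Phi>) \<and>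
      (\<forall>A\<in>N. cop_map \<Phi> A\<^sup>\<dagger> = (cop_map \<Phi> A)\<^sup>\<dagger>) \<and>
      (\<forall>A\<in>N. \<forall>B\<in>N. cop_map \<Phi> (A * B) = cop_map \<Phi> B * cop_map \<Phi> A)"
    and "unital \<Phi> \<longleftrightarrow> cop_map \<Phi> 1 = 1"
proof -
  have F: "\<Phi> (of_cop A) = of_cop (cop_map \<Phi> A)" if "A \<in> N" for A
    using that \<Phi> N by (simp add: cop_map_def cop_inverse)
  note mem = star_algebra.mem[OF alg]
  note rep = plus_cop.rep_eq[symmetric] cscale.rep_eq[symmetric] star.rep_eq[symmetric] times_cop.rep_eq[symmetric]
  show lin: "clinear_map_on M \<Phi> \<longleftrightarrow> clin_on N (cop_map \<Phi>)"
    unfolding clinear_map_on_def clin_on_def Pi_iff ball_of_cop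
    by (simp add: rep F mem of_cop_inject N[symmetric] cong: ball_cong)
  show "star_homomorphism_on M \<Phi> \<longleftrightarrow> clin_on N (cop_map \<Phi>) \<and>
      (\<forall>A\<in>N. cop_map \<Phi> A\<^sup>\<dagger> = (cop_map \<Phi> A)\<^sup>\<dagger>) \<and>
      (\<forall>A\<in>N. \<forall>B\<in>N. cop_map \<Phi> (A * B) = cop_map \<Phi> A * cop_map \<Phi> B)"
    unfolding star_homomorphism_on_def lin ball_of_cop
    by (simp add: rep F mem of_cop_inject cong: ball_cong)
  show "star_antihomomorphism_on M \<Phi> \<longleftrightarrow> clin_on N (cop_map \<Phi>) \<and>
      (\<forall>A\<in>N. cop_map \<Phi> A\<^sup>\<dagger> = (cop_map \<Phi> A)\<^sup>\<dagger>) \<and>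
      (\<forall>A\<in>N. \<forall>B\<in>N. cop_map \<Phi> (A * B) = cop_map \<Phi> B * cop_map \<Phi> A)"
    unfolding star_antihomomorphism_on_def lin ball_of_cop
    by (simp add: rep F mem of_cop_inject cong: ball_cong)
  show "unital \<Phi> \<longleftrightarrow> cop_map \<Phi> 1 = 1"
    unfolding unital_def one_cop.rep_eq[symmetric] F[OF star_algebra.one_mem[OF alg]] by (rule of_cop_inject)
qed

lemma extreme_point_of_cop:
  "of_cop A extreme_point_of unit_ball M \<longleftrightarrow> A extreme_point_of {A \<in> N. norm A \<le> 1}"
proof -
  have ball: "unit_ball M = of_cop ` {A \<in> N. norm A \<le> 1}"
    using M by (auto simp: unit_ball_def N norm_cop.rep_eq image_iff) (metis cop_inverse subsetD)
  have "of_cop A \<in> open_segment (of_cop B) (of_cop C) \<longleftrightarrow> A \<in> open_segment B C" for B C :: "'h cop"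
    by (simp add: in_segment of_cop_inject flip: scaleR_cop.rep_eq plus_cop.rep_eq)
  then show ?thesis by (simp add: extreme_point_of_def ball inj_image_mem_iff inj_def of_cop_inject)
qed

end

lemma factor_cop:
  assumes M: "factor M" and N: "\<And>A. A \<in> N \<longleftrightarrow> of_cop A \<in> M"
  shows "vn_factor N"
proof -
  have vn: "M \<subseteq> clinear_ops" "\<And>A B. A \<in> M \<Longrightarrow> B \<in> M \<Longrightarrow> A + B \<in> M \<and> A o\<^sub>L B \<in> M"
    "\<And>c A. A \<in> M \<Longrightarrow> scaleC_op c A \<in> M" "\<And>A. A \<in> M \<Longrightarrow> adjoint_op A \<in> M"
    "commutant (commutant M) = M"
    using M by (auto simp: factor_def von_neumann_algebra_def)
  have centre: "centre M = range (\<lambda>c. scaleC_op c id_blinfun)" using M by (simp add: factor_def)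
  show ?thesis
  proof
    show "1 \<in> N"
    proof -
      \<comment> \<open>The identity is a scalar operator, so the description of the centre puts it
        into \<open>M\<close>.\<close>
      have "of_cop (1 \<odot> 1) \<in> centre M" unfolding centre cscale.rep_eq one_cop.rep_eq by blast
      then show ?thesis by (simp add: N centre_def)
    qed
    show "B \<in> N" if B: "\<And>T. (\<And>A. A \<in> N \<Longrightarrow> A * T = T * A) \<Longrightarrow> B * T = T * B" for B
    proof -
      have "S o\<^sub>L of_cop B = of_cop B o\<^sub>L S" if S: "S \<in> commutant M" for S
      proof -
        obtain T where T: "S = of_cop T" using S by (metis (no_types, lifting) CollectD commutant_def cop_inverse)
        have "A * T = T * A" if "A \<in> N" for A
          using S that by (simp add: commutant_def N T flip: times_cop.rep_eq) (metis of_cop_inject times_cop.rep_eq)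
        then have "B * T = T * B" by (rule B)
        then show ?thesis by (simp add: T flip: times_cop.rep_eq)
      qed
      then have "of_cop B \<in> commutant (commutant M)"
        using of_cop unfolding commutant_def by blast
      then show ?thesis by (simp add: N vn)
    qed
    show "\<exists>c. A = c \<odot> 1" if A: "A \<in> N" "\<And>B. B \<in> N \<Longrightarrow> A * B = B * A" for A
    proof -
      have "of_cop A o\<^sub>L B = B o\<^sub>L of_cop A" if "B \<in> M" for B
        using A(2)[of "cop B"] that vn(1) by (metis N cop_inverse subsetD times_cop.rep_eq)
      then have "of_cop A \<in> centre M" using A(1) by (simp add: centre_def N)
      then obtain c where "of_cop A = scaleC_op c id_blinfun" unfolding centre by blast
      then have "A = c \<odot> 1" by (simp add: cscale.rep_eq one_cop.rep_eq flip: of_cop_inject)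
      then show ?thesis by blast
    qed
  qed (simp_all add: N plus_cop.rep_eq times_cop.rep_eq star.rep_eq cscale.rep_eq vn)
qed

lemma unitary_op_cop: "unitary_op (of_cop U) \<longleftrightarrow> unit U"
  using of_cop[of U]
  by (simp add: unitary_op_def unit_def of_cop_inject flip: star.rep_eq times_cop.rep_eq one_cop.rep_eq)

theorem theorem1:
  fixes M :: "('h::chilbert_space \<Rightarrow>\<^sub>L 'h) set"
    and \<Phi> :: "('h \<Rightarrow>\<^sub>L 'h) \<Rightarrow> ('h \<Rightarrow>\<^sub>L 'h)"
  assumes "infinite_factor M"
    and "clinear_map_on M \<Phi>"
  shows "preserves_extreme_points M \<Phi> \<longleftrightarrow>
    (\<exists>U\<in>M. \<exists>\<Psi>. unitary_op U \<and> star_homomorphism_on M \<Psi> \<and> unital \<Psi> \<and>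
       (\<forall>A\<in>M. \<Phi> A = U o\<^sub>L \<Psi> A)) \<or>
    (\<exists>U'\<in>M. \<exists>\<Psi>'. unitary_op U' \<and> star_antihomomorphism_on M \<Psi>' \<and> unital \<Psi>' \<and>
       (\<forall>A\<in>M. \<Phi> A = U' o\<^sub>L \<Psi>' A))"
    (is "_ \<longleftrightarrow> ?hom \<or> ?anti")
proof -
  define N where "N = {A. of_cop A \<in> M}"
  have N: "A \<in> N \<longleftrightarrow> of_cop A \<in> M" for A by (simp add: N_def)
  have M: "factor M" "M \<subseteq> clinear_ops"
    using assms(1) by (auto simp: infinite_factor_def factor_def von_neumann_algebra_def)
  interpret vn_factor N by (rule factor_cop[OF M(1) N])
  note ctx = M(2) N star_algebra_axioms
  have MN: "\<exists>B\<in>N. A = of_cop B" if "A \<in> M" for A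
    using that M(2) N by (metis cop_inverse subsetD)
  have \<Phi>M: "\<Phi> A \<in> M" if "A \<in> M" for A using assms(2) that by (auto simp: clinear_map_on_def)
  then have \<Phi>cl: "\<Phi> A \<in> clinear_ops" if "A \<in> M" for A using that M(2) by blast
  have lin: "clin_on N (cop_map \<Phi>)" using cop_map_homs(1)[OF ctx, of \<Phi>, OF \<Phi>cl] assms(2) by blast
  have \<Phi>_cop: "\<Phi> (of_cop A) = of_cop (cop_map \<Phi> A)" if "A \<in> N" for A
    using that \<Phi>cl N by (simp add: cop_map_def cop_inverse)
  have extreme: "of_cop A extreme_point_of unit_ball M \<longleftrightarrow> A \<in> N \<and> iso_coiso A" for A
    unfolding extreme_point_of_cop[OF ctx] extreme_point_iff ..
  have pres: "preserves_extreme_points M \<Phi> \<longleftrightarrow> preserves_iso_coiso N (cop_map \<Phi>)"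
  proof -
    have "preserves_extreme_points M \<Phi> \<longleftrightarrow>
        (\<forall>A\<in>M. A extreme_point_of unit_ball M \<longrightarrow> \<Phi> A extreme_point_of unit_ball M)"
      by (auto simp: preserves_extreme_points_def extreme_point_of_def unit_ball_def)
    also have "\<dots> \<longleftrightarrow> preserves_iso_coiso N (cop_map \<Phi>)"
      unfolding ball_of_cop[OF ctx] preserves_iso_coiso_def using clin_mem[OF lin] by (simp add: \<Phi>_cop extreme cong: ball_cong)
    finally show ?thesis .
  qed
  have backward: "preserves_extreme_points M \<Phi>"
    if U: "U \<in> M" "unitary_op U" and \<Psi>: "star_homomorphism_on M \<Psi> \<or> star_antihomomorphism_on M \<Psi>" "unital \<Psi>"
      and \<Phi>: "\<forall>A\<in>M. \<Phi> A = U o\<^sub>L \<Psi> A" for U \<Psi>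
  proof -
    have \<Psi>cl: "\<Psi> A \<in> clinear_ops" if "A \<in> M" for A
      using \<Psi>(1) that M(2) by (auto simp: star_homomorphism_on_def star_antihomomorphism_on_def clinear_map_on_def)
    note hom = cop_map_homs[OF ctx, of \<Psi>, OF \<Psi>cl]
    obtain V where V: "U = of_cop V" using MN U(1) by blast
    have \<Psi>_cop: "\<Psi> (of_cop A) = of_cop (cop_map \<Psi> A)" if "A \<in> N" for A
      using that \<Psi>cl N by (simp add: cop_map_def cop_inverse)
    have "cop_map \<Phi> A = V * cop_map \<Psi> A" if "A \<in> N" for A
      using \<Phi>_cop[OF that] \<Psi>_cop[OF that] \<Phi> that by (metis N V of_cop_inject times_cop.rep_eq)
    moreover have "iso_coiso (V * cop_map \<Psi> A)" if "A \<in> N" "iso_coiso A" for A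
      using that U(2) \<Psi> hom unitary_op_cop[of V] V by (intro hom_preserves_iso_coiso) auto
    ultimately show ?thesis unfolding pres by (simp add: preserves_iso_coiso_def)
  qed
  have forward: "?hom \<or> ?anti" if preserves: "preserves_extreme_points M \<Phi>"
  proof -
    \<comment> \<open>\<open>V\<close> implements the equivalence of the identity with a proper
      subprojection, which is its range projection.\<close>
    have "\<exists>V\<in>M. adjoint_op V o\<^sub>L V = id_blinfun \<and> V o\<^sub>L adjoint_op V \<noteq> id_blinfun"
      using assms(1) by (auto simp: infinite_factor_def infinite_projection_def mvn_equiv_def)
    then obtain V where V: "V \<in> N" "V\<^sup>\<dagger> * V = 1" "V * V\<^sup>\<dagger> \<noteq> 1"
      using MN by (metis of_cop_inject one_cop.rep_eq star.rep_eq times_cop.rep_eq)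
    \<comment> \<open>If \<open>1 = 0\<close>, all operators coincide, against the properness of
      \<open>V\<close>.\<close>
    then have "(1 :: 'h cop) \<noteq> 0" by (metis mult_1 mult_zero_left)
    moreover obtain V1 V2 where "V1 \<in> N" "V2 \<in> N" "V1\<^sup>\<dagger> * V1 = 1" "V2\<^sup>\<dagger> * V2 = 1" "V1\<^sup>\<dagger> * V2 = 0"
      using orthogonal_isometries[OF V] by blast
    ultimately interpret properly_infinite_vn_algebra N V1 V2 by unfold_locales auto
    obtain U \<psi> where U: "U \<in> N" "unit U" and \<psi>: "clin_on N \<psi>" "\<psi> 1 = 1" "\<forall>A\<in>N. \<psi> A\<^sup>\<dagger> = (\<psi> A)\<^sup>\<dagger>"
      "(\<forall>A\<in>N. \<forall>B\<in>N. \<psi> (A * B) = \<psi> A * \<psi> B) \<or> (\<forall>A\<in>N. \<forall>B\<in>N. \<psi> (A * B) = \<psi> B * \<psi> A)"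
      and \<Phi>: "\<forall>A. cop_map \<Phi> A = U * \<psi> A"
      using iso_coiso_preserver_structure[OF lin] preserves unfolding pres by blast
    define \<Psi> where "\<Psi> = (\<lambda>A. of_cop (\<psi> (cop A)))"
    have \<Psi>\<psi>: "cop_map \<Psi> = \<psi>" by (rule ext) (simp add: cop_map_def \<Psi>_def of_cop_inverse)
    note hom = cop_map_homs[OF ctx, of \<Psi>, unfolded \<Psi>\<psi>]
    have cl: "\<Psi> A \<in> clinear_ops" for A unfolding \<Psi>_def by (rule of_cop)
    have "\<Phi> A = of_cop U o\<^sub>L \<Psi> A" if "A \<in> M" for A
      using MN[OF that] \<Phi> \<Phi>_cop by (metis (no_types, lifting) \<Psi>_def of_cop_inverse times_cop.rep_eq)
    moreover have "unitary_op (of_cop U)" "of_cop U \<in> M" "unital \<Psi>"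
      "star_homomorphism_on M \<Psi> \<or> star_antihomomorphism_on M \<Psi>"
      using U \<psi> hom[OF cl] N by (auto simp: unitary_op_cop)
    ultimately show ?thesis by blast
  qed
  show ?thesis using forward backward by blast
qed

end
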